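(* Let $(\mathscr{A},d_{\mathscr{A}})$ be a commutative differential graded algebra over $\mathbb{K}$, let $\delta:\mathscr{A}\to\Omega$ be a dg derivation valued in a dg $\mathscr{A}$-module $(\Omega,\partial_{\mathscr{A}})$, let $\mathcal{B}=\Omega^\vee$ be the dual dg $\mathscr{A}$-module, and let $\nabla$ be a $\delta$-connection on $\mathcal{B}$. Then $\mathcal{B}$, endowed with the structure maps $\{\mathcal{R}^\nabla_k:\mathcal{B}^{\otimes k}\to\mathcal{B}\}_{k\ge1}$, is a Leibniz$_\infty[1]$ $\mathscr{A}$-algebra.
   Context: Conventions. $\mathbb{K}$ is a field of characteristic zero; graded means $\mathbb{Z}$-graded; the Koszul sign rule is used; $\otimes$ without subscript is over $\mathbb{K}$. A cdga $(\mathscr{A},d_{\mathscr{A}})$ is a graded-commutative $\mathbb{K}$-algebra with a degree $1$ square-zero derivation. A dg $\mathscr{A}$-module is a graded $\mathscr{A}$-module $E$ with a degree $1$, square-zero, $\mathbb{K}$-linear map $\partial_{\mathscr{A}}$ with $\partial_{\mathscr{A}}(ae)=(d_{\mathscr{A}}a)e+(-1)^{|a|}a\,\partial_{\mathscr{A}}e$ (the same symbol $\partial_{\mathscr{A}}$ is used for all dg modules). All $\mathscr{A}$-modules considered are assumed projective. The dual is $\Omega^\vee=\mathrm{Hom}_{\mathscr{A}}(\Omega,\mathscr{A})$ with the induced differential. dg derivation: a degree $0$ map $\delta:\mathscr{A}\to\Omega$ with $\delta(ab)=\delta(a)b+a\delta(b)$ and $\delta\circ d_{\mathscr{A}}=\partial_{\mathscr{A}}\circ\delta$.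 $\delta$-connection on an $\mathscr{A}$-module $E$: a degree $0$ $\mathbb{K}$-linear map $\nabla:E\to\Omega\otimes_{\mathscr{A}}E$ with $\nabla(ae)=\delta(a)\otimes e+a\nabla(e)$. For $b\in\mathcal{B}$ put $\nabla_b e=\iota_b\nabla(e)$ (contraction of $b$ with the $\Omega$ factor), and extend $\nabla_b$ to tensor products by $\nabla_b(e_1\otimes\cdots\otimes e_n)=\sum_i(-1)^{|b|(|e_1|+\cdots+|e_{i-1}|)}e_1\otimes\cdots\otimes\nabla_be_i\otimes\cdots\otimes e_n$. Structure maps: $\mathcal{R}^\nabla_1=\partial_{\mathscr{A}}$; $\mathcal{R}^\nabla_2(b,e)=\nabla_{\partial_{\mathscr{A}}b}e-\partial_{\mathscr{A}}(\nabla_be)+(-1)^{|b|}\nabla_b(\partial_{\mathscr{A}}e)$ (the $\delta$-twisted Atiyah cocycle); and for $k\ge2$, $\mathcal{R}^\nabla_{k+1}(b_0,b_1,\dots,b_k)=(-1)^{|b_0|}[\nabla_{b_0},\mathcal{R}^\nabla_k](b_1,\dots,b_k)=(-1)^{|b_0|}\nabla_{b_0}\big(\mathcal{R}^\nabla_k(b_1,\dots,b_k)\big)-\mathcal{R}^\nabla_k\big(\nabla_{b_0}(b_1\otimes\cdots\otimes b_k)\big)$. Leibniz$_\infty[1]$ algebra: a graded $\mathbb{K}$-vector space $V$ with degree $1$ $\mathbb{K}$-multilinear maps $\lambda_k:V^{\otimes k}\to V$, $k\ge1$, such that for all $n\ge1$ and homogeneous $v_i$, $$\sum_{i+j=n+1}\sum_{k=j}^{n}\sum_{\sigma\in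 \mathrm{sh}(k-j,j-1)}\epsilon(\sigma)(-1)^{|v_{\sigma(1)}|+\cdots+|v_{\sigma(k-j)}|}\lambda_i\big(v_{\sigma(1)},\dots,v_{\sigma(k-j)},\lambda_j(v_{\sigma(k-j+1)},\dots,v_{\sigma(k-1)},v_k),v_{k+1},\dots,v_n\big)=0,$$ where $i,j\geq 1$, $\mathrm{sh}(p,q)$ is the set of $(p,q)$-shuffles of $\{1,\dots,p+q\}$ and $\epsilon(\sigma)$ is the Koszul sign. It is a Leibniz$_\infty[1]$ $\mathscr{A}$-algebra if $(V,\lambda_1)$ is a dg $\mathscr{A}$-module and all $\lambda_k$, $k\ge2$, are $\mathscr{A}$-multilinear (in the graded sense). *)

theory Defs
  imports
    Complex_Main
    "HOL-Library.Function_Algebras"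
    "HOL-Library.Poly_Mapping"
    "HOL-Combinatorics.Permutations"
begin

text \<open>
  A \<open>\<int>\<close>-graded object is given by its homogeneous components, which form an independent family of
  subspaces of an ambient \<open>\<bbbK>\<close>-vector space; the object itself is the internal direct sum of the
  components. (Multi)linear maps between graded objects are given by their values on homogeneous
  elements: linearity is required on each component, and the values of the representing function
  on other elements of the ambient type are irrelevant.
\<close>

record ('k, 'v) graded_space =
  scl :: "'k \<Rightarrow> 'v \<Rightarrow> 'v"
  cmp :: "int \<Rightarrow> 'v set"

record ('k, 'a, 'v) graded_mod = "('k, 'v) graded_space" +
  act :: "'a \<Rightarrow> 'v \<Rightarrow> 'v"

definition graded_space :: "('k::field_char_0, 'v::ab_group_add, 'z) graded_space_scheme \<Rightarrow> bool" where
  "graded_space V \<longleftrightarrow>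
     vector_space (scl V) \<and>
     (\<forall>n. module.subspace (scl V) (cmp V n)) \<and>
     (\<forall>N x. finite N \<and> (\<forall>n\<in>N. x n \<in> cmp V n) \<and> (\<Sum>n\<in>N. x n) = 0 \<longrightarrow> (\<forall>n\<in>N. x n = 0))"

definition homogeneous :: "('k, 'v, 'z) graded_space_scheme \<Rightarrow> 'v set" where
  "homogeneous V = (\<Union>n. cmp V n)"

text \<open>The degree of a nonzero homogeneous element is unique; that of \<open>0\<close> is an arbitrary integer,
  which only ever enters as the sign in front of a zero term.\<close>

definition deg :: "('k, 'v, 'z) graded_space_scheme \<Rightarrow> 'v \<Rightarrow> int" where
  "deg V v = (SOME n. v \<in> cmp V n)"

text \<open>\<open>sg n v\<close> is \<open>(-1)\<^sup>n v\<close>.\<close>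

definition sg :: "int \<Rightarrow> 'v::ab_group_add \<Rightarrow> 'v" where
  "sg n v = (if even n then v else - v)"

definition graded_linear ::
  "('k, 'v::ab_group_add, 'y) graded_space_scheme \<Rightarrow> ('k, 'w::ab_group_add, 'z) graded_space_scheme
     \<Rightarrow> int \<Rightarrow> ('v \<Rightarrow> 'w) \<Rightarrow> bool" where
  "graded_linear V W p f \<longleftrightarrow>
     (\<forall>n. \<forall>v\<in>cmp V n. f v \<in> cmp W (n + p)) \<and>
     (\<forall>n. \<forall>u\<in>cmp V n. \<forall>v\<in>cmp V n. f (u + v) = f u + f v) \<and>
     (\<forall>n. \<forall>v\<in>cmp V n. \<forall>c. f (scl V c v) = scl W c (f v))"


section \<open>Differential graded algebras and modules\<close>

text \<open>The product and the unit of the algebra are those of the ambient ring. The sort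
  \<open>{ring, monoid_mult}\<close> is that of unital rings in which \<open>0 = 1\<close> is allowed.\<close>

definition cdga ::
  "('k::field_char_0, 'a::{ring,monoid_mult}) graded_space \<Rightarrow> ('a \<Rightarrow> 'a) \<Rightarrow> bool" where
  "cdga A d \<longleftrightarrow>
     graded_space A \<and>
     1 \<in> cmp A 0 \<and>
     (\<forall>i j. \<forall>x\<in>cmp A i. \<forall>y\<in>cmp A j.
        x * y \<in> cmp A (i + j) \<and> x * y = sg (i * j) (y * x) \<and>
        (\<forall>c. scl A c (x * y) = scl A c x * y \<and> scl A c (x * y) = x * scl A c y)) \<and>
     graded_linear A A 1 d \<and>
     (\<forall>i. \<forall>x\<in>cmp A i. d (d x) = 0) \<and>
     (\<forall>i j. \<forall>x\<in>cmp A i. \<forall>y\<in>cmp A j. d (x * y) = d x * y + sg i (x * d y))"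

definition graded_module ::
  "('k::field_char_0, 'a::{ring,monoid_mult}) graded_space
     \<Rightarrow> ('k, 'a, 'm::ab_group_add) graded_mod \<Rightarrow> bool" where
  "graded_module A M \<longleftrightarrow>
     graded_space M \<and>
     (\<forall>i j. \<forall>a\<in>cmp A i. \<forall>m\<in>cmp M j. act M a m \<in> cmp M (i + j)) \<and>
     (\<forall>i j. \<forall>a\<in>cmp A i. \<forall>b\<in>cmp A i. \<forall>m\<in>cmp M j. act M (a + b) m = act M a m + act M b m) \<and>
     (\<forall>i j. \<forall>a\<in>cmp A i. \<forall>m\<in>cmp M j. \<forall>m'\<in>cmp M j. act M a (m + m') = act M a m + act M a m') \<and>
     (\<forall>i j. \<forall>a\<in>cmp A i. \<forall>m\<in>cmp M j. \<forall>c.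
        act M (scl A c a) m = scl M c (act M a m) \<and> act M a (scl M c m) = scl M c (act M a m)) \<and>
     (\<forall>i j k. \<forall>a\<in>cmp A i. \<forall>b\<in>cmp A j. \<forall>m\<in>cmp M k. act M (a * b) m = act M a (act M b m)) \<and>
     (\<forall>j. \<forall>m\<in>cmp M j. act M 1 m = m)"

definition dg_module ::
  "('k::field_char_0, 'a::{ring,monoid_mult}) graded_space \<Rightarrow> ('a \<Rightarrow> 'a)
     \<Rightarrow> ('k, 'a, 'm::ab_group_add) graded_mod \<Rightarrow> ('m \<Rightarrow> 'm) \<Rightarrow> bool" where
  "dg_module A d M dM \<longleftrightarrow>
     graded_module A M \<and>
     graded_linear M M 1 dM \<and>
     (\<forall>j. \<forall>m\<in>cmp M j. dM (dM m) = 0) \<and>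
     (\<forall>i j. \<forall>a\<in>cmp A i. \<forall>m\<in>cmp M j. dM (act M a m) = act M (d a) m + sg i (act M a (dM m)))"

definition module_hom ::
  "('k::field_char_0, 'a::{ring,monoid_mult}) graded_space
     \<Rightarrow> ('k, 'a, 'm::ab_group_add) graded_mod \<Rightarrow> ('k, 'a, 'n::ab_group_add) graded_mod
     \<Rightarrow> int \<Rightarrow> ('m \<Rightarrow> 'n) \<Rightarrow> bool" where
  "module_hom A M N p f \<longleftrightarrow>
     graded_linear M N p f \<and>
     (\<forall>i j. \<forall>a\<in>cmp A i. \<forall>m\<in>cmp M j. f (act M a m) = sg (i * p) (act N a (f m)))"

text \<open>The free graded module \<open>\<Oplus>\<^sub>i A\<cdot>e\<^sub>i\<close> on generators \<open>e\<^sub>i\<close> of degree \<open>g i\<close>; an element \<open>\<Sum>\<^sub>i x\<^sub>i e\<^sub>i\<close> is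
  represented by its finitely supported family of coefficients.\<close>

definition free_module ::
  "('k::field_char_0, 'a::{ring,monoid_mult}) graded_space \<Rightarrow> ('i \<Rightarrow> int)
     \<Rightarrow> ('k, 'a, 'i \<Rightarrow>\<^sub>0 'a) graded_mod" where
  "free_module A g =
     \<lparr> scl = (\<lambda>c. Poly_Mapping.map (scl A c)),
       cmp = (\<lambda>n. {x. \<forall>i. Poly_Mapping.lookup x i \<in> cmp A (n - g i)}),
       act = (\<lambda>a. Poly_Mapping.map ((*) a)) \<rparr>"

text \<open>A projective graded module is a direct summand of a free graded module. The basis of the
  latter is indexed by the type \<open>'i\<close>.\<close>

definition projective_module ::
  "'i itself \<Rightarrow> ('k::field_char_0, 'a::{ring,monoid_mult}) graded_space
     \<Rightarrow> ('k, 'a, 'm::ab_group_add) graded_mod \<Rightarrow> bool" where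
  "projective_module I A M \<longleftrightarrow>
     (\<exists>(g :: 'i \<Rightarrow> int) s p.
        module_hom A M (free_module A g) 0 s \<and>
        module_hom A (free_module A g) M 0 p \<and>
        (\<forall>n. \<forall>m\<in>cmp M n. p (s m) = m))"


section \<open>The dual module\<close>

definition self_module ::
  "('k, 'a::{ring,monoid_mult}) graded_space \<Rightarrow> ('k, 'a, 'a) graded_mod" where
  "self_module A = \<lparr> scl = scl A, cmp = cmp A, act = (*) \<rparr>"

text \<open>\<open>Hom\<^sub>A(\<Omega>, A)\<close>. To be determined by its values on homogeneous elements, the function representing
  a homomorphism is required to vanish on all other elements of the ambient type.\<close>

definition dual ::
  "('k::field_char_0, 'a::{ring,monoid_mult}) graded_space
     \<Rightarrow> ('k, 'a, 'w::ab_group_add) graded_mod \<Rightarrow> ('k, 'a, 'w \<Rightarrow> 'a) graded_mod" where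
  "dual A \<Omega> =
     \<lparr> scl = (\<lambda>c f w. scl A c (f w)),
       cmp = (\<lambda>n. {f. module_hom A \<Omega> (self_module A) n f \<and> (\<forall>w. w \<notin> homogeneous \<Omega> \<longrightarrow> f w = 0)}),
       act = (\<lambda>a f w. a * f w) \<rparr>"

definition dual_diff ::
  "('k::field_char_0, 'a::{ring,monoid_mult}) graded_space \<Rightarrow> ('a \<Rightarrow> 'a)
     \<Rightarrow> ('k, 'a, 'w::ab_group_add) graded_mod \<Rightarrow> ('w \<Rightarrow> 'w) \<Rightarrow> ('w \<Rightarrow> 'a) \<Rightarrow> ('w \<Rightarrow> 'a)" where
  "dual_diff A d \<Omega> d\<Omega> f =
     (\<lambda>w. if w \<in> homogeneous \<Omega> then d (f w) - sg (deg (dual A \<Omega>) f) (f (d\<Omega> w)) else 0)"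


section \<open>The tensor product over the algebra\<close>

text \<open>\<open>\<Omega> \<otimes>\<^sub>A E\<close> is the quotient of the \<open>\<bbbK>\<close>-vector space of finitely supported functions on pairs by the
  span of \<open>tensor_relators\<close>; its elements are cosets. The right action on \<open>\<Omega>\<close> is
  \<open>\<omega> a = (-1)\<^bsup>|a||\<omega>|\<^esup> a \<omega>\<close>.\<close>

definition free_scl :: "'k::field_char_0 \<Rightarrow> ('p \<Rightarrow>\<^sub>0 'k) \<Rightarrow> ('p \<Rightarrow>\<^sub>0 'k)" where
  "free_scl c = Poly_Mapping.map ((*) c)"

definition gen :: "'w \<Rightarrow> 'e \<Rightarrow> ('w \<times> 'e \<Rightarrow>\<^sub>0 'k::field_char_0)" where
  "gen w e = Poly_Mapping.single (w, e) 1"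

text \<open>The linear extension of a function on basis elements.\<close>

definition lin_ext :: "('k::field_char_0 \<Rightarrow> 'v \<Rightarrow> 'v::ab_group_add) \<Rightarrow> ('p \<Rightarrow> 'v) \<Rightarrow> ('p \<Rightarrow>\<^sub>0 'k) \<Rightarrow> 'v" where
  "lin_ext s f x = (\<Sum>p\<in>Poly_Mapping.keys x. s (Poly_Mapping.lookup x p) (f p))"

definition tensor_relators ::
  "('k::field_char_0, 'a::{ring,monoid_mult}) graded_space
     \<Rightarrow> ('k, 'a, 'w::ab_group_add) graded_mod \<Rightarrow> ('k, 'a, 'e::ab_group_add) graded_mod
     \<Rightarrow> ('w \<times> 'e \<Rightarrow>\<^sub>0 'k) set" where
  "tensor_relators A \<Omega> E =
     {gen (w + w') e - gen w e - gen w' e | w w' e i j. w \<in> cmp \<Omega> i \<and> w' \<in> cmp \<Omega> i \<and> e \<in> cmp E j} \<union>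
     {gen w (e + e') - gen w e - gen w e' | w e e' i j. w \<in> cmp \<Omega> i \<and> e \<in> cmp E j \<and> e' \<in> cmp E j} \<union>
     {gen (scl \<Omega> c w) e - free_scl c (gen w e) | c w e i j. w \<in> cmp \<Omega> i \<and> e \<in> cmp E j} \<union>
     {gen w (act E a e) - sg (k * i) (gen (act \<Omega> a w) e) | a w e k i j.
        a \<in> cmp A k \<and> w \<in> cmp \<Omega> i \<and> e \<in> cmp E j}"

definition coset ::
  "('k::field_char_0, 'a::{ring,monoid_mult}) graded_space
     \<Rightarrow> ('k, 'a, 'w::ab_group_add) graded_mod \<Rightarrow> ('k, 'a, 'e::ab_group_add) graded_mod
     \<Rightarrow> ('w \<times> 'e \<Rightarrow>\<^sub>0 'k) \<Rightarrow> ('w \<times> 'e \<Rightarrow>\<^sub>0 'k) set" where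
  "coset A \<Omega> E x = {y. y - x \<in> module.span free_scl (tensor_relators A \<Omega> E)}"

definition tensor_cmp ::
  "('k::field_char_0, 'a::{ring,monoid_mult}) graded_space
     \<Rightarrow> ('k, 'a, 'w::ab_group_add) graded_mod \<Rightarrow> ('k, 'a, 'e::ab_group_add) graded_mod
     \<Rightarrow> int \<Rightarrow> ('w \<times> 'e \<Rightarrow>\<^sub>0 'k) set set" where
  "tensor_cmp A \<Omega> E n =
     coset A \<Omega> E ` {x. \<forall>(w, e)\<in>Poly_Mapping.keys x. \<exists>i j. w \<in> cmp \<Omega> i \<and> e \<in> cmp E j \<and> i + j = n}"

definition tensor_add ::
  "('k::field_char_0, 'a::{ring,monoid_mult}) graded_space
     \<Rightarrow> ('k, 'a, 'w::ab_group_add) graded_mod \<Rightarrow> ('k, 'a, 'e::ab_group_add) graded_mod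
     \<Rightarrow> ('w \<times> 'e \<Rightarrow>\<^sub>0 'k) set \<Rightarrow> ('w \<times> 'e \<Rightarrow>\<^sub>0 'k) set \<Rightarrow> ('w \<times> 'e \<Rightarrow>\<^sub>0 'k) set" where
  "tensor_add A \<Omega> E X Y = (\<Union>x\<in>X. \<Union>y\<in>Y. coset A \<Omega> E (x + y))"

definition tensor_scl ::
  "('k::field_char_0, 'a::{ring,monoid_mult}) graded_space
     \<Rightarrow> ('k, 'a, 'w::ab_group_add) graded_mod \<Rightarrow> ('k, 'a, 'e::ab_group_add) graded_mod
     \<Rightarrow> 'k \<Rightarrow> ('w \<times> 'e \<Rightarrow>\<^sub>0 'k) set \<Rightarrow> ('w \<times> 'e \<Rightarrow>\<^sub>0 'k) set" where
  "tensor_scl A \<Omega> E c X = (\<Union>x\<in>X. coset A \<Omega> E (free_scl c x))"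

definition tensor_act ::
  "('k::field_char_0, 'a::{ring,monoid_mult}) graded_space
     \<Rightarrow> ('k, 'a, 'w::ab_group_add) graded_mod \<Rightarrow> ('k, 'a, 'e::ab_group_add) graded_mod
     \<Rightarrow> 'a \<Rightarrow> ('w \<times> 'e \<Rightarrow>\<^sub>0 'k) set \<Rightarrow> ('w \<times> 'e \<Rightarrow>\<^sub>0 'k) set" where
  "tensor_act A \<Omega> E a X =
     (\<Union>x\<in>X. coset A \<Omega> E (lin_ext free_scl (\<lambda>(w, e). gen (act \<Omega> a w) e) x))"

text \<open>The contraction \<open>\<iota>\<^sub>b : \<Omega> \<otimes>\<^sub>A E \<rightarrow> E\<close>, \<open>\<omega> \<otimes> e \<mapsto> b(\<omega>) e\<close>; its value on a coset is the common value on
  all representatives.\<close>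

definition contraction ::
  "('k::field_char_0, 'a::{ring,monoid_mult}, 'e::ab_group_add) graded_mod
     \<Rightarrow> ('w \<Rightarrow> 'a) \<Rightarrow> ('w \<times> 'e \<Rightarrow>\<^sub>0 'k) set \<Rightarrow> 'e" where
  "contraction E b X = the_elem ((\<lambda>x. lin_ext (scl E) (\<lambda>(w, e). act E (b w) e) x) ` X)"


section \<open>Derivations and connections\<close>

text \<open>The term \<open>\<delta>(a) b\<close> uses the right action \<open>\<omega> b = (-1)\<^bsup>|b||\<omega>|\<^esup> b \<omega>\<close>.\<close>

definition dg_derivation ::
  "('k::field_char_0, 'a::{ring,monoid_mult}) graded_space \<Rightarrow> ('a \<Rightarrow> 'a)
     \<Rightarrow> ('k, 'a, 'w::ab_group_add) graded_mod \<Rightarrow> ('w \<Rightarrow> 'w) \<Rightarrow> ('a \<Rightarrow> 'w) \<Rightarrow> bool" where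
  "dg_derivation A d \<Omega> d\<Omega> \<delta> \<longleftrightarrow>
     graded_linear A \<Omega> 0 \<delta> \<and>
     (\<forall>i j. \<forall>a\<in>cmp A i. \<forall>b\<in>cmp A j. \<delta> (a * b) = sg (i * j) (act \<Omega> b (\<delta> a)) + act \<Omega> a (\<delta> b)) \<and>
     (\<forall>i. \<forall>a\<in>cmp A i. \<delta> (d a) = d\<Omega> (\<delta> a))"

definition connection ::
  "('k::field_char_0, 'a::{ring,monoid_mult}) graded_space
     \<Rightarrow> ('k, 'a, 'w::ab_group_add) graded_mod \<Rightarrow> ('a \<Rightarrow> 'w)
     \<Rightarrow> ('k, 'a, 'e::ab_group_add) graded_mod \<Rightarrow> ('e \<Rightarrow> ('w \<times> 'e \<Rightarrow>\<^sub>0 'k) set) \<Rightarrow> bool" where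
  "connection A \<Omega> \<delta> E nabla \<longleftrightarrow>
     (\<forall>n. \<forall>e\<in>cmp E n. nabla e \<in> tensor_cmp A \<Omega> E n) \<and>
     (\<forall>n. \<forall>e\<in>cmp E n. \<forall>e'\<in>cmp E n. nabla (e + e') = tensor_add A \<Omega> E (nabla e) (nabla e')) \<and>
     (\<forall>n. \<forall>e\<in>cmp E n. \<forall>c. nabla (scl E c e) = tensor_scl A \<Omega> E c (nabla e)) \<and>
     (\<forall>i n. \<forall>a\<in>cmp A i. \<forall>e\<in>cmp E n.
        nabla (act E a e) =
          tensor_add A \<Omega> E (coset A \<Omega> E (gen (\<delta> a) e)) (tensor_act A \<Omega> E a (nabla e)))"

text \<open>\<open>cov E nabla b e\<close> is \<open>\<nabla>\<^sub>b e\<close>.\<close>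

definition cov ::
  "('k::field_char_0, 'a::{ring,monoid_mult}, 'e::ab_group_add) graded_mod
     \<Rightarrow> ('e \<Rightarrow> ('w \<times> 'e \<Rightarrow>\<^sub>0 'k) set) \<Rightarrow> ('w \<Rightarrow> 'a) \<Rightarrow> 'e \<Rightarrow> 'e" where
  "cov E nabla b e = contraction E b (nabla e)"


section \<open>The structure maps\<close>

text \<open>A \<open>k\<close>-linear map is applied to the list of its \<open>k\<close> arguments. For multilinear \<open>f\<close>,
  \<open>after_derivation V p D f [e\<^sub>1, \<dots>, e\<^sub>n]\<close> is \<open>f (D(e\<^sub>1 \<otimes> \<dots> \<otimes> e\<^sub>n))\<close>, where \<open>D\<close> is a map of degree \<open>p\<close>
  extended to tensor products by the Leibniz rule.\<close>

definition after_derivation ::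
  "('k, 'v, 'z) graded_space_scheme \<Rightarrow> int \<Rightarrow> ('v \<Rightarrow> 'v) \<Rightarrow> ('v list \<Rightarrow> 'u::ab_group_add) \<Rightarrow> 'v list \<Rightarrow> 'u" where
  "after_derivation V p D f es =
     (\<Sum>i<length es. sg (p * (\<Sum>j<i. deg V (es ! j))) (f (es[i := D (es ! i)])))"

fun atiyah_map ::
  "('k::field_char_0, 'a::{ring,monoid_mult}) graded_space \<Rightarrow> ('a \<Rightarrow> 'a)
     \<Rightarrow> ('k, 'a, 'w::ab_group_add) graded_mod \<Rightarrow> ('w \<Rightarrow> 'w)
     \<Rightarrow> (('w \<Rightarrow> 'a) \<Rightarrow> ('w \<times> ('w \<Rightarrow> 'a) \<Rightarrow>\<^sub>0 'k) set)
     \<Rightarrow> nat \<Rightarrow> ('w \<Rightarrow> 'a) list \<Rightarrow> ('w \<Rightarrow> 'a)" where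
  "atiyah_map A d \<Omega> d\<Omega> nabla 0 bs = 0"
| "atiyah_map A d \<Omega> d\<Omega> nabla (Suc 0) bs = dual_diff A d \<Omega> d\<Omega> (bs ! 0)"
| "atiyah_map A d \<Omega> d\<Omega> nabla (Suc (Suc 0)) bs =
     (let B = dual A \<Omega>; D = cov B nabla; dB = dual_diff A d \<Omega> d\<Omega>; b = bs ! 0; e = bs ! 1
      in D (dB b) e - dB (D b e) + sg (deg B b) (D b (dB e)))"
| "atiyah_map A d \<Omega> d\<Omega> nabla (Suc (Suc (Suc k))) bs =
     (let B = dual A \<Omega>; D = cov B nabla; R = atiyah_map A d \<Omega> d\<Omega> nabla (Suc (Suc k)); b = hd bs
      in sg (deg B b) (D b (R (tl bs))) - after_derivation B (deg B b) (D b) R (tl bs))"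


section \<open>Leibniz infinity algebras\<close>

definition has_degs :: "('k, 'v, 'z) graded_space_scheme \<Rightarrow> int list \<Rightarrow> 'v list \<Rightarrow> bool" where
  "has_degs V ns vs \<longleftrightarrow> list_all2 (\<lambda>n v. v \<in> cmp V n) ns vs"

definition multilinear_deg_one ::
  "('k, 'v::ab_group_add, 'z) graded_space_scheme \<Rightarrow> nat \<Rightarrow> ('v list \<Rightarrow> 'v) \<Rightarrow> bool" where
  "multilinear_deg_one V k f \<longleftrightarrow>
     (\<forall>ns vs. length vs = k \<and> has_degs V ns vs \<longrightarrow>
        f vs \<in> cmp V (sum_list ns + 1) \<and>
        (\<forall>i<k. \<forall>u\<in>cmp V (ns ! i). f (vs[i := vs ! i + u]) = f vs + f (vs[i := u])) \<and>
        (\<forall>i<k. \<forall>c. f (vs[i := scl V c (vs ! i)]) = scl V c (f vs)))"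

definition module_multilinear_deg_one ::
  "('k, 'a) graded_space \<Rightarrow> ('k, 'a, 'v::ab_group_add) graded_mod \<Rightarrow> nat \<Rightarrow> ('v list \<Rightarrow> 'v) \<Rightarrow> bool" where
  "module_multilinear_deg_one A V k f \<longleftrightarrow>
     multilinear_deg_one V k f \<and>
     (\<forall>ns vs p. \<forall>a\<in>cmp A p. length vs = k \<and> has_degs V ns vs \<longrightarrow>
        (\<forall>i<k. f (vs[i := act V a (vs ! i)]) = sg (p * (1 + (\<Sum>j<i. ns ! j))) (act V a (f vs))))"

definition shuffle :: "nat \<Rightarrow> nat \<Rightarrow> (nat \<Rightarrow> nat) set" where
  "shuffle p q =
     {\<sigma>. \<sigma> permutes {1..p + q} \<and> strict_mono_on {1..p} \<sigma> \<and> strict_mono_on {p + 1..p + q} \<sigma>}"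

text \<open>The Koszul sign of a permutation of \<open>m\<close> elements of degrees \<open>n 1, \<dots>, n m\<close> is \<open>(-1)\<close> to this
  power.\<close>

definition koszul_exponent :: "(nat \<Rightarrow> int) \<Rightarrow> nat \<Rightarrow> (nat \<Rightarrow> nat) \<Rightarrow> int" where
  "koszul_exponent n m \<sigma> =
     (\<Sum>(r, s)\<in>{(r, s). 1 \<le> r \<and> r < s \<and> s \<le> m \<and> \<sigma> s < \<sigma> r}. n (\<sigma> r) * n (\<sigma> s))"

definition leibniz_infinity ::
  "('k::field_char_0, 'v::ab_group_add, 'z) graded_space_scheme \<Rightarrow> (nat \<Rightarrow> 'v list \<Rightarrow> 'v) \<Rightarrow> bool" where
  "leibniz_infinity V l \<longleftrightarrow>
     graded_space V \<and>
     (\<forall>k\<ge>1. multilinear_deg_one V k (l k)) \<and>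
     (\<forall>n\<ge>1. \<forall>(v :: nat \<Rightarrow> 'v) (g :: nat \<Rightarrow> int). (\<forall>r\<in>{1..n}. v r \<in> cmp V (g r)) \<longrightarrow>
        (\<Sum>(i, j)\<in>{(i, j). 1 \<le> i \<and> 1 \<le> j \<and> i + j = n + 1}. \<Sum>k=j..n. \<Sum>\<sigma>\<in>shuffle (k - j) (j - 1).
           sg (koszul_exponent g (k - 1) \<sigma> + (\<Sum>r=1..k - j. g (\<sigma> r)))
             (l i (map (\<lambda>r. v (\<sigma> r)) [1..<k - j + 1]
                   @ [l j (map (\<lambda>r. v (\<sigma> r)) [k - j + 1..<k] @ [v k])]
                   @ map v [k + 1..<n + 1])))
        = 0)"

definition leibniz_infinity_algebra ::
  "('k::field_char_0, 'a::{ring,monoid_mult}) graded_space \<Rightarrow> ('a \<Rightarrow> 'a)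
     \<Rightarrow> ('k, 'a, 'v::ab_group_add) graded_mod \<Rightarrow> (nat \<Rightarrow> 'v list \<Rightarrow> 'v) \<Rightarrow> bool" where
  "leibniz_infinity_algebra A d V l \<longleftrightarrow>
     leibniz_infinity V l \<and>
     dg_module A d V (\<lambda>v. l 1 [v]) \<and>
     (\<forall>k\<ge>2. module_multilinear_deg_one A V k (l k))"

end

theory Submission
  imports Defs
begin

text \<open>
  Let \<open>J\<^sub>n\<close> denote the left-hand side of the \<open>n\<close>-th Leibniz identity. Splitting the terms of
  \<open>J\<^sub>n\<^sub>+\<^sub>1(b\<^sub>0, \<dots>, b\<^sub>n)\<close> according to whether \<open>b\<^sub>0\<close> is the root of the inner bracket, lies in the inner or
  in the outer bracket, and inserting the recursion for the bracket containing \<open>b\<^sub>0\<close>, one finds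
  \<open>J\<^sub>n\<^sub>+\<^sub>1(b\<^sub>0, \<dots>, b\<^sub>n) = \<nabla>\<^bsub>b\<^sub>0\<^esub> (J\<^sub>n(b\<^sub>1, \<dots>, b\<^sub>n)) - J\<^sub>n(\<nabla>\<^bsub>b\<^sub>0\<^esub> (b\<^sub>1 \<otimes> \<dots> \<otimes> b\<^sub>n))\<close>; the terms with
  \<open>\<nabla>\<close> along \<open>\<partial>b\<^sub>0\<close> cancel because \<open>\<partial>\<partial>b\<^sub>0 = 0\<close>. As \<open>J\<^sub>1 = \<partial>\<partial> = 0\<close>, all identities follow by induction.
  The brackets are linear over the algebra because the derivations \<open>a \<mapsto> b(\<delta> a)\<close> cancel in commutators.
\<close>

section \<open>Graded sums over lists\<close>

text \<open>The recursion is not quite a commutator: the second bracket differs from the commutator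
  of \<nabla> and \<partial> by a defect term, \<nabla> along \<partial>b. When the outer bracket
  has just two arguments, the defect gives \<nabla> along \<partial>b applied to a bracket; when the
  inner bracket has just two, it gives a bracket applied to the derivation \<nabla> along
  \<partial>b. Together these are the negative of the term with b as root, a bracket with first
  argument \<partial>b, whose own defect lies along \<partial>\<partial>b. Two obstacles shape the
  proof. Koszul signs need degrees, but the degree of zero is arbitrary; computations therefore run
  on lists of entries labelled with degrees, and a comparison with \<open>deg\<close> shows that a
  wrong degree only ever stands before a term that vanishes by multilinearity. Shuffles do not suit
  an induction on the first argument; they are replaced by splittings built up from the head of the
  list, and matched with shuffles through the image of the first block.\<close>

lemma sg_zero [simp]: "sg n 0 = 0"
  and sg_0 [simp]: "sg 0 x = x"
  and sg_sg [simp]: "sg m (sg n x) = sg (m + n) x"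
  and sg_add: "sg n (x + y) = sg n x + sg n y"
  and sg_diff: "sg n (x - y) = sg n x - sg n y"
  by (simp_all add: sg_def)

lemma sg_cong: "even (m - n) \<Longrightarrow> sg m x = sg n x"
  by (auto simp: sg_def)

lemma sg_sum: "sg n (\<Sum>i\<in>I. f i) = (\<Sum>i\<in>I. sg n (f i))"
  by (simp add: sg_def sum_negf)

section \<open>Additive subgroups and maps additive on one component\<close>

definition additive_subgroup :: "'v::ab_group_add set \<Rightarrow> bool" where
  "additive_subgroup S \<longleftrightarrow> 0 \<in> S \<and> (\<forall>x\<in>S. \<forall>y\<in>S. x + y \<in> S) \<and> (\<forall>x\<in>S. - x \<in> S)"

definition additive_on :: "'v::ab_group_add set \<Rightarrow> ('v \<Rightarrow> 'u::ab_group_add) \<Rightarrow> bool" where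
  "additive_on S f \<longleftrightarrow> (\<forall>x\<in>S. \<forall>y\<in>S. f (x + y) = f x + f y)"

lemma additive_subgroupD:
  assumes "additive_subgroup S"
  shows "0 \<in> S" "x \<in> S \<Longrightarrow> y \<in> S \<Longrightarrow> x + y \<in> S" "x \<in> S \<Longrightarrow> - x \<in> S"
    "x \<in> S \<Longrightarrow> y \<in> S \<Longrightarrow> x - y \<in> S" "x \<in> S \<Longrightarrow> sg n x \<in> S"
proof -
  show "0 \<in> S" "x \<in> S \<Longrightarrow> y \<in> S \<Longrightarrow> x + y \<in> S" "x \<in> S \<Longrightarrow> - x \<in> S"
    using assms unfolding additive_subgroup_def by blast+
  show "x \<in> S \<Longrightarrow> sg n x \<in> S"
    using assms unfolding additive_subgroup_def sg_def by simp
  assume "x \<in> S" "y \<in> S"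
  then have "x + - y \<in> S"
    using assms unfolding additive_subgroup_def by blast
  then show "x - y \<in> S" by simp
qed

lemma additive_onD:
  assumes "additive_on S f" "additive_subgroup S"
  shows "f 0 = 0" "x \<in> S \<Longrightarrow> y \<in> S \<Longrightarrow> f (x + y) = f x + f y" "x \<in> S \<Longrightarrow> f (- x) = - f x"
    "x \<in> S \<Longrightarrow> y \<in> S \<Longrightarrow> f (x - y) = f x - f y" "x \<in> S \<Longrightarrow> f (sg n x) = sg n (f x)"
proof -
  note S = additive_subgroupD [OF assms(2)]
  have add: "f (x + y) = f x + f y" if "x \<in> S" "y \<in> S" for x y
    using assms(1) that unfolding additive_on_def by blast
  have "f (0 + 0) = f 0 + f 0"
    using add S(1) by blast
  then show z: "f 0 = 0" by simp
  have m: "f (- x) = - f x" if "x \<in> S" for x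
  proof -
    have "f (x + - x) = f x + f (- x)"
      using add S(3) that by blast
    then show ?thesis
      by (simp add: z minus_unique)
  qed
  show "x \<in> S \<Longrightarrow> y \<in> S \<Longrightarrow> f (x + y) = f x + f y"
    by (rule add)
  show "x \<in> S \<Longrightarrow> f (- x) = - f x"
    by (rule m)
  show "x \<in> S \<Longrightarrow> f (sg n x) = sg n (f x)"
    using m by (simp add: sg_def)
  assume "x \<in> S" "y \<in> S"
  then have "f (x + - y) = f x + f (- y)"
    using add S(3) by blast
  then show "f (x - y) = f x - f y"
    using m \<open>y \<in> S\<close> by simp
qed

text \<open>Homogeneous elements are paired with a degree, so that signs in front of possibly vanishing
  terms are unambiguous.\<close>

definition total_deg :: "(int \<times> 'v) list \<Rightarrow> int" where
  "total_deg ps = sum_list (map fst ps)"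

lemma total_deg_simps [simp]:
  "total_deg [] = 0"
  "total_deg (u # ps) = fst u + total_deg ps"
  "total_deg (ps @ qs) = total_deg ps + total_deg qs"
  by (simp_all add: total_deg_def)

definition homogeneous_list :: "(int \<Rightarrow> 'v set) \<Rightarrow> (int \<times> 'v) list \<Rightarrow> bool" where
  "homogeneous_list C ps \<longleftrightarrow> (\<forall>u\<in>set ps. snd u \<in> C (fst u))"

lemma homogeneous_list_simps [simp]:
  "homogeneous_list C []"
  "homogeneous_list C (u # ps) \<longleftrightarrow> snd u \<in> C (fst u) \<and> homogeneous_list C ps"
  "homogeneous_list C (ps @ qs) \<longleftrightarrow> homogeneous_list C ps \<and> homogeneous_list C qs"
  by (auto simp: homogeneous_list_def)

text \<open>The functional \<open>F\<close> varies in the recursion: an entry that has been passed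
  is frozen into \<open>F\<close>, and the tail poses the same problem. Results of \<open>D\<close>
  get a label raised by \<open>p\<close>, so a degree is never read off an element that may be
  zero.\<close>

fun tensor_der ::
  "int \<Rightarrow> ('v \<Rightarrow> 'v) \<Rightarrow> ((int \<times> 'v) list \<Rightarrow> 'u::ab_group_add) \<Rightarrow> (int \<times> 'v) list \<Rightarrow> 'u" where
  "tensor_der p D F [] = 0"
| "tensor_der p D F (u # us) =
     F ((fst u + p, D (snd u)) # us) + sg (p * fst u) (tensor_der p D (\<lambda>ys. F (u # ys)) us)"

lemma tensor_der_append:
  "tensor_der p D F (xs @ ys) =
     tensor_der p D (\<lambda>zs. F (zs @ ys)) xs + sg (p * total_deg xs) (tensor_der p D (\<lambda>zs. F (xs @ zs)) ys)"
  by (induction xs arbitrary: F) (simp_all add: sg_add algebra_simps)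

text \<open>Every list fed to \<open>F\<close> keeps the original length and has its total degree
  raised by \<open>p\<close>, so facts about \<open>F\<close> in one arity and degree
  suffice.\<close>

lemma tensor_der_cong:
  assumes "\<And>n x. x \<in> C n \<Longrightarrow> D x \<in> C (n + p)" "homogeneous_list C ps"
    and "\<And>qs. homogeneous_list C qs \<Longrightarrow> length qs = length ps \<Longrightarrow> total_deg qs = total_deg ps + p \<Longrightarrow>
           F qs = G qs"
  shows "tensor_der p D F ps = tensor_der p D G ps"
  using assms(2,3)
proof (induction ps arbitrary: F G)
  case (Cons u us)
  have "F ((fst u + p, D (snd u)) # us) = G ((fst u + p, D (snd u)) # us)"
    using Cons.prems assms(1) by simp
  moreover have "tensor_der p D (\<lambda>ys. F (u # ys)) us = tensor_der p D (\<lambda>ys. G (u # ys)) us"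
    using Cons.prems by (intro Cons.IH) auto
  ultimately show ?case by simp
qed simp

lemma tensor_der_zero [simp]: "tensor_der p D (\<lambda>qs. 0) ps = 0"
  by (induction ps) simp_all

lemma tensor_der_add:
  "tensor_der p D (\<lambda>qs. F qs + G qs) ps = tensor_der p D F ps + tensor_der p D G ps"
  by (induction ps arbitrary: F G) (simp_all add: sg_add)

lemma tensor_der_sg: "tensor_der p D (\<lambda>qs. sg n (F qs)) ps = sg n (tensor_der p D F ps)"
  by (induction ps arbitrary: F) (simp_all add: sg_add add.commute)

text \<open>Wherever \<open>D\<close> lands, the total degree rises by \<open>p\<close>; the sign is
  thus common to all terms and comes out.\<close>

lemma tensor_der_sg_total_deg:
  "tensor_der p D (\<lambda>qs. sg (c * total_deg qs) (F qs)) ps = sg (c * (total_deg ps + p)) (tensor_der p D F ps)"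
proof (induction ps arbitrary: F)
  case (Cons u us)
  have "tensor_der p D (\<lambda>ys. sg (c * total_deg (u # ys)) (F (u # ys))) us
      = tensor_der p D (\<lambda>ys. sg (c * fst u) (sg (c * total_deg ys) (F (u # ys)))) us"
    by (simp add: distrib_left)
  also have "\<dots> = sg (c * fst u) (sg (c * (total_deg us + p)) (tensor_der p D (\<lambda>ys. F (u # ys)) us))"
    by (simp only: tensor_der_sg Cons.IH)
  finally show ?case
    by (simp add: sg_add algebra_simps)
qed simp

lemma tensor_der_in:
  assumes "\<And>n x. x \<in> C n \<Longrightarrow> D x \<in> C (n + p)" "homogeneous_list C ps" "additive_subgroup S"
    and "\<And>qs. homogeneous_list C qs \<Longrightarrow> length qs = length ps \<Longrightarrow> total_deg qs = total_deg ps + p \<Longrightarrow>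
           F qs \<in> S"
  shows "tensor_der p D F ps \<in> S"
  using assms(2,4)
proof (induction ps arbitrary: F)
  case (Cons u us)
  have "F ((fst u + p, D (snd u)) # us) \<in> S"
    using Cons.prems assms(1) by simp
  moreover have "tensor_der p D (\<lambda>ys. F (u # ys)) us \<in> S"
    using Cons.prems by (intro Cons.IH) auto
  ultimately show ?case
    using additive_subgroupD [OF assms(3)] by simp
qed (use additive_subgroupD [OF assms(3)] in simp)

lemma additive_on_tensor_der:
  assumes "\<And>n x. x \<in> C n \<Longrightarrow> D x \<in> C (n + p)" "homogeneous_list C ps" "additive_subgroup S"
    and "additive_on S f"
    and "\<And>qs. homogeneous_list C qs \<Longrightarrow> length qs = length ps \<Longrightarrow> total_deg qs = total_deg ps + p \<Longrightarrow>
           F qs \<in> S"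
  shows "f (tensor_der p D F ps) = tensor_der p D (\<lambda>qs. f (F qs)) ps"
  using assms(2,5)
proof (induction ps arbitrary: F)
  case (Cons u us)
  have "F ((fst u + p, D (snd u)) # us) \<in> S"
    using Cons.prems assms(1) by simp
  moreover have "tensor_der p D (\<lambda>ys. F (u # ys)) us \<in> S"
    using Cons.prems by (intro tensor_der_in [where C = C] assms) auto
  moreover have "f (tensor_der p D (\<lambda>ys. F (u # ys)) us) = tensor_der p D (\<lambda>ys. f (F (u # ys))) us"
    using Cons.prems by (intro Cons.IH) auto
  ultimately show ?case
    using additive_subgroupD [OF assms(3)] additive_onD [OF assms(4,3)] by simp
qed (use additive_onD [OF assms(4,3)] in simp)

text \<open>Bridge from the recursion to the indexed sum in \<open>after_derivation\<close>.\<close>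

lemma tensor_der_conv_sum:
  "tensor_der p D F ps =
     (\<Sum>i<length ps. sg (p * (\<Sum>j<i. fst (ps ! j))) (F (ps[i := (fst (ps ! i) + p, D (snd (ps ! i)))])))"
proof (induction ps arbitrary: F)
  case (Cons u us)
  show ?case
    by (simp add: Cons.IH sum.lessThan_Suc_shift sg_sum distrib_left del: sum.lessThan_Suc)
qed simp

text \<open>The sum runs over an entry \<open>x\<close> of the list and a splitting of the entries before \<open>x\<close> into two
  sublists \<open>ts\<close> and \<open>ss\<close>, with the Koszul sign of the splitting; \<open>rs\<close> are the entries after \<open>x\<close>.\<close>

fun unshuffle_sum ::
  "((int \<times> 'v) list \<Rightarrow> (int \<times> 'v) list \<Rightarrow> int \<times> 'v \<Rightarrow> (int \<times> 'v) list \<Rightarrow> 'u) \<Rightarrow> (int \<times> 'v) list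
     \<Rightarrow> 'u::ab_group_add" where
  "unshuffle_sum G [] = 0"
| "unshuffle_sum G (u # us) =
     G [] [] u us + unshuffle_sum (\<lambda>ts ss x rs. G (u # ts) ss x rs) us
       + unshuffle_sum (\<lambda>ts ss x rs. sg (fst u * total_deg ts) (G ts (u # ss) x rs)) us"

lemma unshuffle_sum_cong:
  assumes "\<And>ts ss x rs. mset (ts @ ss @ x # rs) = mset ps \<Longrightarrow> G ts ss x rs = G' ts ss x rs"
  shows "unshuffle_sum G ps = unshuffle_sum G' ps"
  using assms
proof (induction ps arbitrary: G G')
  case (Cons u us)
  have "unshuffle_sum (\<lambda>ts ss x rs. G (u # ts) ss x rs) us = unshuffle_sum (\<lambda>ts ss x rs. G' (u # ts) ss x rs) us"
    by (rule Cons.IH, rule Cons.prems) simp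
  moreover have "unshuffle_sum (\<lambda>ts ss x rs. sg (fst u * total_deg ts) (G ts (u # ss) x rs)) us
      = unshuffle_sum (\<lambda>ts ss x rs. sg (fst u * total_deg ts) (G' ts (u # ss) x rs)) us"
    by (rule Cons.IH, rule arg_cong [where f = "sg _"], rule Cons.prems) simp
  moreover have "G [] [] u us = G' [] [] u us"
    by (rule Cons.prems) simp
  ultimately show ?case by simp
qed simp

lemma unshuffle_sum_zero [simp]: "unshuffle_sum (\<lambda>ts ss x rs. 0) ps = 0"
  by (induction ps) simp_all

lemma unshuffle_sum_add:
  "unshuffle_sum (\<lambda>ts ss x rs. G ts ss x rs + G' ts ss x rs) ps = unshuffle_sum G ps + unshuffle_sum G' ps"
  by (induction ps arbitrary: G G') (simp_all add: sg_add)

lemma unshuffle_sum_sg: "unshuffle_sum (\<lambda>ts ss x rs. sg n (G ts ss x rs)) ps = sg n (unshuffle_sum G ps)"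
proof (induction ps arbitrary: G)
  case (Cons u us)
  show ?case
    by (simp add: sg_add add.commute [of _ n]) (simp flip: sg_sg add: Cons.IH)
qed simp

lemma unshuffle_sum_minus: "unshuffle_sum (\<lambda>ts ss x rs. - G ts ss x rs) ps = - unshuffle_sum G ps"
  using unshuffle_sum_sg [of 1 G ps] by (simp add: sg_def)

lemma unshuffle_sum_in:
  assumes "additive_subgroup S"
    and "\<And>ts ss x rs. mset (ts @ ss @ x # rs) = mset ps \<Longrightarrow> G ts ss x rs \<in> S"
  shows "unshuffle_sum G ps \<in> S"
  using assms(2)
proof (induction ps arbitrary: G)
  case (Cons u us)
  note S = additive_subgroupD [OF assms(1)]
  have "unshuffle_sum (\<lambda>ts ss x rs. G (u # ts) ss x rs) us \<in> S"
    by (rule Cons.IH, rule Cons.prems) simp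
  moreover have "unshuffle_sum (\<lambda>ts ss x rs. sg (fst u * total_deg ts) (G ts (u # ss) x rs)) us \<in> S"
    by (rule Cons.IH, rule S, rule Cons.prems) simp
  moreover have "G [] [] u us \<in> S"
    by (rule Cons.prems) simp
  ultimately show ?case using S by simp
qed (use additive_subgroupD [OF assms(1)] in simp)

lemma additive_on_unshuffle_sum:
  assumes "additive_subgroup S" "additive_on S f"
    and "\<And>ts ss x rs. mset (ts @ ss @ x # rs) = mset ps \<Longrightarrow> G ts ss x rs \<in> S"
  shows "f (unshuffle_sum G ps) = unshuffle_sum (\<lambda>ts ss x rs. f (G ts ss x rs)) ps"
  using assms(3)
proof (induction ps arbitrary: G)
  case (Cons u us)
  note S = additive_subgroupD [OF assms(1)]
  note f = additive_onD [OF assms(2,1)]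
  have 0: "G [] [] u us \<in> S"
    by (rule Cons.prems) simp
  have G1: "G (u # ts) ss x rs \<in> S" if "mset (ts @ ss @ x # rs) = mset us" for ts ss x rs
    using that by (intro Cons.prems) simp
  have G2: "G ts (u # ss) x rs \<in> S" if "mset (ts @ ss @ x # rs) = mset us" for ts ss x rs
    using that by (intro Cons.prems) simp
  have 1: "unshuffle_sum (\<lambda>ts ss x rs. G (u # ts) ss x rs) us \<in> S"
    by (rule unshuffle_sum_in [OF assms(1) G1])
  have 2: "unshuffle_sum (\<lambda>ts ss x rs. sg (fst u * total_deg ts) (G ts (u # ss) x rs)) us \<in> S"
    by (rule unshuffle_sum_in [OF assms(1) S(5) [OF G2]])
  have "f (unshuffle_sum (\<lambda>ts ss x rs. G (u # ts) ss x rs) us) = unshuffle_sum (\<lambda>ts ss x rs. f (G (u # ts) ss x rs)) us"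
    by (rule Cons.IH [OF G1])
  moreover have "f (unshuffle_sum (\<lambda>ts ss x rs. sg (fst u * total_deg ts) (G ts (u # ss) x rs)) us)
      = unshuffle_sum (\<lambda>ts ss x rs. f (sg (fst u * total_deg ts) (G ts (u # ss) x rs))) us"
    by (rule Cons.IH [OF S(5) [OF G2]])
  moreover have "unshuffle_sum (\<lambda>ts ss x rs. f (sg (fst u * total_deg ts) (G ts (u # ss) x rs))) us
      = unshuffle_sum (\<lambda>ts ss x rs. sg (fst u * total_deg ts) (f (G ts (u # ss) x rs))) us"
    by (rule unshuffle_sum_cong, rule f, rule G2)
  ultimately show ?case
    using 0 1 2 S f by simp
qed (use additive_onD [OF assms(2,1)] in simp)

text \<open>One splitting survives: the last entry is the root and all others are in the inner
  block. No entry moves past another, so no sign appears. This evaluates the terms in which the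
  outer bracket takes just two arguments.\<close>

lemma unshuffle_sum_only_inner:
  "ps \<noteq> [] \<Longrightarrow> unshuffle_sum (\<lambda>ts ss x rs. if ts = [] \<and> rs = [] then H (ss @ [x]) else 0) ps = H ps"
proof (induction ps arbitrary: H)
  case (Cons u us)
  have "unshuffle_sum (\<lambda>ts ss x rs. sg (fst u * total_deg ts) (if ts = [] \<and> rs = [] then H ((u # ss) @ [x]) else 0)) us
      = unshuffle_sum (\<lambda>ts ss x rs. if ts = [] \<and> rs = [] then H (u # ss @ [x]) else 0) us"
    by (rule unshuffle_sum_cong) auto
  also have "\<dots> = (if us = [] then 0 else H (u # us))"
    using Cons.IH [of "\<lambda>zs. H (u # zs)"] by (cases "us = []") auto
  finally show ?case
    by (cases "us = []") auto
qed simp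

text \<open>With an empty inner block the root runs through the list, and
  \<open>sg (p * total_deg ts)\<close> is the sign for moving an operator of degree \<open>p\<close>
  up to it: the sum is the Leibniz rule.\<close>

lemma unshuffle_sum_only_outer:
  "unshuffle_sum (\<lambda>ts ss x rs. if ss = [] then sg (p * total_deg ts) (H (ts @ (fst x + p, D (snd x)) # rs)) else 0) ps
     = tensor_der p D H ps"
proof (induction ps arbitrary: H)
  case (Cons u us)
  have "unshuffle_sum (\<lambda>ts ss x rs. if ss = [] then
          sg (p * total_deg (u # ts)) (H ((u # ts) @ (fst x + p, D (snd x)) # rs)) else 0) us
      = unshuffle_sum (\<lambda>ts ss x rs. sg (p * fst u) (if ss = [] then
          sg (p * total_deg ts) (H (u # ts @ (fst x + p, D (snd x)) # rs)) else 0)) us"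
    by (rule unshuffle_sum_cong) (auto simp: distrib_left)
  also have "\<dots> = sg (p * fst u) (tensor_der p D (\<lambda>zs. H (u # zs)) us)"
    by (simp only: unshuffle_sum_sg Cons.IH [of "\<lambda>zs. H (u # zs)"])
  finally show ?case
    by simp
qed simp

text \<open>The Leibniz rule on the rearranged word \<open>ts @ ss @ [x] @ rs\<close>, cut at the
  block boundaries because \<open>G\<close> takes the four blocks separately.\<close>

definition block_der ::
  "int \<Rightarrow> ('v \<Rightarrow> 'v)
     \<Rightarrow> ((int \<times> 'v) list \<Rightarrow> (int \<times> 'v) list \<Rightarrow> int \<times> 'v \<Rightarrow> (int \<times> 'v) list \<Rightarrow> 'u::ab_group_add)
     \<Rightarrow> (int \<times> 'v) list \<Rightarrow> (int \<times> 'v) list \<Rightarrow> int \<times> 'v \<Rightarrow> (int \<times> 'v) list \<Rightarrow> 'u" where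
  "block_der p D G ts ss x rs =
     tensor_der p D (\<lambda>zs. G zs ss x rs) ts
     + sg (p * total_deg ts) (tensor_der p D (\<lambda>zs. G ts zs x rs) ss)
     + sg (p * (total_deg ts + total_deg ss)) (G ts ss (fst x + p, D (snd x)) rs)
     + sg (p * (total_deg ts + total_deg ss + fst x)) (tensor_der p D (\<lambda>zs. G ts ss x zs) rs)"

text \<open>Derivations commute with permutations carrying Koszul signs. The induction compares the
  sign for moving the head \<open>u\<close> past \<open>ts\<close> before and after \<open>D\<close>
  has acted.\<close>

lemma tensor_der_unshuffle_sum:
  "tensor_der p D (unshuffle_sum G) ps = unshuffle_sum (block_der p D G) ps"
proof (induction ps arbitrary: G)
  case (Cons u us)
  let ?Du = "(fst u + p, D (snd u))"
  let ?G1 = "\<lambda>ts ss x rs. G (u # ts) ss x rs"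
  let ?G2 = "\<lambda>ts ss x rs. sg (fst u * total_deg ts) (G ts (u # ss) x rs)"
  have 0: "block_der p D G [] [] u us
      = G [] [] ?Du us + sg (p * fst u) (tensor_der p D (\<lambda>ys. G [] [] u ys) us)"
    by (simp add: block_der_def)
  have 1: "block_der p D G (u # ts) ss x rs = G (?Du # ts) ss x rs + sg (p * fst u) (block_der p D ?G1 ts ss x rs)"
    for ts ss x rs
    by (simp add: block_der_def sg_add algebra_simps)
  \<comment> \<open>If \<open>D\<close> acts on an entry of \<open>ts\<close>, the degree of
    \<open>ts\<close> rises by \<open>p\<close>, which accounts for the factor
    \<open>sg (p * fst u)\<close>. If it acts on \<open>u\<close>, its sign for passing
    \<open>ts\<close> merges with that of \<open>u\<close> into the sign of an element of degree
    \<open>fst u + p\<close>.\<close>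
  have 2: "sg (fst u * total_deg ts) (block_der p D G ts (u # ss) x rs)
      = sg ((fst u + p) * total_deg ts) (G ts (?Du # ss) x rs) + sg (p * fst u) (block_der p D ?G2 ts ss x rs)"
    for ts ss x rs
    unfolding block_der_def tensor_der_sg_total_deg tensor_der_sg
    by (cases "even p"; cases "even (fst u)"; cases "even (total_deg ts)"; cases "even (total_deg ss)") (simp_all add: sg_def)
  have "unshuffle_sum (block_der p D G) (u # us) =
      G [] [] ?Du us + sg (p * fst u) (tensor_der p D (\<lambda>ys. G [] [] u ys) us)
      + unshuffle_sum (\<lambda>ts ss x rs. block_der p D G (u # ts) ss x rs) us
      + unshuffle_sum (\<lambda>ts ss x rs. sg (fst u * total_deg ts) (block_der p D G ts (u # ss) x rs)) us"
    by (simp add: 0)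
  also have "\<dots> =
      unshuffle_sum G (?Du # us) + sg (p * fst u) (tensor_der p D (\<lambda>ys. G [] [] u ys) us
        + unshuffle_sum (block_der p D ?G1) us + unshuffle_sum (block_der p D ?G2) us)"
    by (simp only: 1 2 unshuffle_sum_add unshuffle_sum_sg sg_add unshuffle_sum.simps fst_conv add_ac)
  also have "\<dots> = unshuffle_sum G (?Du # us) + sg (p * fst u) (tensor_der p D (\<lambda>ys. G [] [] u ys) us
        + tensor_der p D (unshuffle_sum ?G1) us + tensor_der p D (unshuffle_sum ?G2) us)"
    by (simp only: Cons.IH)
  also have "\<dots> = tensor_der p D (unshuffle_sum G) (u # us)"
    by (simp add: tensor_der_add)
  finally show ?case by simp
qed simp

section \<open>The Leibniz identities\<close>

text \<open>The last summand, which only occurs for \<open>k = 1\<close>, is the failure of \<open>\<R>\<^sub>2\<close> to be the commutator of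
  \<open>\<nabla>\<close> and \<open>\<R>\<^sub>1 = \<partial>\<close>.\<close>

primrec atiyah :: "('v \<Rightarrow> 'v) \<Rightarrow> ('v \<Rightarrow> 'v \<Rightarrow> 'v) \<Rightarrow> nat \<Rightarrow> (int \<times> 'v) list \<Rightarrow> 'v::ab_group_add" where
  "atiyah dd D 0 ps = 0"
| "atiyah dd D (Suc k) ps =
     (if k = 0 then dd (snd (hd ps))
      else sg (fst (hd ps)) (D (snd (hd ps)) (atiyah dd D k (tl ps)))
             - tensor_der (fst (hd ps)) (D (snd (hd ps))) (atiyah dd D k) (tl ps)
             + (if k = 1 then D (dd (snd (hd ps))) (snd (hd (tl ps))) else 0))"

text \<open>Compatibility of \<open>D\<close> with \<open>dd\<close> is not an axiom: its failure is
  what the second bracket measures.\<close>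

locale dg_connection =
  fixes C :: "int \<Rightarrow> 'v::ab_group_add set"
    and dd :: "'v \<Rightarrow> 'v"
    and D :: "'v \<Rightarrow> 'v \<Rightarrow> 'v"
  assumes subgroup: "additive_subgroup (C n)"
    and dd_in: "x \<in> C n \<Longrightarrow> dd x \<in> C (n + 1)"
    and dd_additive: "additive_on (C n) dd"
    and dd_dd: "x \<in> C n \<Longrightarrow> dd (dd x) = 0"
    and D_in: "x \<in> C m \<Longrightarrow> y \<in> C n \<Longrightarrow> D x y \<in> C (n + m)"
    and D_additive_left: "y \<in> C n \<Longrightarrow> additive_on (C m) (\<lambda>x. D x y)"
    and D_additive_right: "x \<in> C m \<Longrightarrow> additive_on (C n) (D x)"
begin

lemmas C_closed = additive_subgroupD [OF subgroup]

lemma D_add_left: "b \<in> C m \<Longrightarrow> b' \<in> C m \<Longrightarrow> y \<in> C n \<Longrightarrow> D (b + b') y = D b y + D b' y"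
  using D_additive_left unfolding additive_on_def by blast

abbreviation homog :: "(int \<times> 'v) list \<Rightarrow> bool" where
  "homog \<equiv> homogeneous_list C"

section \<open>Degrees and additivity of the brackets\<close>

definition R :: "(int \<times> 'v) list \<Rightarrow> 'v" where
  "R ps = atiyah dd D (length ps) ps"

lemma R_single [simp]: "R [u] = dd (snd u)"
  by (simp add: R_def)

text \<open>A derivation preserves length, so the arity may be read off each list instead of being
  fixed in advance. Taking \<open>UNIV\<close> for every component makes the degree conditions
  void.\<close>

lemma tensor_der_atiyah: "tensor_der p f (atiyah dd D (length ps)) ps = tensor_der p f R ps"
  by (rule tensor_der_cong [where C = "\<lambda>_. UNIV"]) (simp_all add: R_def homogeneous_list_def)

lemma R_Cons:
  assumes "us \<noteq> []"
  shows "R (u # us) = sg (fst u) (D (snd u) (R us)) - tensor_der (fst u) (D (snd u)) R us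
           + (if length us = 1 then D (dd (snd u)) (snd (hd us)) else 0)"
proof -
  have "length us \<noteq> 0"
    using assms by simp
  then show ?thesis
    using tensor_der_atiyah [of "fst u" "D (snd u)" us] by (simp add: R_def)
qed

lemma R_in: "homog ps \<Longrightarrow> ps \<noteq> [] \<Longrightarrow> R ps \<in> C (total_deg ps + 1)"
proof (induction "length ps" arbitrary: ps rule: less_induct)
  case less
  then obtain u us where ps: "ps = u # us"
    by (cases ps) auto
  have u: "snd u \<in> C (fst u)" and us: "homog us"
    using less.prems ps by auto
  show ?case
  proof (cases "us = []")
    case True
    then show ?thesis
      using u ps dd_in by simp
  next
    case False
    have IH: "R qs \<in> C (total_deg qs + 1)" if "length qs = length us" "homog qs" for qs
      using less.hyps [of qs] that ps False by (cases qs) auto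
    have "D (snd u) (R us) \<in> C (total_deg us + 1 + fst u)"
      by (rule D_in [OF u IH]) (use us in auto)
    moreover have "tensor_der (fst u) (D (snd u)) R us \<in> C (total_deg us + fst u + 1)"
    proof (rule tensor_der_in [where C = C])
      show "R qs \<in> C (total_deg us + fst u + 1)"
        if "homog qs" "length qs = length us" "total_deg qs = total_deg us + fst u" for qs
        using IH [of qs] that by simp
    qed (use D_in u us subgroup in auto)
    moreover have "D (dd (snd u)) (snd (hd us)) \<in> C (total_deg us + 1 + fst u)" if "length us = 1"
    proof -
      obtain w where w: "us = [w]"
        using \<open>length us = 1\<close> by (cases us) auto
      show ?thesis
        using D_in [OF dd_in [OF u], of "snd w" "fst w"] us w by (simp add: ac_simps)
    qed
    ultimately show ?thesis
      using ps False by (auto simp: R_Cons ac_simps intro!: C_closed)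
  qed
qed

definition slot_additive :: "((int \<times> 'v) list \<Rightarrow> 'v) \<Rightarrow> nat \<Rightarrow> bool" where
  "slot_additive F k \<longleftrightarrow>
     (\<forall>xs ys n. homog xs \<longrightarrow> homog ys \<longrightarrow> length xs + Suc (length ys) = k \<longrightarrow>
        additive_on (C n) (\<lambda>x. F (xs @ (n, x) # ys)))"

lemma slot_additiveD:
  assumes "slot_additive F (length xs + Suc (length ys))" "homog xs" "homog ys" "x \<in> C n" "y \<in> C n"
  shows "F (xs @ (n, x + y) # ys) = F (xs @ (n, x) # ys) + F (xs @ (n, y) # ys)"
  using assms unfolding slot_additive_def additive_on_def by blast

lemma slot_additive_tensor_der:
  assumes F: "slot_additive F k" and b: "b \<in> C p"
  shows "slot_additive (tensor_der p (D b) F) k"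
  unfolding slot_additive_def
proof (intro allI impI)
  fix xs ys n assume xs: "homog xs" and ys: "homog ys" and k: "length xs + Suc (length ys) = k"
  note Db = D_in [OF b]
  show "additive_on (C n) (\<lambda>x. tensor_der p (D b) F (xs @ (n, x) # ys))"
    unfolding additive_on_def
  proof (intro ballI)
    fix x y assume x: "x \<in> C n" and y: "y \<in> C n"
    have "tensor_der p (D b) (\<lambda>zs. F (zs @ (n, x + y) # ys)) xs
        = tensor_der p (D b) (\<lambda>zs. F (zs @ (n, x) # ys) + F (zs @ (n, y) # ys)) xs"
      by (rule tensor_der_cong [where C = C, OF Db xs])
        (use slot_additiveD [of F] F k ys x y in auto)
    moreover have "tensor_der p (D b) (\<lambda>zs. F (xs @ (n, x + y) # zs)) ys
        = tensor_der p (D b) (\<lambda>zs. F (xs @ (n, x) # zs) + F (xs @ (n, y) # zs)) ys"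
      by (rule tensor_der_cong [where C = C, OF Db ys])
        (use slot_additiveD [of F] F k xs x y in auto)
    moreover have "F (xs @ (n + p, D b (x + y)) # ys) = F (xs @ (n + p, D b x) # ys) + F (xs @ (n + p, D b y) # ys)"
      using slot_additiveD [of F xs ys "D b x" "n + p" "D b y"] F k xs ys x y b
      by (simp add: additive_onD [OF D_additive_right subgroup] D_in)
    ultimately show "tensor_der p (D b) F (xs @ (n, x + y) # ys)
        = tensor_der p (D b) F (xs @ (n, x) # ys) + tensor_der p (D b) F (xs @ (n, y) # ys)"
      by (simp add: tensor_der_append tensor_der_add sg_add)
  qed
qed

lemma tensor_der_additive_coeff:
  assumes F: "slot_additive F (length ps)" and ps: "homog ps" and b: "b \<in> C p" and b': "b' \<in> C p"
  shows "tensor_der p (D (b + b')) F ps = tensor_der p (D b) F ps + tensor_der p (D b') F ps"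
proof -
  \<comment> \<open>Generalised over a prefix \<open>ts\<close>: additivity is known for the slots
    of complete lists, while the recursion sees \<open>F\<close> with its first entries
    frozen.\<close>
  have "tensor_der p (D (b + b')) G us = tensor_der p (D b) G us + tensor_der p (D b') G us"
    if "homog us" "homog ts" "\<And>zs. G zs = F (ts @ zs)" "length ts + length us = length ps" for ts us G
    using that
  proof (induction us arbitrary: ts G)
    case (Cons u us)
    have "G ((fst u + p, D (b + b') (snd u)) # us) = G ((fst u + p, D b (snd u)) # us) + G ((fst u + p, D b' (snd u)) # us)"
      using slot_additiveD [of F ts us "D b (snd u)" "fst u + p" "D b' (snd u)"] F Cons.prems b b'
      by (simp add: D_add_left [OF b b', of "snd u" "fst u"] D_in)
    moreover have "tensor_der p (D (b + b')) (\<lambda>ys. G (u # ys)) us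
        = tensor_der p (D b) (\<lambda>ys. G (u # ys)) us + tensor_der p (D b') (\<lambda>ys. G (u # ys)) us"
      by (rule Cons.IH [of "ts @ [u]"]) (use Cons.prems in auto)
    ultimately show ?case
      by (simp add: sg_add)
  qed simp
  from this [of ps "[]" F] show ?thesis
    using ps by simp
qed

text \<open>A varying first argument enters through \<open>D\<close>, through the coefficient of the
  derivation and through the defect; any other one enters through the shorter bracket.\<close>

lemma slot_additive_R: "slot_additive R k"
proof (induction k)
  case 0
  then show ?case by (simp add: slot_additive_def)
next
  case (Suc k)
  show ?case
    unfolding slot_additive_def additive_on_def
  proof (intro allI impI ballI)
    fix xs ys n x y
    assume xs: "homog xs" and ys: "homog ys" and k: "length xs + Suc (length ys) = Suc k"
      and x: "x \<in> C n" and y: "y \<in> C n"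
    show "R (xs @ (n, x + y) # ys) = R (xs @ (n, x) # ys) + R (xs @ (n, y) # ys)"
    proof (cases xs)
      case Nil
      show ?thesis
      proof (cases "ys = []")
        case True
        then show ?thesis
          using Nil additive_onD [OF dd_additive subgroup] x y by simp
      next
        case False
        have "R ys \<in> C (total_deg ys + 1)"
          by (rule R_in [OF ys False])
        moreover have "tensor_der n (D (x + y)) R ys = tensor_der n (D x) R ys + tensor_der n (D y) R ys"
          by (rule tensor_der_additive_coeff [OF _ ys x y]) (use Suc.IH k Nil in simp)
        moreover have "D (dd (x + y)) (snd (hd ys)) = D (dd x) (snd (hd ys)) + D (dd y) (snd (hd ys))"
          using ys False x y
          by (cases ys) (auto simp: additive_onD [OF dd_additive subgroup] intro: D_add_left dd_in)
        ultimately show ?thesis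
          using Nil False x y by (simp add: R_Cons additive_onD [OF D_additive_left subgroup] sg_add)
      qed
    next
      case (Cons u us)
      have u: "snd u \<in> C (fst u)" and us: "homog us"
        using xs Cons by auto
      \<comment> \<open>The defect term of the second bracket, isolated so that one computation
        serves all arities.\<close>
      define E where "E z = (if length (us @ (n, z) # ys) = 1 then D (dd (snd u)) (snd (hd (us @ (n, z) # ys))) else 0)" for z
      have R_z: "R (xs @ (n, z) # ys) = sg (fst u) (D (snd u) (R (us @ (n, z) # ys)))
          - tensor_der (fst u) (D (snd u)) R (us @ (n, z) # ys) + E z" for z
        unfolding Cons append_Cons E_def by (rule R_Cons) simp
      have in_C: "R (us @ (n, z) # ys) \<in> C (total_deg us + n + total_deg ys + 1)" if "z \<in> C n" for z
        using R_in [of "us @ (n, z) # ys"] that us ys by (simp add: ac_simps)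
      have "R (us @ (n, x + y) # ys) = R (us @ (n, x) # ys) + R (us @ (n, y) # ys)"
        by (rule slot_additiveD) (use Suc.IH k us ys x y Cons in auto)
      then have "D (snd u) (R (us @ (n, x + y) # ys)) = D (snd u) (R (us @ (n, x) # ys)) + D (snd u) (R (us @ (n, y) # ys))"
        using additive_onD(2) [OF D_additive_right [OF u] subgroup in_C [OF x] in_C [OF y]] by simp
      moreover have "tensor_der (fst u) (D (snd u)) R (us @ (n, x + y) # ys)
          = tensor_der (fst u) (D (snd u)) R (us @ (n, x) # ys) + tensor_der (fst u) (D (snd u)) R (us @ (n, y) # ys)"
        by (rule slot_additiveD) (use slot_additive_tensor_der [OF Suc.IH u] k us ys x y Cons in auto)
      moreover have "E (x + y) = E x + E y"
        using x y additive_onD(2) [OF D_additive_right [OF dd_in [OF u]] subgroup] by (simp add: E_def)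
      ultimately show ?thesis
        by (simp only: R_z sg_add) simp
    qed
  qed
qed

lemma R_additive: "homog xs \<Longrightarrow> homog ys \<Longrightarrow> additive_on (C n) (\<lambda>x. R (xs @ (n, x) # ys))"
  using slot_additive_R unfolding slot_additive_def by blast

lemma R_zero: "homog xs \<Longrightarrow> homog ys \<Longrightarrow> R (xs @ (n, 0) # ys) = 0"
  using additive_onD(1) [OF R_additive subgroup] by blast

section \<open>Jacobiators\<close>

definition inner :: "(int \<times> 'v) list \<Rightarrow> int \<times> 'v" where
  "inner ps = (total_deg ps + 1, R ps)"

text \<open>The sign is that of a bracket of degree one passing the entries of
  \<open>ts\<close>.\<close>

definition bracket_term ::
  "(int \<times> 'v) list \<Rightarrow> (int \<times> 'v) list \<Rightarrow> int \<times> 'v \<Rightarrow> (int \<times> 'v) list \<Rightarrow> 'v" where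
  "bracket_term ts ss x rs = sg (total_deg ts) (R (ts @ inner (ss @ [x]) # rs))"

text \<open>The left-hand side of the Leibniz identity, indexed by splittings instead of shuffles.
  The root is the last argument of the inner bracket, and the entries after it stay in place in the
  outer one.\<close>

definition jacobiator :: "(int \<times> 'v) list \<Rightarrow> 'v" where
  "jacobiator ps = unshuffle_sum bracket_term ps"


lemma inner_in: "homog ps \<Longrightarrow> ps \<noteq> [] \<Longrightarrow> snd (inner ps) \<in> C (fst (inner ps))"
  by (simp add: inner_def R_in)

lemma mset_eq_total_deg: "mset ps = mset qs \<Longrightarrow> total_deg ps = total_deg qs"
  unfolding total_deg_def by (metis mset_map sum_mset_sum_list)

lemma mset_eq_homog: "mset ps = mset qs \<Longrightarrow> homog ps = homog qs"
  unfolding homogeneous_list_def by (metis mset_eq_setD)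

lemma bracket_term_in:
  assumes "homog ts" "homog ss" "snd x \<in> C (fst x)" "homog rs"
  shows "bracket_term ts ss x rs \<in> C (total_deg ts + total_deg ss + fst x + total_deg rs + 2)"
  using R_in [of "ts @ inner (ss @ [x]) # rs"] assms inner_in [of "ss @ [x]"]
  by (simp add: bracket_term_def C_closed inner_def ac_simps)

lemma bracket_term_in_mset:
  assumes "homog ps" and *: "mset (ts @ ss @ x # rs) = mset ps"
  shows "bracket_term ts ss x rs \<in> C (total_deg ps + 2)"
proof -
  have "total_deg ps = total_deg ts + total_deg ss + fst x + total_deg rs"
    using mset_eq_total_deg [OF *] by simp
  then show ?thesis
    using bracket_term_in [of ts ss x rs] mset_eq_homog [OF *] assms(1) by simp
qed

text \<open>The part of the recursion for the outer bracket that involves \<open>\<nabla>\<^sub>b\<close> with \<open>b\<close> the first argument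
  cancels against the same part of the inner bracket.\<close>

lemma bracket_term_Cons:
  assumes b: "b \<in> C m" and ts: "homog ts" and ss: "homog ss" and x: "snd x \<in> C (fst x)" and rs: "homog rs"
  shows "bracket_term ((m, b) # ts) ss x rs + sg (m * total_deg ts) (bracket_term ts ((m, b) # ss) x rs)
    = D b (bracket_term ts ss x rs) - block_der m (D b) bracket_term ts ss x rs
      + (sg m (if ts = [] \<and> rs = [] then D (dd b) (R (ss @ [x])) else 0)
      + (if ss = [] then sg ((m + 1) * total_deg ts) (R (ts @ (fst x + (m + 1), D (dd b) (snd x)) # rs)) else 0))"
proof -
  let ?y = "inner (ss @ [x])"
  let ?t = "total_deg ts"
  let ?n = "fst ?y"
  \<comment> \<open>The outer bracket as a function of its inner value, at the degree reached once
    \<open>b\<close> has acted. Its additivity distributes it over the recursion of the inner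
    bracket.\<close>
  define f where "f z = R (ts @ (?n + m, z) # rs)" for z
  have f: "additive_on (C (?n + m)) f"
    unfolding f_def by (rule R_additive [OF ts rs])
  note fD = additive_onD [OF f subgroup]
  have y: "snd ?y \<in> C ?n"
    using ss x inner_in by simp
  note Db = D_in [OF b]
  define t1 where "t1 = tensor_der m (D b) (\<lambda>zs. R (zs @ ?y # rs)) ts"
  define t2 where "t2 = tensor_der m (D b) (\<lambda>zs. R (ts @ ?y # zs)) rs"
  define s1 where "s1 = tensor_der m (D b) (\<lambda>zs. R (zs @ [x])) ss"
  define s2 where "s2 = R (ss @ [(fst x + m, D b (snd x))])"
  \<comment> \<open>The inner bracket has just the two arguments \<open>b\<close> and
    \<open>x\<close> when \<open>ss\<close> is empty; only then does its recursion carry the defect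
    term.\<close>
  define e where "e = (if ss = [] then D (dd b) (snd x) else 0)"

  have Ry: "R (ts @ ?y # rs) \<in> C (?t + ?n + total_deg rs + 1)"
    using R_in [of "ts @ ?y # rs"] ts y rs by (simp add: ac_simps)
  \<comment> \<open>The outer bracket has just the two arguments \<open>b\<close> and
    \<open>?y\<close> when both \<open>ts\<close> and \<open>rs\<close> are empty; this is where its
    defect term occurs.\<close>
  have outer: "bracket_term ((m, b) # ts) ss x rs
      = D b (bracket_term ts ss x rs)
        - sg (m + ?t) (t1 + sg (m * ?t) (f (D b (snd ?y))) + sg (m * (?t + ?n)) t2)
        + sg m (if ts = [] \<and> rs = [] then D (dd b) (R (ss @ [x])) else 0)"
  proof -
    have "R ((m, b) # ts @ ?y # rs) = sg m (D b (R (ts @ ?y # rs)))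
        - tensor_der m (D b) R (ts @ ?y # rs)
        + (if ts = [] \<and> rs = [] then D (dd b) (R (ss @ [x])) else 0)"
      by (simp add: R_Cons inner_def)
    moreover have "tensor_der m (D b) R (ts @ ?y # rs)
        = t1 + sg (m * ?t) (f (D b (snd ?y))) + sg (m * (?t + ?n)) t2"
      by (simp add: tensor_der_append t1_def t2_def f_def sg_add algebra_simps)
    moreover have "D b (bracket_term ts ss x rs) = sg ?t (D b (R (ts @ ?y # rs)))"
      unfolding bracket_term_def by (rule additive_onD(5) [OF D_additive_right [OF b] subgroup Ry])
    ultimately show ?thesis
      by (cases "even m") (simp_all add: bracket_term_def sg_add sg_diff, simp_all add: sg_def)
  qed

  have s1: "s1 \<in> C (?n + m)"
    unfolding s1_def
  proof (rule tensor_der_in [where C = C, OF Db ss subgroup])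
    fix qs assume "homog qs" "total_deg qs = total_deg ss + m"
    then show "R (qs @ [x]) \<in> C (?n + m)"
      using R_in [of "qs @ [x]"] x by (simp add: inner_def ac_simps)
  qed
  have s2: "s2 \<in> C (?n + m)"
    using R_in [of "ss @ [(fst x + m, D b (snd x))]"] ss Db [OF x] by (simp add: s2_def inner_def ac_simps)
  have e: "e \<in> C (?n + m)"
    using D_in [OF dd_in [OF b] x] C_closed by (auto simp: e_def inner_def ac_simps)
  have Dby: "D b (snd ?y) \<in> C (?n + m)"
    by (rule Db [OF y])
  have inner: "sg (m * ?t) (bracket_term ts ((m, b) # ss) x rs)
      = sg (m * ?t + ?t) (sg m (f (D b (snd ?y))) - (f s1 + sg (m * total_deg ss) (f s2)) + f e)"
  proof -
    have "R ((m, b) # ss @ [x]) = sg m (D b (snd ?y)) - (s1 + sg (m * total_deg ss) s2) + e"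
      using R_Cons [of "ss @ [x]" "(m, b)"] tensor_der_append [of m "D b" R ss "[x]"]
      by (simp add: inner_def s1_def s2_def e_def)
    then have "inner ((m, b) # ss @ [x]) = (?n + m, sg m (D b (snd ?y)) - (s1 + sg (m * total_deg ss) s2) + e)"
      by (simp add: inner_def)
    then have "bracket_term ts ((m, b) # ss) x rs = sg ?t (f (sg m (D b (snd ?y)) - (s1 + sg (m * total_deg ss) s2) + e))"
      by (simp add: bracket_term_def f_def)
    also have "f (sg m (D b (snd ?y)) - (s1 + sg (m * total_deg ss) s2) + e)
        = sg m (f (D b (snd ?y))) - (f s1 + sg (m * total_deg ss) (f s2)) + f e"
      using s1 s2 e Dby by (simp add: fD C_closed)
    finally show ?thesis by simp
  qed

  have block: "block_der m (D b) bracket_term ts ss x rs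
      = sg (?t + m) t1 + sg (m * ?t + ?t) (f s1) + sg (m * (?t + total_deg ss) + ?t) (f s2)
        + sg (m * (?t + total_deg ss + fst x) + ?t) t2"
  proof -
    have "tensor_der m (D b) (\<lambda>zs. bracket_term zs ss x rs) ts = sg (?t + m) t1"
      using tensor_der_sg_total_deg [of m "D b" 1 "\<lambda>zs. R (zs @ ?y # rs)" ts]
      by (simp add: bracket_term_def t1_def)
    moreover have "tensor_der m (D b) (\<lambda>zs. bracket_term ts zs x rs) ss = sg ?t (f s1)"
    proof -
      have "f s1 = tensor_der m (D b) (\<lambda>zs. f (R (zs @ [x]))) ss"
        unfolding s1_def
      proof (rule additive_on_tensor_der [where C = C, OF Db ss subgroup f])
        fix qs assume "homog qs" "total_deg qs = total_deg ss + m"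
        then show "R (qs @ [x]) \<in> C (?n + m)"
          using R_in [of "qs @ [x]"] x by (simp add: inner_def ac_simps)
      qed
      also have "\<dots> = tensor_der m (D b) (\<lambda>zs. R (ts @ inner (zs @ [x]) # rs)) ss"
        by (rule tensor_der_cong [where C = C, OF Db ss]) (simp_all add: f_def inner_def ac_simps)
      finally show ?thesis
        by (simp add: bracket_term_def tensor_der_sg)
    qed
    moreover have "bracket_term ts ss (fst x + m, D b (snd x)) rs = sg ?t (f s2)"
      by (simp add: bracket_term_def f_def s2_def inner_def ac_simps)
    moreover have "tensor_der m (D b) (\<lambda>zs. bracket_term ts ss x zs) rs = sg ?t t2"
      by (simp add: bracket_term_def t2_def tensor_der_sg)
    ultimately show ?thesis
      by (simp add: block_der_def)
  qed
  \<comment> \<open>The exponent \<open>m * ?t + ?t\<close> is \<open>(m + 1) * ?t\<close>: the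
    defect acts as an operator of degree \<open>m + 1\<close>, the degree of \<open>dd b\<close>,
    that passes \<open>ts\<close>.\<close>
  have fe: "sg (m * ?t + ?t) (f e)
      = (if ss = [] then sg ((m + 1) * ?t) (R (ts @ (fst x + (m + 1), D (dd b) (snd x)) # rs)) else 0)"
    using fD(1) by (simp add: e_def f_def inner_def algebra_simps)
  \<comment> \<open>\<open>f (D b (snd ?y))\<close> comes with opposite signs from the two brackets.
    The other pieces match the blocks; for \<open>t2\<close>, the extra \<open>m\<close> in the sign
    is absorbed by the degree one of the inner bracket contained in \<open>?n\<close>. Only parities
    matter.\<close>
  show ?thesis
    unfolding outer inner block fe [symmetric] sg_add sg_diff
    unfolding inner_def
    by (cases "even m"; cases "even ?t"; cases "even (total_deg ss)"; cases "even (fst x)")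
      (simp_all add: sg_def)
qed

lemma jacobiator_Cons:
  assumes b: "b \<in> C m" and ps: "homog ps" "ps \<noteq> []"
  shows "jacobiator ((m, b) # ps) = D b (jacobiator ps) - tensor_der m (D b) jacobiator ps"
proof -
  let ?d = "dd b"
  let ?X = "\<lambda>ts ss x rs. if ts = [] \<and> rs = [] then D ?d (R (ss @ [x])) else 0"
  let ?Y = "\<lambda>ts ss x rs. if ss = [] then sg ((m + 1) * total_deg ts) (R (ts @ (fst x + (m + 1), D ?d (snd x)) # rs)) else 0"
  have "unshuffle_sum (\<lambda>ts ss x rs. bracket_term ((m, b) # ts) ss x rs
           + sg (m * total_deg ts) (bracket_term ts ((m, b) # ss) x rs)) ps
      = unshuffle_sum (\<lambda>ts ss x rs. D b (bracket_term ts ss x rs)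
           + - block_der m (D b) bracket_term ts ss x rs + (sg m (?X ts ss x rs) + ?Y ts ss x rs)) ps"
  proof (rule unshuffle_sum_cong)
    fix ts ss x rs assume *: "mset (ts @ ss @ x # rs) = mset ps"
    show "bracket_term ((m, b) # ts) ss x rs + sg (m * total_deg ts) (bracket_term ts ((m, b) # ss) x rs)
        = D b (bracket_term ts ss x rs) + - block_der m (D b) bracket_term ts ss x rs + (sg m (?X ts ss x rs) + ?Y ts ss x rs)"
      using bracket_term_Cons [OF b, of ts ss x rs] mset_eq_homog [OF *] ps by simp
  qed
  also have "\<dots> = unshuffle_sum (\<lambda>ts ss x rs. D b (bracket_term ts ss x rs)) ps
      + - unshuffle_sum (block_der m (D b) bracket_term) ps
      + (sg m (unshuffle_sum ?X ps) + unshuffle_sum ?Y ps)"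
    by (simp only: unshuffle_sum_add unshuffle_sum_minus unshuffle_sum_sg)
  also have "unshuffle_sum (\<lambda>ts ss x rs. D b (bracket_term ts ss x rs)) ps = D b (jacobiator ps)"
    unfolding jacobiator_def
  proof (rule additive_on_unshuffle_sum [OF subgroup D_additive_right [OF b], symmetric])
    fix ts ss x rs assume *: "mset (ts @ ss @ x # rs) = mset ps"
    show "bracket_term ts ss x rs \<in> C (total_deg ps + 2)"
      by (rule bracket_term_in_mset [OF ps(1) *])
  qed
  also have "unshuffle_sum (block_der m (D b) bracket_term) ps = tensor_der m (D b) jacobiator ps"
    by (simp flip: tensor_der_unshuffle_sum add: jacobiator_def [abs_def])
  \<comment> \<open>What remains are the two kinds of defect: \<open>D ?d\<close> applied to a
    bracket, and a bracket applied to the derivation \<open>D ?d\<close>.\<close>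
  also have "unshuffle_sum ?X ps = D ?d (R ps)"
    by (rule unshuffle_sum_only_inner [OF ps(2)])
  also have "unshuffle_sum ?Y ps = tensor_der (m + 1) (D ?d) R ps"
    by (rule unshuffle_sum_only_outer)
  finally have 1: "unshuffle_sum (\<lambda>ts ss x rs. bracket_term ((m, b) # ts) ss x rs) ps
      + unshuffle_sum (\<lambda>ts ss x rs. sg (m * total_deg ts) (bracket_term ts ((m, b) # ss) x rs)) ps
      = D b (jacobiator ps) + - tensor_der m (D b) jacobiator ps
        + (sg m (D ?d (R ps)) + tensor_der (m + 1) (D ?d) R ps)"
    by (simp only: unshuffle_sum_add)
  \<comment> \<open>With this term gone, the bracket with first argument \<open>dd b\<close> is a
    pure commutator even when \<open>ps\<close> has one entry. Its two parts are the negatives of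
    the two remaining defects, the degree \<open>m + 1\<close> reversing the sign of the
    first.\<close>
  have "D (dd ?d) (snd (hd ps)) = 0"
    using additive_onD(1) [OF D_additive_left subgroup, of "snd (hd ps)"] ps b by (cases ps) (auto simp: dd_dd)
  then have "R ((m + 1, ?d) # ps) = sg (m + 1) (D ?d (R ps)) - tensor_der (m + 1) (D ?d) R ps"
    by (simp add: R_Cons [OF ps(2)])
  moreover have "bracket_term [] [] (m, b) ps = R ((m + 1, ?d) # ps)"
    by (simp add: bracket_term_def inner_def)
  ultimately have 2: "bracket_term [] [] (m, b) ps = sg (m + 1) (D ?d (R ps)) - tensor_der (m + 1) (D ?d) R ps"
    by simp
  show ?thesis
    unfolding jacobiator_def [of "_ # _"] unshuffle_sum.simps 2 fst_conv add.assoc 1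
    by (simp add: sg_def)
qed

theorem jacobiator_eq_0: "homog ps \<Longrightarrow> ps \<noteq> [] \<Longrightarrow> jacobiator ps = 0"
proof (induction "length ps" arbitrary: ps rule: less_induct)
  case less
  then obtain m b us where ps: "ps = (m, b) # us"
    by (cases ps) auto
  have b: "b \<in> C m" and us: "homog us"
    using less.prems ps by auto
  show ?case
  proof (cases "us = []")
    case True
    then show ?thesis
      using ps b by (simp add: jacobiator_def bracket_term_def inner_def dd_dd)
  next
    case False
    \<comment> \<open>\<open>D b\<close> alters the entries but not their number, so induction on
      the length covers the derived lists as well as the tail.\<close>
    have IH: "jacobiator qs = 0" if "length qs = length us" "homog qs" for qs
      using less.hyps [of qs] that ps False by (cases qs) auto
    have "tensor_der m (D b) jacobiator us = tensor_der m (D b) (\<lambda>_. 0) us"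
      by (rule tensor_der_cong [where C = C, OF D_in [OF b] us]) (use IH in auto)
    then show ?thesis
      using jacobiator_Cons [OF b us False] IH [of us] us ps additive_onD(1) [OF D_additive_right [OF b] subgroup]
      by simp
  qed
qed

end

section \<open>Linearity over the algebra\<close>

text \<open>In the application \<open>\<rho> b a = b (\<delta> a)\<close>.\<close>

locale dg_module_connection = dg_connection C dd D
  for C :: "int \<Rightarrow> 'v::ab_group_add set" and dd :: "'v \<Rightarrow> 'v" and D :: "'v \<Rightarrow> 'v \<Rightarrow> 'v" +
  fixes CA :: "int \<Rightarrow> 'a set"
    and d :: "'a \<Rightarrow> 'a"
    and M :: "'a \<Rightarrow> 'v \<Rightarrow> 'v"
    and \<rho> :: "'v \<Rightarrow> 'a \<Rightarrow> 'a"
  assumes M_in: "a \<in> CA p \<Longrightarrow> x \<in> C n \<Longrightarrow> M a x \<in> C (p + n)"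
    and M_additive: "a \<in> CA p \<Longrightarrow> additive_on (C n) (M a)"
    and d_in: "a \<in> CA p \<Longrightarrow> d a \<in> CA (p + 1)"
    and rho_in: "b \<in> C m \<Longrightarrow> a \<in> CA p \<Longrightarrow> \<rho> b a \<in> CA (p + m)"
    and dd_M: "a \<in> CA p \<Longrightarrow> x \<in> C n \<Longrightarrow> dd (M a x) = M (d a) x + sg p (M a (dd x))"
    and D_M_left: "a \<in> CA p \<Longrightarrow> b \<in> C m \<Longrightarrow> x \<in> C n \<Longrightarrow> D (M a b) x = M a (D b x)"
    and D_M_right: "a \<in> CA p \<Longrightarrow> b \<in> C m \<Longrightarrow> x \<in> C n \<Longrightarrow>
          D b (M a x) = M (\<rho> b a) x + sg (m * p) (M a (D b x))"
    and rho_dd: "a \<in> CA p \<Longrightarrow> b \<in> C m \<Longrightarrow> x \<in> C n \<Longrightarrow>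
          M (\<rho> (dd b) a) x = M (d (\<rho> b a)) x - sg m (M (\<rho> b (d a)) x)"
begin

text \<open>The \<open>1\<close> in the sign is the degree of the bracket, which the scalar passes
  together with the entries \<open>xs\<close>.\<close>

definition slot_linear :: "((int \<times> 'v) list \<Rightarrow> 'v) \<Rightarrow> nat \<Rightarrow> bool" where
  "slot_linear F k \<longleftrightarrow>
     (\<forall>xs ys n x p a. homog xs \<longrightarrow> homog ys \<longrightarrow> length xs + Suc (length ys) = k \<longrightarrow> a \<in> CA p \<longrightarrow> x \<in> C n \<longrightarrow>
        F (xs @ (p + n, M a x) # ys) = sg (p * (1 + total_deg xs)) (M a (F (xs @ (n, x) # ys))))"

lemma slot_linearD:
  assumes "slot_linear F (length xs + Suc (length ys))" "homog xs" "homog ys" "a \<in> CA p" "x \<in> C n"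
  shows "F (xs @ (p + n, M a x) # ys) = sg (p * (1 + total_deg xs)) (M a (F (xs @ (n, x) # ys)))"
  using assms unfolding slot_linear_def by blast

text \<open>\<open>D\<close> is linear over the algebra in its direction, so no term with
  \<open>\<rho>\<close> arises. The sign for pulling the scalar out past the earlier entries makes
  up for the difference between the signs of derivations of degrees \<open>p + m\<close> and
  \<open>m\<close>.\<close>

lemma tensor_der_linear_coeff:
  assumes lin: "slot_linear F (length ps)"
    and F_in: "\<And>qs. homog qs \<Longrightarrow> length qs = length ps \<Longrightarrow> F qs \<in> C (total_deg qs + 1)"
    and ps: "homog ps" and a: "a \<in> CA p" and b: "b \<in> C m"
  shows "tensor_der (p + m) (D (M a b)) F ps = sg p (M a (tensor_der m (D b) F ps))"
proof -
  have "tensor_der (p + m) (D (M a b)) G us = sg (p * (1 + total_deg ts)) (M a (tensor_der m (D b) G us))"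
    if "homog us" "homog ts" "\<And>zs. G zs = F (ts @ zs)" "length ts + length us = length ps" for ts us G
    using that
  proof (induction us arbitrary: ts G)
    case Nil
    then show ?case
      using additive_onD(1) [OF M_additive [OF a] subgroup] by simp
  next
    case (Cons u us)
    have u: "snd u \<in> C (fst u)" and us: "homog us"
      using Cons.prems by auto
    let ?A = "G ((fst u + m, D b (snd u)) # us)"
    let ?B = "tensor_der m (D b) (\<lambda>ys. G (u # ys)) us"
    let ?c = "total_deg ts + fst u + m + total_deg us + 1"
    have A: "?A \<in> C ?c"
      using F_in [of "ts @ (fst u + m, D b (snd u)) # us"] Cons.prems D_in [OF b u] by (simp add: ac_simps)
    have B: "?B \<in> C ?c"
    proof (rule tensor_der_in [where C = C, OF D_in [OF b] us subgroup])
      fix qs assume "homog qs" "length qs = length us" "total_deg qs = total_deg us + m"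
      then show "G (u # qs) \<in> C ?c"
        using F_in [of "ts @ u # qs"] Cons.prems by (simp add: ac_simps)
    qed
    have "G ((p + (fst u + m), M a (D b (snd u))) # us) = sg (p * (1 + total_deg ts)) (M a ?A)"
      using slot_linearD [of F ts us a p "D b (snd u)" "fst u + m"] lin Cons.prems a D_in [OF b u] by simp
    moreover have "tensor_der (p + m) (D (M a b)) (\<lambda>ys. G (u # ys)) us
        = sg (p * (1 + total_deg (ts @ [u]))) (M a ?B)"
      by (rule Cons.IH) (use Cons.prems in auto)
    moreover have "M a (?A + sg (m * fst u) ?B) = M a ?A + sg (m * fst u) (M a ?B)"
      using additive_onD [OF M_additive [OF a] subgroup] A B C_closed by simp
    moreover have "D (M a b) (snd u) = M a (D b (snd u))"
      by (rule D_M_left [OF a b u])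
    ultimately show ?case
      by (cases "even p"; cases "even m"; cases "even (fst u)"; cases "even (total_deg ts)")
        (simp_all add: sg_def ac_simps)
  qed
  from this [of ps "[]" F] show ?thesis
    using ps by simp
qed

text \<open>The derivation fails to be linear in a slot: \<open>D b\<close> also differentiates the
  scalar, which leaves the term with \<open>\<rho> b a\<close>. In the commutator,
  \<open>D b\<close> applied to the value of \<open>F\<close> produces the same term, and the
  difference is linear.\<close>

lemma tensor_der_linear_slot:
  assumes lin: "slot_linear F k" and add: "slot_additive F k" and k: "length xs + Suc (length ys) = k"
    and F_in: "\<And>qs. homog qs \<Longrightarrow> length qs = k \<Longrightarrow> F qs \<in> C (total_deg qs + 1)"
    and xs: "homog xs" and ys: "homog ys" and a: "a \<in> CA p" and b: "b \<in> C m" and x: "x \<in> C n"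
  shows "tensor_der m (D b) F (xs @ (p + n, M a x) # ys)
    = sg (p * (1 + total_deg xs + m)) (M a (tensor_der m (D b) F (xs @ (n, x) # ys)))
      + sg (m * total_deg xs + (p + m) * (1 + total_deg xs)) (M (\<rho> b a) (F (xs @ (n, x) # ys)))"
proof -
  note Db = D_in [OF b]
  let ?c = "total_deg xs + n + total_deg ys + m + 1"
  note Ma = additive_onD [OF M_additive [OF a] subgroup [of ?c]]
  define t1 where "t1 = tensor_der m (D b) (\<lambda>zs. F (zs @ (n, x) # ys)) xs"
  define t2 where "t2 = F (xs @ (n + m, D b x) # ys)"
  define t3 where "t3 = tensor_der m (D b) (\<lambda>zs. F (xs @ (n, x) # zs)) ys"
  have in1: "F (zs @ (n, x) # ys) \<in> C ?c" if "homog zs" "length zs = length xs" "total_deg zs = total_deg xs + m" for zs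
    using F_in [of "zs @ (n, x) # ys"] that k ys x by (simp add: ac_simps)
  have in3: "F (xs @ (n, x) # zs) \<in> C ?c" if "homog zs" "length zs = length ys" "total_deg zs = total_deg ys + m" for zs
    using F_in [of "xs @ (n, x) # zs"] that k xs x by (simp add: ac_simps)
  have t1: "t1 \<in> C ?c"
    unfolding t1_def by (rule tensor_der_in [where C = C, OF Db xs subgroup in1])
  have t2: "t2 \<in> C ?c"
    using F_in [of "xs @ (n + m, D b x) # ys"] k xs ys Db [OF x] by (simp add: t2_def ac_simps)
  have t3: "t3 \<in> C ?c"
    unfolding t3_def by (rule tensor_der_in [where C = C, OF Db ys subgroup in3])
  have 1: "tensor_der m (D b) (\<lambda>zs. F (zs @ (p + n, M a x) # ys)) xs = sg (p * (1 + total_deg xs + m)) (M a t1)"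
  proof -
    \<comment> \<open>\<open>D b\<close> acts before the slot here, so the scalar passes a prefix of
      degree raised by \<open>m\<close>. Splitting off \<open>sg p\<close> leaves a sign
      proportional to the degree of the prefix.\<close>
    have "tensor_der m (D b) (\<lambda>zs. F (zs @ (p + n, M a x) # ys)) xs
        = tensor_der m (D b) (\<lambda>zs. sg p (sg (p * total_deg zs) (M a (F (zs @ (n, x) # ys))))) xs"
    proof (rule tensor_der_cong [where C = C, OF Db xs])
      fix zs assume "homog zs" "length zs = length xs"
      then show "F (zs @ (p + n, M a x) # ys) = sg p (sg (p * total_deg zs) (M a (F (zs @ (n, x) # ys))))"
        using slot_linearD [of F zs ys a p x n] lin k ys a x by (simp add: distrib_left)
    qed
    also have "\<dots> = sg p (sg (p * (total_deg xs + m)) (tensor_der m (D b) (\<lambda>zs. M a (F (zs @ (n, x) # ys))) xs))"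
      by (simp only: tensor_der_sg tensor_der_sg_total_deg)
    also have "tensor_der m (D b) (\<lambda>zs. M a (F (zs @ (n, x) # ys))) xs = M a t1"
      unfolding t1_def
      by (rule additive_on_tensor_der [where C = C, OF Db xs subgroup M_additive [OF a] in1, symmetric])
    finally show ?thesis by (simp add: algebra_simps)
  qed
  have 3: "tensor_der m (D b) (\<lambda>zs. F (xs @ (p + n, M a x) # zs)) ys = sg (p * (1 + total_deg xs)) (M a t3)"
  proof -
    have "tensor_der m (D b) (\<lambda>zs. F (xs @ (p + n, M a x) # zs)) ys
        = tensor_der m (D b) (\<lambda>zs. sg (p * (1 + total_deg xs)) (M a (F (xs @ (n, x) # zs)))) ys"
    proof (rule tensor_der_cong [where C = C, OF Db ys])
      fix zs assume "homog zs" "length zs = length ys"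
      then show "F (xs @ (p + n, M a x) # zs) = sg (p * (1 + total_deg xs)) (M a (F (xs @ (n, x) # zs)))"
        using slot_linearD [of F xs zs a p x n] lin k xs a x by simp
    qed
    also have "\<dots> = sg (p * (1 + total_deg xs)) (tensor_der m (D b) (\<lambda>zs. M a (F (xs @ (n, x) # zs))) ys)"
      by (simp only: tensor_der_sg)
    also have "tensor_der m (D b) (\<lambda>zs. M a (F (xs @ (n, x) # zs))) ys = M a t3"
      unfolding t3_def
      by (rule additive_on_tensor_der [where C = C, OF Db ys subgroup M_additive [OF a] in3, symmetric])
    finally show ?thesis .
  qed
  have 2: "F (xs @ (p + n + m, D b (M a x)) # ys)
      = sg ((p + m) * (1 + total_deg xs)) (M (\<rho> b a) (F (xs @ (n, x) # ys)))
        + sg (m * p + p * (1 + total_deg xs)) (M a t2)"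
  proof -
    define f where "f z = F (xs @ (p + n + m, z) # ys)" for z
    have "additive_on (C (p + n + m)) f"
      using add k xs ys unfolding f_def slot_additive_def by blast
    note f = additive_onD [OF this subgroup]
    have in_1: "M (\<rho> b a) x \<in> C (p + n + m)"
      using M_in [OF rho_in [OF b a] x] by (simp add: ac_simps)
    have in_2: "M a (D b x) \<in> C (p + n + m)"
      using M_in [OF a Db [OF x]] by (simp add: ac_simps)
    have "f (D b (M a x)) = f (M (\<rho> b a) x) + sg (m * p) (f (M a (D b x)))"
      unfolding D_M_right [OF a b x] using f in_1 in_2 C_closed by simp
    moreover have "f (M (\<rho> b a) x) = sg ((p + m) * (1 + total_deg xs)) (M (\<rho> b a) (F (xs @ (n, x) # ys)))"
      using slot_linearD [of F xs ys "\<rho> b a" "p + m" x n] lin k xs ys x rho_in [OF b a]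
      by (simp add: f_def ac_simps)
    moreover have "f (M a (D b x)) = sg (p * (1 + total_deg xs)) (M a t2)"
      using slot_linearD [of F xs ys a p "D b x" "n + m"] lin k xs ys a Db [OF x]
      by (simp add: f_def t2_def ac_simps)
    ultimately show ?thesis
      by (simp add: f_def)
  qed
  have "tensor_der m (D b) F (xs @ (n, x) # ys)
      = t1 + sg (m * total_deg xs) (t2 + sg (m * n) t3)"
    by (simp add: tensor_der_append t1_def t2_def t3_def)
  then have Mt: "M a (tensor_der m (D b) F (xs @ (n, x) # ys))
      = M a t1 + sg (m * total_deg xs) (M a t2 + sg (m * n) (M a t3))"
    using t1 t2 t3 Ma C_closed by simp
  have "tensor_der m (D b) F (xs @ (p + n, M a x) # ys)
      = sg (p * (1 + total_deg xs + m)) (M a t1)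
        + sg (m * total_deg xs) (sg ((p + m) * (1 + total_deg xs)) (M (\<rho> b a) (F (xs @ (n, x) # ys)))
            + sg (m * p + p * (1 + total_deg xs)) (M a t2)
            + sg (m * (p + n)) (sg (p * (1 + total_deg xs)) (M a t3)))"
    unfolding tensor_der_append tensor_der.simps fst_conv snd_conv 1 2 3 ..
  then show ?thesis
    unfolding Mt
    by (cases "even p"; cases "even m"; cases "even n"; cases "even (total_deg xs)") (simp_all add: sg_def)
qed

text \<open>The commutator argument has no starting point at \<open>dd\<close>, which is not linear
  over the algebra. In the first slot the two terms with \<open>d a\<close> cancel. In the second,
  so do those with \<open>M (d a) (D b x)\<close> and those with
  \<open>M (\<rho> b a) (dd x)\<close>; the terms in which neither \<open>D\<close> nor
  \<open>dd\<close> hits \<open>x\<close> cancel by \<open>rho_dd\<close>.\<close>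

lemma slot_linear_R_2: "slot_linear R 2"
  unfolding slot_linear_def
proof (intro allI impI)
  fix xs ys :: "(int \<times> 'v) list" and n x p a
  assume xs: "homog xs" and ys: "homog ys" and k: "length xs + Suc (length ys) = 2"
    and a: "a \<in> CA p" and x: "x \<in> C n"
  show "R (xs @ (p + n, M a x) # ys) = sg (p * (1 + total_deg xs)) (M a (R (xs @ (n, x) # ys)))"
  proof (cases xs)
    case Nil
    with k obtain w where w: "ys = [w]"
      by (cases ys) auto
    have e: "snd w \<in> C (fst w)"
      using ys w by simp
    let ?c = "n + fst w + 1"
    note Ma = additive_onD [OF M_additive [OF a] subgroup [of ?c]]
    have in1: "D x (dd (snd w)) \<in> C ?c"
      using D_in [OF x dd_in [OF e]] by (simp add: ac_simps)
    have in2: "dd (D x (snd w)) \<in> C ?c"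
      using dd_in [OF D_in [OF x e]] by (simp add: ac_simps)
    have in3: "D (dd x) (snd w) \<in> C ?c"
      using D_in [OF dd_in [OF x] e] by (simp add: ac_simps)
    have "R [(n, x), w] = sg n (D x (dd (snd w))) - dd (D x (snd w)) + D (dd x) (snd w)"
      by (simp add: R_Cons)
    then have "M a (R [(n, x), w]) = sg n (M a (D x (dd (snd w)))) - M a (dd (D x (snd w))) + M a (D (dd x) (snd w))"
      using in1 in2 in3 C_closed Ma by simp
    moreover have "R [(p + n, M a x), w] = sg (p + n) (M a (D x (dd (snd w)))) - dd (M a (D x (snd w))) + D (dd (M a x)) (snd w)"
      using D_M_left [OF a x e] D_M_left [OF a x dd_in [OF e]] by (simp add: R_Cons)
    moreover have "dd (M a (D x (snd w))) = M (d a) (D x (snd w)) + sg p (M a (dd (D x (snd w))))"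
      by (rule dd_M [OF a D_in [OF x e]])
    moreover have "D (dd (M a x)) (snd w) = M (d a) (D x (snd w)) + sg p (M a (D (dd x) (snd w)))"
    proof -
      have 1: "M (d a) x \<in> C (p + n + 1)"
        using M_in [OF d_in [OF a] x] by (simp add: ac_simps)
      have 2: "M a (dd x) \<in> C (p + n + 1)"
        using M_in [OF a dd_in [OF x]] by (simp add: ac_simps)
      have "D (dd (M a x)) (snd w) = D (M (d a) x) (snd w) + sg p (D (M a (dd x)) (snd w))"
        using additive_onD [OF D_additive_left [OF e] subgroup] 1 2 C_closed by (simp add: dd_M [OF a x])
      then show ?thesis
        using D_M_left [OF d_in [OF a] x e] D_M_left [OF a dd_in [OF x] e] by simp
    qed
    ultimately show ?thesis
      using Nil w by (simp add: sg_add sg_diff)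
  next
    case (Cons u us)
    then obtain m b where u: "xs = [(m, b)]" and ys: "ys = []"
      using k by (cases u) auto
    have b: "b \<in> C m"
      using xs u by simp
    note Db = D_in [OF b]
    let ?c = "n + m + 1"
    note Ma = additive_onD [OF M_additive [OF a] subgroup [of ?c]]
    have in1: "D b (dd x) \<in> C ?c"
      using Db [OF dd_in [OF x]] by (simp add: ac_simps)
    have in2: "dd (D b x) \<in> C ?c"
      using dd_in [OF Db [OF x]] by (simp add: ac_simps)
    have in3: "D (dd b) x \<in> C ?c"
      using D_in [OF dd_in [OF b] x] by (simp add: ac_simps)
    have "R [(m, b), (n, x)] = sg m (D b (dd x)) - dd (D b x) + D (dd b) x"
      by (simp add: R_Cons)
    then have 0: "M a (R [(m, b), (n, x)]) = sg m (M a (D b (dd x))) - M a (dd (D b x)) + M a (D (dd b) x)"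
      using in1 in2 in3 C_closed Ma by simp
    have 1: "D b (dd (M a x)) = M (\<rho> b (d a)) x + sg (m * (p + 1)) (M (d a) (D b x))
        + sg p (M (\<rho> b a) (dd x) + sg (m * p) (M a (D b (dd x))))"
    proof -
      have 1: "M (d a) x \<in> C (p + n + 1)"
        using M_in [OF d_in [OF a] x] by (simp add: ac_simps)
      have 2: "M a (dd x) \<in> C (p + n + 1)"
        using M_in [OF a dd_in [OF x]] by (simp add: ac_simps)
      have "D b (dd (M a x)) = D b (M (d a) x) + sg p (D b (M a (dd x)))"
        using additive_onD [OF D_additive_right [OF b] subgroup] 1 2 C_closed by (simp add: dd_M [OF a x])
      then show ?thesis
        using D_M_right [OF d_in [OF a] b x] D_M_right [OF a b dd_in [OF x]] by simp
    qed
    have 2: "dd (D b (M a x)) = M (d (\<rho> b a)) x + sg (p + m) (M (\<rho> b a) (dd x))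
        + sg (m * p) (M (d a) (D b x) + sg p (M a (dd (D b x))))"
    proof -
      have 1: "M (\<rho> b a) x \<in> C (p + n + m)"
        using M_in [OF rho_in [OF b a] x] by (simp add: ac_simps)
      have 2: "M a (D b x) \<in> C (p + n + m)"
        using M_in [OF a Db [OF x]] by (simp add: ac_simps)
      have "dd (D b (M a x)) = dd (M (\<rho> b a) x) + sg (m * p) (dd (M a (D b x)))"
        using additive_onD [OF dd_additive subgroup] 1 2 C_closed by (simp add: D_M_right [OF a b x])
      then show ?thesis
        using dd_M [OF rho_in [OF b a] x] dd_M [OF a Db [OF x]] by simp
    qed
    have 3: "D (dd b) (M a x) = M (d (\<rho> b a)) x - sg m (M (\<rho> b (d a)) x) + sg ((m + 1) * p) (M a (D (dd b) x))"
      using D_M_right [OF a dd_in [OF b] x] rho_dd [OF a b x] by simp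
    have "R [(m, b), (p + n, M a x)] = sg m (D b (dd (M a x))) - dd (D b (M a x)) + D (dd b) (M a x)"
      by (simp add: R_Cons)
    then show ?thesis
      unfolding u ys append_Cons append_Nil total_deg_simps fst_conv 0 1 2 3
      by (cases "even p"; cases "even m") (simp_all add: sg_def)
  qed
qed

text \<open>Starts at two because the first bracket is not linear and the second carries a defect;
  beyond that, the recursion is the commutator of \<open>D b\<close> with a linear map.\<close>

lemma slot_linear_R: "2 \<le> k \<Longrightarrow> slot_linear R k"
proof (induction k rule: dec_induct)
  case base
  show ?case by (rule slot_linear_R_2)
next
  case (step k)
  have R_in': "R qs \<in> C (total_deg qs + 1)" if "homog qs" "length qs = k" for qs
    using R_in [of qs] that step.hyps by (cases qs) auto
  have R_Cons': "R (u # us) = sg (fst u) (D (snd u) (R us)) - tensor_der (fst u) (D (snd u)) R us"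
    if "length us = k" for u us
    using R_Cons [of us u] that step.hyps by (cases us) auto
  show ?case
    unfolding slot_linear_def
  proof (intro allI impI)
    fix xs ys :: "(int \<times> 'v) list" and n x p a
    assume xs: "homog xs" and ys: "homog ys" and k: "length xs + Suc (length ys) = Suc k"
      and a: "a \<in> CA p" and x: "x \<in> C n"
    show "R (xs @ (p + n, M a x) # ys) = sg (p * (1 + total_deg xs)) (M a (R (xs @ (n, x) # ys)))"
    proof (cases xs)
      case Nil
      then have len: "length ys = k"
        using k by simp
      let ?t = "tensor_der n (D x) R ys"
      have 1: "D x (R ys) \<in> C (total_deg ys + 1 + n)"
        by (rule D_in [OF x R_in' [OF ys len]])
      have 2: "?t \<in> C (total_deg ys + 1 + n)"
      proof (rule tensor_der_in [where C = C, OF D_in [OF x] ys subgroup])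
        fix qs assume "homog qs" "length qs = length ys" "total_deg qs = total_deg ys + n"
        then show "R qs \<in> C (total_deg ys + 1 + n)"
          using R_in' [of qs] len by (simp add: ac_simps)
      qed
      have "R ((p + n, M a x) # ys) = sg (p + n) (M a (D x (R ys))) - sg p (M a ?t)"
        using tensor_der_linear_coeff [of R ys a p x n] step.IH len R_in' ys a x D_M_left [OF a x R_in' [OF ys len]]
        by (simp add: R_Cons')
      moreover have "M a (R ((n, x) # ys)) = sg n (M a (D x (R ys))) - M a ?t"
        using additive_onD [OF M_additive [OF a] subgroup [of "total_deg ys + 1 + n"]] 1 2 C_closed len
        by (simp add: R_Cons')
      ultimately show ?thesis
        using Nil by (simp add: sg_diff)
    next
      case (Cons u us)
      then obtain m b where u: "u = (m, b)" and b: "b \<in> C m" and us: "homog us"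
        and len: "length us + Suc (length ys) = k"
        using k xs by (cases u) auto
      let ?P = "us @ (n, x) # ys"
      let ?c = "total_deg us + n + total_deg ys + 1"
      have RP: "R ?P \<in> C ?c"
        using R_in' [of ?P] us ys x len by (simp add: ac_simps)
      have t: "tensor_der m (D b) R ?P \<in> C (?c + m)"
      proof (rule tensor_der_in [where C = C, OF D_in [OF b] _ subgroup])
        show "homog ?P"
          using us ys x by simp
        fix qs assume "homog qs" "length qs = length ?P" "total_deg qs = total_deg ?P + m"
        then show "R qs \<in> C (?c + m)"
          using R_in' [of qs] len by (simp add: ac_simps)
      qed
      have 0: "M a (R ((m, b) # ?P)) = sg m (M a (D b (R ?P))) - M a (tensor_der m (D b) R ?P)"
        using additive_onD [OF M_additive [OF a] subgroup [of "?c + m"]] D_in [OF b RP] t C_closed len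
        by (simp add: R_Cons')
      have 1: "D b (R (us @ (p + n, M a x) # ys))
          = sg (p * (1 + total_deg us)) (M (\<rho> b a) (R ?P) + sg (m * p) (M a (D b (R ?P))))"
      proof -
        have "R (us @ (p + n, M a x) # ys) = sg (p * (1 + total_deg us)) (M a (R ?P))"
          by (rule slot_linearD) (use step.IH len us ys a x in auto)
        then show ?thesis
          using additive_onD(5) [OF D_additive_right [OF b] subgroup M_in [OF a RP]] D_M_right [OF a b RP] by simp
      qed
      have 2: "tensor_der m (D b) R (us @ (p + n, M a x) # ys)
          = sg (p * (1 + total_deg us + m)) (M a (tensor_der m (D b) R ?P))
            + sg (m * total_deg us + (p + m) * (1 + total_deg us)) (M (\<rho> b a) (R ?P))"
        by (rule tensor_der_linear_slot [OF step.IH slot_additive_R len _ us ys a b x]) (rule R_in')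
      have 3: "R ((m, b) # us @ (p + n, M a x) # ys)
          = sg m (D b (R (us @ (p + n, M a x) # ys))) - tensor_der m (D b) R (us @ (p + n, M a x) # ys)"
        using len by (simp add: R_Cons')
      show ?thesis
        unfolding Cons u append_Cons total_deg_simps fst_conv 3 0 1 2
        by (cases "even p"; cases "even m"; cases "even (total_deg us)") (simp_all add: sg_def)
    qed
  qed
qed

end

section \<open>Shuffles\<close>

text \<open>Koszul exponent of an unshuffle in terms of the index set \<open>T\<close> that is put
  first. Both blocks keep their order, so only pairs with the larger index in \<open>T\<close>
  cross.\<close>

definition crossing_exponent :: "(nat \<Rightarrow> int) \<Rightarrow> nat set \<Rightarrow> nat set \<Rightarrow> int" where
  "crossing_exponent g T S = (\<Sum>t\<in>T. \<Sum>s\<in>{s\<in>S. s < t}. g t * g s)"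

lemma sorted_list_of_set_insert_less:
  assumes "finite A" "\<forall>x\<in>A. (a::nat) < x"
  shows "sorted_list_of_set (insert a A) = a # sorted_list_of_set A"
proof -
  have "a \<notin> A"
    using assms(2) by auto
  then have "sorted_list_of_set (insert a A) = insort a (sorted_list_of_set A)"
    using assms(1) by simp
  also have "\<dots> = a # sorted_list_of_set A"
    using assms by (intro insort_is_Cons) (auto simp: less_imp_le)
  finally show ?thesis .
qed

lemma total_deg_map_sorted_list_of_set:
  "finite T \<Longrightarrow> total_deg (map f (sorted_list_of_set T)) = (\<Sum>t\<in>T. fst (f t))"
  by (simp add: total_deg_def comp_def sum_list_distinct_conv_sum_set)

text \<open>The recursion on the head decides whether the least index \<open>l\<close> belongs to
  \<open>T\<close>.\<close>

lemma unshuffle_sum_interval: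
  fixes f :: "nat \<Rightarrow> int \<times> 'v"
    and G :: "(int \<times> 'v) list \<Rightarrow> (int \<times> 'v) list \<Rightarrow> int \<times> 'v \<Rightarrow> (int \<times> 'v) list \<Rightarrow> 'u::ab_group_add"
  shows "unshuffle_sum G (map f [l..<n]) =
    (\<Sum>k=l..<n. \<Sum>T\<in>Pow {l..<k}. sg (crossing_exponent (\<lambda>r. fst (f r)) T ({l..<k} - T))
       (G (map f (sorted_list_of_set T)) (map f (sorted_list_of_set ({l..<k} - T))) (f k) (map f [Suc k..<n])))"
proof (induction "n - l" arbitrary: l G)
  case 0
  then show ?case by simp
next
  case (Suc d)
  then have ln: "l < n" by simp
  let ?g = "\<lambda>r. fst (f r)"
  define summand where "summand = (\<lambda>G :: (int \<times> 'v) list \<Rightarrow> (int \<times> 'v) list \<Rightarrow> int \<times> 'v \<Rightarrow> (int \<times> 'v) list \<Rightarrow> 'u. \<lambda>l k T. sg (crossing_exponent ?g T ({l..<k} - T))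
       (G (map f (sorted_list_of_set T)) (map f (sorted_list_of_set ({l..<k} - T))) (f k) (map f [Suc k..<n])))"
  have IH: "unshuffle_sum G (map f [Suc l..<n]) = (\<Sum>k=Suc l..<n. \<Sum>T\<in>Pow {Suc l..<k}. summand G (Suc l) k T)" for G
    unfolding summand_def using Suc.hyps(2) by (intro Suc.hyps(1)) simp
  have "(\<Sum>T\<in>Pow {l..<k}. summand G l k T) =
      (\<Sum>T\<in>Pow {Suc l..<k}. summand (\<lambda>ts ss x rs. G (f l # ts) ss x rs) (Suc l) k T)
      + (\<Sum>T\<in>Pow {Suc l..<k}. summand (\<lambda>ts ss x rs. sg (?g l * total_deg ts) (G ts (f l # ss) x rs)) (Suc l) k T)"
    if k: "k \<in> {Suc l..<n}" for k
  proof -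
    let ?I = "{Suc l..<k}"
    have I: "{l..<k} = insert l ?I"
      using k by auto
    have "inj_on (insert l) (Pow ?I)"
      by (rule inj_onI) (metis PowD atLeastLessThan_iff insert_ident not_less_eq_eq order_refl subsetD)
    then have "(\<Sum>T\<in>Pow {l..<k}. summand G l k T) = (\<Sum>T\<in>Pow ?I. summand G l k (insert l T)) + (\<Sum>T\<in>Pow ?I. summand G l k T)"
      unfolding I Pow_insert by (subst sum.union_disjoint) (auto simp: sum.reindex)
    \<comment> \<open>As the least index, \<open>l\<close> crosses nothing when it is put
      first.\<close>
    moreover have "summand G l k (insert l T) = summand (\<lambda>ts ss x rs. G (f l # ts) ss x rs) (Suc l) k T"
      if T: "T \<in> Pow ?I" for T
    proof -
      have fin: "finite T" and l: "l \<notin> T" and less: "\<forall>x\<in>T. l < x"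
        using T finite_subset by auto
      have "insert l ?I - insert l T = ?I - T"
        using l by auto
      moreover have "{s \<in> ?I - T. s < l} = {}"
        by auto
      then have "crossing_exponent ?g (insert l T) (?I - T) = crossing_exponent ?g T (?I - T)"
        by (simp only: crossing_exponent_def sum.insert [OF fin l] sum.empty add_0)
      ultimately show ?thesis
        by (simp only: summand_def I sorted_list_of_set_insert_less [OF fin less] list.map)
    qed
    \<comment> \<open>When \<open>l\<close> stays behind, every index in \<open>T\<close> crosses
      it; this is the sign in the recursion.\<close>
    moreover have "summand G l k T = summand (\<lambda>ts ss x rs. sg (?g l * total_deg ts) (G ts (f l # ss) x rs)) (Suc l) k T"
      if T: "T \<in> Pow ?I" for T
    proof -
      have fin: "finite T" and l: "l \<notin> T" and less: "\<forall>x\<in>T. l < x"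
        using T finite_subset by auto
      have compl: "insert l ?I - T = insert l (?I - T)"
        using l by auto
      have "(\<Sum>s\<in>{s \<in> insert l (?I - T). s < t}. ?g t * ?g s) = (\<Sum>s\<in>{s \<in> ?I - T. s < t}. ?g t * ?g s) + ?g l * ?g t"
        if "t \<in> T" for t
      proof -
        have "{s \<in> insert l (?I - T). s < t} = insert l {s \<in> ?I - T. s < t}"
          using that less by auto
        then show ?thesis by simp
      qed
      then have "crossing_exponent ?g T (insert l (?I - T))
          = crossing_exponent ?g T (?I - T) + ?g l * total_deg (map f (sorted_list_of_set T))"
        by (simp add: crossing_exponent_def total_deg_map_sorted_list_of_set fin sum.distrib sum_distrib_left)
      moreover have "sorted_list_of_set (insert l (?I - T)) = l # sorted_list_of_set (?I - T)"
        by (rule sorted_list_of_set_insert_less) auto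
      ultimately show ?thesis
        by (simp only: summand_def I compl list.map sg_sg)
    qed
    ultimately show ?thesis by simp
  qed
  then have "(\<Sum>k=Suc l..<n. \<Sum>T\<in>Pow {l..<k}. summand G l k T) =
      unshuffle_sum (\<lambda>ts ss x rs. G (f l # ts) ss x rs) (map f [Suc l..<n])
      + unshuffle_sum (\<lambda>ts ss x rs. sg (?g l * total_deg ts) (G ts (f l # ss) x rs)) (map f [Suc l..<n])"
    unfolding IH by (simp add: sum.distrib)
  \<comment> \<open>For \<open>k = l\<close> nothing precedes the root, so \<open>T\<close> is
    empty.\<close>
  moreover have "summand G l l {} = G [] [] (f l) (map f [Suc l..<n])"
    by (simp add: summand_def crossing_exponent_def)
  ultimately have "unshuffle_sum G (map f [l..<n]) = (\<Sum>k=l..<n. \<Sum>T\<in>Pow {l..<k}. summand G l k T)"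
    using ln by (simp add: upt_conv_Cons sum.atLeast_Suc_lessThan add.assoc)
  then show ?case
    unfolding summand_def .
qed

section \<open>Shuffles as subsets\<close>

lemma shuffle_image_compl:
  assumes "\<sigma> \<in> shuffle p q"
  shows "\<sigma> ` {p + 1..p + q} = {1..p + q} - \<sigma> ` {1..p}"
proof -
  have perm: "\<sigma> permutes {1..p + q}"
    using assms by (simp add: shuffle_def)
  have "{p + 1..p + q} = {1..p + q} - {1..p}"
    by auto
  then show ?thesis
    using image_set_diff [OF permutes_inj [OF perm], of "{1..p + q}" "{1..p}"] permutes_image [OF perm] by simp
qed

lemma map_strict_mono_eq_sorted_list_of_set:
  assumes "strict_mono_on {a..b} (\<sigma> :: nat \<Rightarrow> nat)"
  shows "map \<sigma> [a..<b + 1] = sorted_list_of_set (\<sigma> ` {a..b})"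
proof -
  have "sorted_wrt (<) (map \<sigma> [a..<b + 1])"
    unfolding sorted_wrt_map
    by (rule sorted_wrt_mono_rel [OF _ sorted_wrt_upt]) (use strict_mono_onD [OF assms] in auto)
  moreover have "set (map \<sigma> [a..<b + 1]) = \<sigma> ` {a..b}"
    by (auto simp del: upt_Suc)
  ultimately show ?thesis
    by (metis sorted_list_of_set.idem_if_sorted_distinct strict_sorted_iff)
qed

lemma
  assumes "\<sigma> \<in> shuffle p q"
  shows map_shuffle_left: "map \<sigma> [1..<p + 1] = sorted_list_of_set (\<sigma> ` {1..p})"
    and map_shuffle_right: "map \<sigma> [p + 1..<p + q + 1] = sorted_list_of_set ({1..p + q} - \<sigma> ` {1..p})"
  using assms map_strict_mono_eq_sorted_list_of_set [of 1 p \<sigma>]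
    map_strict_mono_eq_sorted_list_of_set [of "p + 1" "p + q" \<sigma>] shuffle_image_compl [OF assms]
  by (simp_all add: shuffle_def)

text \<open>A shuffle is increasing on both blocks, so each inversion pairs a position up to
  \<open>p\<close> with one beyond \<open>p\<close>.\<close>

lemma koszul_exponent_shuffle:
  assumes "\<sigma> \<in> shuffle p q"
  shows "koszul_exponent g (p + q) \<sigma> = crossing_exponent g (\<sigma> ` {1..p}) ({1..p + q} - \<sigma> ` {1..p})"
proof -
  have perm: "\<sigma> permutes {1..p + q}" and left: "strict_mono_on {1..p} \<sigma>"
    and right: "strict_mono_on {p + 1..p + q} \<sigma>"
    using assms by (auto simp: shuffle_def)
  have inj: "inj \<sigma>"
    by (rule permutes_inj [OF perm])
  have "{(r, s). 1 \<le> r \<and> r < s \<and> s \<le> p + q \<and> \<sigma> s < \<sigma> r}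
      = (SIGMA r:{1..p}. {s \<in> {p + 1..p + q}. \<sigma> s < \<sigma> r})" (is "?I = ?J")
  proof
    show "?I \<subseteq> ?J"
    proof (rule subsetI, unfold mem_Collect_eq, elim case_prodE conjE, hypsubst)
      fix r s assume rs: "1 \<le> r" "r < s" "s \<le> p + q" "\<sigma> s < \<sigma> r"
      have "r \<le> p"
        using strict_mono_onD [OF right, of r s] rs by (cases "r \<le> p") auto
      moreover have "p < s"
        using strict_mono_onD [OF left, of r s] rs by (cases "p < s") auto
      ultimately show "(r, s) \<in> ?J"
        using rs by auto
    qed
    show "?J \<subseteq> ?I"
      by auto
  qed
  then have "koszul_exponent g (p + q) \<sigma>
      = (\<Sum>r\<in>{1..p}. \<Sum>s\<in>{s \<in> {p + 1..p + q}. \<sigma> s < \<sigma> r}. g (\<sigma> r) * g (\<sigma> s))"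
    by (simp add: koszul_exponent_def sum.Sigma)
  also have "\<dots> = (\<Sum>r\<in>{1..p}. \<Sum>s\<in>{s \<in> \<sigma> ` {p + 1..p + q}. s < \<sigma> r}. g (\<sigma> r) * g s)"
  proof (rule sum.cong [OF refl])
    fix r
    have "{s \<in> \<sigma> ` {p + 1..p + q}. s < \<sigma> r} = \<sigma> ` {s \<in> {p + 1..p + q}. \<sigma> s < \<sigma> r}"
      by auto
    then show "(\<Sum>s\<in>{s \<in> {p + 1..p + q}. \<sigma> s < \<sigma> r}. g (\<sigma> r) * g (\<sigma> s))
        = (\<Sum>s\<in>{s \<in> \<sigma> ` {p + 1..p + q}. s < \<sigma> r}. g (\<sigma> r) * g s)"
      using inj by (simp add: sum.reindex inj_on_subset)
  qed
  also have "\<dots> = (\<Sum>t\<in>\<sigma> ` {1..p}. \<Sum>s\<in>{s \<in> \<sigma> ` {p + 1..p + q}. s < t}. g t * g s)"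
    using inj by (simp add: sum.reindex inj_on_subset)
  finally show ?thesis
    unfolding crossing_exponent_def shuffle_image_compl [OF assms] .
qed

lemma shuffle_exists:
  assumes "T \<subseteq> {1..m}"
  shows "\<exists>\<sigma>\<in>shuffle (card T) (m - card T). \<sigma> ` {1..card T} = T"
proof -
  let ?p = "card T"
  have fin: "finite T"
    using assms finite_subset by blast
  let ?S = "{1..m} - T"
  let ?xs = "sorted_list_of_set T"
  let ?ys = "sorted_list_of_set ?S"
  have pm: "?p \<le> m"
    using card_mono [OF _ assms] by simp
  have lx: "length ?xs = ?p" and ly: "length ?ys = m - ?p"
    using card_Diff_subset [OF fin assms] by simp_all
  \<comment> \<open>\<open>T\<close> in increasing order, followed by its complement. The shift by
    one reconciles positions counted from one with lists indexed from zero; outside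
    \<open>{1..m}\<close> a permutation must be the identity.\<close>
  define \<sigma> where "\<sigma> r = (if r \<in> {1..m} then (?xs @ ?ys) ! (r - 1) else r)" for r
  have "bij_betw (\<lambda>r. r - 1) {1..m} {..<m}"
    by (rule bij_betw_byWitness [where f' = Suc]) auto
  moreover have "bij_betw ((!) (?xs @ ?ys)) {..<m} {1..m}"
    by (rule bij_betw_nth) (use assms fin pm lx ly in auto)
  ultimately have "bij_betw ((!) (?xs @ ?ys) \<circ> (\<lambda>r. r - 1)) {1..m} {1..m}"
    by (rule bij_betw_trans)
  then have "bij_betw \<sigma> {1..m} {1..m}"
    by (rule bij_betw_cong [THEN iffD1, rotated]) (simp add: \<sigma>_def)
  then have perm: "\<sigma> permutes {1..m}"
    by (rule bij_imp_permutes) (auto simp: \<sigma>_def)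
  have left: "\<sigma> r = ?xs ! (r - 1)" if "r \<in> {1..?p}" for r
    using that pm lx by (auto simp: \<sigma>_def nth_append)
  have right: "\<sigma> r = ?ys ! (r - 1 - ?p)" if "r \<in> {?p + 1..m}" for r
    using that pm lx by (auto simp: \<sigma>_def nth_append)
  have "strict_mono_on {1..?p} \<sigma>"
  proof (rule strict_mono_onI)
    fix r s assume rs: "r \<in> {1..?p}" "s \<in> {1..?p}" "r < s"
    then have "?xs ! (r - 1) < ?xs ! (s - 1)"
      using sorted_wrt_nth_less [OF strict_sorted_list_of_set, of "r - 1" "s - 1" T] lx by auto
    then show "\<sigma> r < \<sigma> s"
      using left rs by simp
  qed
  moreover have "strict_mono_on {?p + 1..m} \<sigma>"
  proof (rule strict_mono_onI)
    fix r s assume rs: "r \<in> {?p + 1..m}" "s \<in> {?p + 1..m}" "r < s"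
    then have "?ys ! (r - 1 - ?p) < ?ys ! (s - 1 - ?p)"
      using sorted_wrt_nth_less [OF strict_sorted_list_of_set, of "r - 1 - ?p" "s - 1 - ?p" ?S] ly by auto
    then show "\<sigma> r < \<sigma> s"
      using right rs by simp
  qed
  ultimately have "\<sigma> \<in> shuffle ?p (m - ?p)"
    using perm pm by (simp add: shuffle_def)
  moreover have "\<sigma> ` {1..?p} = T"
  proof -
    have "\<sigma> ` {1..?p} = (\<lambda>r. ?xs ! (r - 1)) ` {1..?p}"
      using left by (rule image_cong [OF refl])
    also have "\<dots> = (!) ?xs ` ((\<lambda>r. r - 1) ` {1..?p})"
      by (simp only: image_image)
    also have "(\<lambda>r. r - 1) ` {1..?p} = {..<?p}"
      by (auto intro!: image_eqI [where x = "Suc _"])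
    also have "(!) ?xs ` {..<?p} = set ?xs"
      using lx by (auto simp: set_conv_nth)
    finally show ?thesis
      using fin by simp
  qed
  ultimately show ?thesis by blast
qed

text \<open>The image of the first block determines a shuffle, since both blocks are listed
  increasingly, and its cardinality recovers \<open>p\<close>; hence all block sizes are taken
  together.\<close>

lemma bij_betw_shuffle_Pow:
  "bij_betw (\<lambda>(p, \<sigma>). \<sigma> ` {1..p}) (SIGMA p:{..m}. shuffle p (m - p)) (Pow {1..m})"
proof (rule bij_betw_imageI)
  show "inj_on (\<lambda>(p, \<sigma>). \<sigma> ` {1..p}) (SIGMA p:{..m}. shuffle p (m - p))"
  proof (rule inj_onI, elim SigmaE, hypsubst, unfold case_prod_conv)
    fix p \<sigma> p' \<sigma>'
    assume p: "p \<in> {..m}" and p': "p' \<in> {..m}" and \<sigma>: "\<sigma> \<in> shuffle p (m - p)" and \<sigma>': "\<sigma>' \<in> shuffle p' (m - p')"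
      and eq: "\<sigma> ` {1..p} = \<sigma>' ` {1..p'}"
    have perm: "\<sigma> permutes {1..m}" "\<sigma>' permutes {1..m}"
      using \<sigma> \<sigma>' p p' by (auto simp: shuffle_def)
    have "card (\<sigma> ` {1..p}) = p" "card (\<sigma>' ` {1..p'}) = p'"
      using permutes_inj [OF perm(1)] permutes_inj [OF perm(2)] by (simp_all add: card_image inj_on_subset)
    then have pp': "p = p'"
      using eq by simp
    have "map \<sigma> [1..<p + 1] = map \<sigma>' [1..<p + 1]"
      using map_shuffle_left [OF \<sigma>] map_shuffle_left [OF \<sigma>'] eq pp' by (simp del: upt_Suc)
    moreover have "map \<sigma> [p + 1..<m + 1] = map \<sigma>' [p + 1..<m + 1]"
      using map_shuffle_right [OF \<sigma>] map_shuffle_right [OF \<sigma>'] eq pp' p by (simp del: upt_Suc)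
    ultimately have "\<sigma> r = \<sigma>' r" if "r \<in> {1..m}" for r
      using that by (cases "r \<le> p") (auto simp del: upt_Suc)
    moreover have "\<sigma> r = \<sigma>' r" if "r \<notin> {1..m}" for r
      using that perm by (metis permutes_not_in)
    ultimately have "\<sigma> = \<sigma>'"
      by blast
    with pp' show "(p, \<sigma>) = (p', \<sigma>')"
      by simp
  qed
  show "(\<lambda>(p, \<sigma>). \<sigma> ` {1..p}) ` (SIGMA p:{..m}. shuffle p (m - p)) = Pow {1..m}"
  proof
    show "(\<lambda>(p, \<sigma>). \<sigma> ` {1..p}) ` (SIGMA p:{..m}. shuffle p (m - p)) \<subseteq> Pow {1..m}"
    proof (rule image_subsetI, elim SigmaE, hypsubst, unfold case_prod_conv)
      fix p \<sigma> assume p: "p \<in> {..m}" and \<sigma>: "\<sigma> \<in> shuffle p (m - p)"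
      have "\<sigma> permutes {1..m}"
        using \<sigma> p by (auto simp: shuffle_def)
      then have "\<sigma> ` {1..p} \<subseteq> {1..m}"
        using p permutes_image [of \<sigma> "{1..m}"] image_mono [of "{1..p}" "{1..m}" \<sigma>] by auto
      then show "\<sigma> ` {1..p} \<in> Pow {1..m}"
        by simp
    qed
    show "Pow {1..m} \<subseteq> (\<lambda>(p, \<sigma>). \<sigma> ` {1..p}) ` (SIGMA p:{..m}. shuffle p (m - p))"
    proof
      fix T assume T: "T \<in> Pow {1..m}"
      then obtain \<sigma> where "\<sigma> \<in> shuffle (card T) (m - card T)" "\<sigma> ` {1..card T} = T"
        using shuffle_exists by blast
      moreover have "card T \<le> m"
        using T card_mono [of "{1..m}" T] by simp
      ultimately show "T \<in> (\<lambda>(p, \<sigma>). \<sigma> ` {1..p}) ` (SIGMA p:{..m}. shuffle p (m - p))"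
        by (intro image_eqI [where x = "(card T, \<sigma>)"]) auto
    qed
  qed
qed

lemma finite_shuffle: "finite (shuffle p q)"
  by (rule finite_subset [OF _ finite_permutations [of "{1..p + q}"]]) (auto simp: shuffle_def)

text \<open>Here \<open>k\<close> is the position of the root, \<open>k - j\<close> the number of
  earlier entries in the outer bracket and \<open>j - 1\<close> the number in the inner one. For
  fixed \<open>k\<close>, summing over \<open>j\<close> runs through all subsets of the earlier
  positions.\<close>

lemma unshuffle_sum_shuffle:
  fixes f :: "nat \<Rightarrow> int \<times> 'v"
  shows "unshuffle_sum G (map f [1..<n + 1]) =
    (\<Sum>(i, j)\<in>{(i, j). 1 \<le> i \<and> 1 \<le> j \<and> i + j = n + 1}. \<Sum>k=j..n. \<Sum>\<sigma>\<in>shuffle (k - j) (j - 1).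
       sg (koszul_exponent (\<lambda>r. fst (f r)) (k - 1) \<sigma>)
         (G (map (\<lambda>r. f (\<sigma> r)) [1..<k - j + 1]) (map (\<lambda>r. f (\<sigma> r)) [k - j + 1..<k]) (f k) (map f [k + 1..<n + 1])))"
proof -
  let ?g = "\<lambda>r. fst (f r)"
  define H where "H k j \<sigma> = sg (koszul_exponent ?g (k - 1) \<sigma>)
      (G (map (\<lambda>r. f (\<sigma> r)) [1..<k - j + 1]) (map (\<lambda>r. f (\<sigma> r)) [k - j + 1..<k]) (f k) (map f [k + 1..<n + 1]))"
    for k j \<sigma>
  define H' where "H' k T = sg (crossing_exponent ?g T ({1..<k} - T))
      (G (map f (sorted_list_of_set T)) (map f (sorted_list_of_set ({1..<k} - T))) (f k) (map f [Suc k..<n + 1]))"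
    for k T
  have inner: "(\<Sum>j=1..k. \<Sum>\<sigma>\<in>shuffle (k - j) (j - 1). H k j \<sigma>) = (\<Sum>T\<in>Pow {1..<k}. H' k T)"
    if k: "k \<in> {1..n}" for k
  proof -
    define m where "m = k - 1"
    have km: "k = Suc m"
      using k by (simp add: m_def)
    have H: "H k (k - p) \<sigma> = H' k (\<sigma> ` {1..p})" if p: "p \<le> m" and \<sigma>: "\<sigma> \<in> shuffle p (m - p)" for p \<sigma>
    proof -
      have map_f: "map (\<lambda>r. f (\<sigma> r)) xs = map f (map \<sigma> xs)" for xs
        by (simp add: comp_def)
      have "map (\<lambda>r. f (\<sigma> r)) [1..<p + 1] = map f (sorted_list_of_set (\<sigma> ` {1..p}))"
        by (simp only: map_f map_shuffle_left [OF \<sigma>])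
      moreover have "map \<sigma> [p + 1..<k] = sorted_list_of_set ({1..<k} - \<sigma> ` {1..p})"
        using map_shuffle_right [OF \<sigma>] p km by (simp add: atLeastLessThanSuc_atLeastAtMost)
      then have "map (\<lambda>r. f (\<sigma> r)) [p + 1..<k] = map f (sorted_list_of_set ({1..<k} - \<sigma> ` {1..p}))"
        by (simp only: map_f)
      moreover have "koszul_exponent ?g (k - 1) \<sigma> = crossing_exponent ?g (\<sigma> ` {1..p}) ({1..<k} - \<sigma> ` {1..p})"
        using koszul_exponent_shuffle [OF \<sigma>, of ?g] p km by (simp add: atLeastLessThanSuc_atLeastAtMost)
      moreover have "k - (k - p) = p"
        using p km by simp
      ultimately show ?thesis
        unfolding H_def H'_def by simp
    qed
    have "(\<Sum>j=1..k. \<Sum>\<sigma>\<in>shuffle (k - j) (j - 1). H k j \<sigma>) = (\<Sum>p\<le>m. \<Sum>\<sigma>\<in>shuffle p (m - p). H k (k - p) \<sigma>)"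
      by (rule sum.reindex_bij_witness [where i = "\<lambda>p. k - p" and j = "\<lambda>j. k - j"]) (use km in auto)
    also have "\<dots> = (\<Sum>(p, \<sigma>)\<in>(SIGMA p:{..m}. shuffle p (m - p)). H' k (\<sigma> ` {1..p}))"
      by (subst sum.Sigma) (auto simp: finite_shuffle H intro!: sum.cong)
    also have "\<dots> = (\<Sum>T\<in>Pow {1..m}. H' k T)"
      using sum.reindex_bij_betw [OF bij_betw_shuffle_Pow, of "H' k" m] by (simp add: case_prod_unfold)
    finally show ?thesis
      by (simp add: km atLeastLessThanSuc_atLeastAtMost)
  qed
  \<comment> \<open>\<open>i\<close> is determined by \<open>j\<close>; the sums over
    \<open>j\<close> and \<open>k\<close> are then exchanged so that the root is fixed
    first.\<close>
  have "(\<Sum>(i, j)\<in>{(i, j). 1 \<le> i \<and> 1 \<le> j \<and> i + j = n + 1}. \<Sum>k=j..n. \<Sum>\<sigma>\<in>shuffle (k - j) (j - 1). H k j \<sigma>)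
      = (\<Sum>j=1..n. \<Sum>k=j..n. \<Sum>\<sigma>\<in>shuffle (k - j) (j - 1). H k j \<sigma>)"
    by (rule sum.reindex_bij_witness [where i = "\<lambda>j. (n + 1 - j, j)" and j = snd]) auto
  also have "\<dots> = (\<Sum>j=1..n. \<Sum>k | k \<in> {1..n} \<and> j \<le> k. \<Sum>\<sigma>\<in>shuffle (k - j) (j - 1). H k j \<sigma>)"
    by (intro sum.cong) auto
  also have "\<dots> = (\<Sum>k=1..n. \<Sum>j | j \<in> {1..n} \<and> j \<le> k. \<Sum>\<sigma>\<in>shuffle (k - j) (j - 1). H k j \<sigma>)"
    by (rule sum.swap_restrict) auto
  also have "\<dots> = (\<Sum>k=1..n. \<Sum>j=1..k. \<Sum>\<sigma>\<in>shuffle (k - j) (j - 1). H k j \<sigma>)"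
    by (intro sum.cong) auto
  also have "\<dots> = (\<Sum>k=1..n. \<Sum>T\<in>Pow {1..<k}. H' k T)"
    by (intro sum.cong refl inner) simp
  also have "\<dots> = unshuffle_sum G (map f [1..<n + 1])"
    unfolding unshuffle_sum_interval H'_def by (intro sum.cong) auto
  finally show ?thesis
    unfolding H_def by simp
qed

section \<open>Graded modules\<close>

lemma
  assumes "graded_space V"
  shows graded_space_additive_subgroup: "additive_subgroup (cmp V n)"
    and graded_space_scl_in: "x \<in> cmp V n \<Longrightarrow> scl V c x \<in> cmp V n"
proof -
  have V: "vector_space (scl V)" and sub: "module.subspace (scl V) (cmp V n)"
    using assms unfolding graded_space_def by blast+
  interpret vector_space "scl V" by (rule V)
  show "additive_subgroup (cmp V n)"
    unfolding additive_subgroup_def using sub subspace_0 subspace_add subspace_neg by blast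
  show "x \<in> cmp V n \<Longrightarrow> scl V c x \<in> cmp V n"
    using sub subspace_scale by blast
qed

lemma graded_space_independent:
  assumes "graded_space V"
  shows "\<forall>N x. finite N \<and> (\<forall>n\<in>N. x n \<in> cmp V n) \<and> (\<Sum>n\<in>N. x n) = 0 \<longrightarrow> (\<forall>n\<in>N. x n = 0)"
  using assms unfolding graded_space_def by (elim conjE)

lemma deg_eq:
  assumes V: "graded_space V" and v: "v \<in> cmp V n" "v \<noteq> 0"
  shows "deg V v = n"
proof -
  have "v \<in> cmp V (deg V v)"
    unfolding deg_def using v(1) by (rule someI)
  moreover have "m = n" if m: "v \<in> cmp V m" for m
  proof (rule ccontr)
    assume "m \<noteq> n"
    \<comment> \<open>With two degrees, \<open>v\<close> and \<open>- v\<close> would form a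
      vanishing sum of nonzero elements from different components.\<close>
    let ?x = "\<lambda>i. if i = n then v else - v"
    have "finite {m, n} \<and> (\<forall>i\<in>{m, n}. ?x i \<in> cmp V i) \<and> (\<Sum>i\<in>{m, n}. ?x i) = 0"
      using \<open>m \<noteq> n\<close> v(1) m additive_subgroupD(3) [OF graded_space_additive_subgroup [OF V]] by auto
    then have "\<forall>i\<in>{m, n}. ?x i = 0"
      using graded_space_independent [OF V, THEN spec, THEN spec, of "{m, n}" ?x] by (rule mp [rotated])
    then show False
      using v(2) by simp
  qed
  ultimately show ?thesis by blast
qed

lemma graded_linearD:
  assumes "graded_linear V W p f"
  shows "v \<in> cmp V n \<Longrightarrow> f v \<in> cmp W (n + p)"
    and "additive_on (cmp V n) f"
    and "v \<in> cmp V n \<Longrightarrow> f (scl V c v) = scl W c (f v)"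
  using assms unfolding graded_linear_def additive_on_def by blast+

lemma graded_moduleD:
  assumes "graded_module A M"
  shows "graded_space M"
    and "a \<in> cmp A i \<Longrightarrow> m \<in> cmp M j \<Longrightarrow> act M a m \<in> cmp M (i + j)"
    and "m \<in> cmp M j \<Longrightarrow> additive_on (cmp A i) (\<lambda>a. act M a m)"
    and "a \<in> cmp A i \<Longrightarrow> additive_on (cmp M j) (act M a)"
    and "a \<in> cmp A i \<Longrightarrow> m \<in> cmp M j \<Longrightarrow> act M (scl A c a) m = scl M c (act M a m)"
    and "a \<in> cmp A i \<Longrightarrow> m \<in> cmp M j \<Longrightarrow> act M a (scl M c m) = scl M c (act M a m)"
    and "a \<in> cmp A i \<Longrightarrow> b \<in> cmp A k \<Longrightarrow> m \<in> cmp M j \<Longrightarrow> act M (a * b) m = act M a (act M b m)"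
    and "m \<in> cmp M j \<Longrightarrow> act M 1 m = m"
  using assms unfolding graded_module_def additive_on_def by (elim conjE; metis)+

lemma cdgaD:
  assumes "cdga A d"
  shows "graded_space A"
    and "1 \<in> cmp A 0"
    and "x \<in> cmp A i \<Longrightarrow> y \<in> cmp A j \<Longrightarrow> x * y \<in> cmp A (i + j)"
    and "x \<in> cmp A i \<Longrightarrow> y \<in> cmp A j \<Longrightarrow> x * y = sg (i * j) (y * x)"
    and "x \<in> cmp A i \<Longrightarrow> y \<in> cmp A j \<Longrightarrow> scl A c x * y = scl A c (x * y)"
    and "x \<in> cmp A i \<Longrightarrow> y \<in> cmp A j \<Longrightarrow> x * scl A c y = scl A c (x * y)"
    and "graded_linear A A 1 d"
    and "x \<in> cmp A i \<Longrightarrow> d (d x) = 0"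
    and "x \<in> cmp A i \<Longrightarrow> y \<in> cmp A j \<Longrightarrow> d (x * y) = d x * y + sg i (x * d y)"
proof -
  from assms have *: "x * y \<in> cmp A (i + j) \<and> x * y = sg (i * j) (y * x) \<and>
        (\<forall>c. scl A c (x * y) = scl A c x * y \<and> scl A c (x * y) = x * scl A c y)"
    if "x \<in> cmp A i" "y \<in> cmp A j" for x y i j
    using that unfolding cdga_def by blast
  show "x \<in> cmp A i \<Longrightarrow> y \<in> cmp A j \<Longrightarrow> x * y \<in> cmp A (i + j)"
    "x \<in> cmp A i \<Longrightarrow> y \<in> cmp A j \<Longrightarrow> x * y = sg (i * j) (y * x)"
    "x \<in> cmp A i \<Longrightarrow> y \<in> cmp A j \<Longrightarrow> scl A c x * y = scl A c (x * y)"
    "x \<in> cmp A i \<Longrightarrow> y \<in> cmp A j \<Longrightarrow> x * scl A c y = scl A c (x * y)"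
    using * by metis+
qed (use assms in \<open>unfold cdga_def, blast+\<close>)

lemma dg_moduleD:
  assumes "dg_module A d M dM"
  shows "graded_module A M"
    and "graded_linear M M 1 dM"
    and "m \<in> cmp M j \<Longrightarrow> dM (dM m) = 0"
    and "a \<in> cmp A i \<Longrightarrow> m \<in> cmp M j \<Longrightarrow> dM (act M a m) = act M (d a) m + sg i (act M a (dM m))"
  using assms unfolding dg_module_def by blast+

lemma dg_derivationD:
  assumes "dg_derivation A d \<Omega> d\<Omega> \<delta>"
  shows "a \<in> cmp A i \<Longrightarrow> \<delta> a \<in> cmp \<Omega> i"
    and "a \<in> cmp A i \<Longrightarrow> \<delta> (d a) = d\<Omega> (\<delta> a)"
  using assms graded_linearD(1) [of A \<Omega> 0 \<delta>] unfolding dg_derivation_def by auto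

section \<open>The contraction\<close>

lemma lookup_free_scl [simp]: "Poly_Mapping.lookup (free_scl c x) p = c * Poly_Mapping.lookup x p"
  unfolding free_scl_def by (simp add: map.rep_eq when_def)

lemma vector_space_free_scl: "vector_space (free_scl :: 'k::field_char_0 \<Rightarrow> ('p \<Rightarrow>\<^sub>0 'k) \<Rightarrow> _)"
  by unfold_locales (auto intro!: poly_mapping_eqI simp: lookup_add algebra_simps)

text \<open>Enlarging the index set beyond the support lets sums with different supports be
  added.\<close>

lemma lin_ext_superset:
  assumes "vector_space s" "finite K" "Poly_Mapping.keys x \<subseteq> K"
  shows "lin_ext s f x = (\<Sum>p\<in>K. s (Poly_Mapping.lookup x p) (f p))"
proof -
  interpret vector_space s by (rule assms)
  show ?thesis
    unfolding lin_ext_def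
    by (rule sum.mono_neutral_left) (use assms(2,3) in \<open>auto simp: in_keys_iff\<close>)
qed

lemma lin_ext_add:
  assumes "vector_space s"
  shows "lin_ext s f (x + y) = lin_ext s f x + lin_ext s f y"
proof -
  interpret vector_space s by (rule assms)
  let ?K = "Poly_Mapping.keys x \<union> Poly_Mapping.keys y"
  have "lin_ext s f z = (\<Sum>p\<in>?K. s (Poly_Mapping.lookup z p) (f p))" if "Poly_Mapping.keys z \<subseteq> ?K" for z
    by (rule lin_ext_superset [OF assms]) (use that in auto)
  then show ?thesis
    by (simp add: keys_add lookup_add scale_left_distrib sum.distrib)
qed

lemma lin_ext_free_scl:
  assumes "vector_space s"
  shows "lin_ext s f (free_scl c x) = s c (lin_ext s f x)"
proof -
  interpret vector_space s by (rule assms)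
  have "lin_ext s f (free_scl c x) = (\<Sum>p\<in>Poly_Mapping.keys x. s (Poly_Mapping.lookup (free_scl c x) p) (f p))"
    by (rule lin_ext_superset [OF assms]) (auto simp: in_keys_iff)
  then show ?thesis
    by (simp add: lin_ext_def scale_sum_right)
qed

lemma lin_ext_0: "lin_ext s f 0 = 0"
  by (simp add: lin_ext_def)

lemma lin_ext_minus:
  assumes "vector_space s"
  shows "lin_ext s f (- x) = - lin_ext s f x"
  using lin_ext_add [OF assms, of f x "- x"] by (simp add: lin_ext_0 minus_unique)

lemma lin_ext_diff:
  assumes "vector_space s"
  shows "lin_ext s f (x - y) = lin_ext s f x - lin_ext s f y"
  using lin_ext_add [OF assms, of f x "- y"] by (simp add: lin_ext_minus [OF assms])

lemma lin_ext_sg: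
  assumes "vector_space s"
  shows "lin_ext s f (sg n x) = sg n (lin_ext s f x)"
  by (simp add: sg_def lin_ext_minus [OF assms])

lemma lin_ext_gen:
  assumes "vector_space s"
  shows "lin_ext s f (gen w e) = f (w, e)"
proof -
  interpret vector_space s by (rule assms)
  show ?thesis by (simp add: lin_ext_def gen_def)
qed

lemma lin_ext_cong:
  assumes "\<And>p. p \<in> Poly_Mapping.keys x \<Longrightarrow> f p = g p"
  shows "lin_ext s f x = lin_ext s g x"
  unfolding lin_ext_def using assms by simp

lemma lin_ext_sum:
  assumes "vector_space s"
  shows "lin_ext s f (\<Sum>p\<in>K. x p) = (\<Sum>p\<in>K. lin_ext s f (x p))"
  by (induction K rule: infinite_finite_induct) (simp_all add: lin_ext_0 lin_ext_add [OF assms])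

lemma lin_ext_lin_ext:
  assumes "vector_space s"
  shows "lin_ext s f (lin_ext free_scl g x) = lin_ext s (\<lambda>p. lin_ext s f (g p)) x"
  by (simp add: lin_ext_def [of free_scl] lin_ext_def [of s "\<lambda>p. lin_ext s f (g p)"]
      lin_ext_sum [OF assms] lin_ext_free_scl [OF assms])

lemma lin_ext_pointwise:
  assumes "vector_space s"
  shows "lin_ext s (\<lambda>p. f p + g p) x = lin_ext s f x + lin_ext s g x"
    and "lin_ext s (\<lambda>p. sg n (f p)) x = sg n (lin_ext s f x)"
proof -
  interpret vector_space s by (rule assms)
  show "lin_ext s (\<lambda>p. f p + g p) x = lin_ext s f x + lin_ext s g x"
    by (simp add: lin_ext_def scale_right_distrib sum.distrib)
  show "lin_ext s (\<lambda>p. sg n (f p)) x = sg n (lin_ext s f x)"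
    by (simp add: lin_ext_def sg_def sum_negf)
qed

lemma contraction_eqI:
  assumes "X \<noteq> {}" "\<And>x. x \<in> X \<Longrightarrow> lin_ext (scl E) (\<lambda>(w, e). act E (b w) e) x = v"
  shows "contraction E b X = v"
proof -
  have "(\<lambda>x. lin_ext (scl E) (\<lambda>(w, e). act E (b w) e) x) ` X = {v}"
    using assms by force
  then show ?thesis
    by (simp add: contraction_def)
qed

lemma dual_cmpD:
  assumes "b \<in> cmp (dual A \<Omega>) n"
  shows "w \<in> cmp \<Omega> i \<Longrightarrow> b w \<in> cmp A (i + n)"
    and "additive_on (cmp \<Omega> i) b"
    and "w \<in> cmp \<Omega> i \<Longrightarrow> b (scl \<Omega> c w) = scl A c (b w)"
    and "a \<in> cmp A p \<Longrightarrow> w \<in> cmp \<Omega> i \<Longrightarrow> b (act \<Omega> a w) = sg (p * n) (a * b w)"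
    and "w \<notin> homogeneous \<Omega> \<Longrightarrow> b w = 0"
proof -
  have lin: "graded_linear \<Omega> (self_module A) n b"
    and hom: "\<forall>i j. \<forall>a\<in>cmp A i. \<forall>w\<in>cmp \<Omega> j. b (act \<Omega> a w) = sg (i * n) (act (self_module A) a (b w))"
    and out: "w \<notin> homogeneous \<Omega> \<longrightarrow> b w = 0"
    using assms by (auto simp: dual_def module_hom_def)
  show "w \<in> cmp \<Omega> i \<Longrightarrow> b w \<in> cmp A (i + n)" "additive_on (cmp \<Omega> i) b"
    "w \<in> cmp \<Omega> i \<Longrightarrow> b (scl \<Omega> c w) = scl A c (b w)"
    using graded_linearD [OF lin] by (auto simp: self_module_def)
  show "a \<in> cmp A p \<Longrightarrow> w \<in> cmp \<Omega> i \<Longrightarrow> b (act \<Omega> a w) = sg (p * n) (a * b w)"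
    using hom by (auto simp: self_module_def)
  show "w \<notin> homogeneous \<Omega> \<Longrightarrow> b w = 0"
    using out by blast
qed

lemma dual_cmpI:
  assumes "\<And>w i. w \<in> cmp \<Omega> i \<Longrightarrow> b w \<in> cmp A (i + n)"
    and "\<And>i. additive_on (cmp \<Omega> i) b"
    and "\<And>w i c. w \<in> cmp \<Omega> i \<Longrightarrow> b (scl \<Omega> c w) = scl A c (b w)"
    and "\<And>a p w i. a \<in> cmp A p \<Longrightarrow> w \<in> cmp \<Omega> i \<Longrightarrow> b (act \<Omega> a w) = sg (p * n) (a * b w)"
    and "\<And>w. w \<notin> homogeneous \<Omega> \<Longrightarrow> b w = 0"
  shows "b \<in> cmp (dual A \<Omega>) n"
  using assms unfolding additive_on_def
  by (simp add: dual_def module_hom_def graded_linear_def self_module_def)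

lemma dual_simps [simp]:
  "scl (dual A \<Omega>) c f = (\<lambda>w. scl A c (f w))"
  "act (dual A \<Omega>) a f = (\<lambda>w. a * f w)"
  by (simp_all add: dual_def)

lemma tensor_relator_cases [consumes 1, case_names 1 2 3 4]:
  assumes "r \<in> tensor_relators A \<Omega> E"
  obtains w w' e i j where "r = gen (w + w') e - gen w e - gen w' e" "w \<in> cmp \<Omega> i" "w' \<in> cmp \<Omega> i" "e \<in> cmp E j"
  | w e e' i j where "r = gen w (e + e') - gen w e - gen w e'" "w \<in> cmp \<Omega> i" "e \<in> cmp E j" "e' \<in> cmp E j"
  | c w e i j where "r = gen (scl \<Omega> c w) e - free_scl c (gen w e)" "w \<in> cmp \<Omega> i" "e \<in> cmp E j"
  | a w e k i j where "r = gen w (act E a e) - sg (k * i) (gen (act \<Omega> a w) e)"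
      "a \<in> cmp A k" "w \<in> cmp \<Omega> i" "e \<in> cmp E j"
  using assms unfolding tensor_relators_def by (elim UnE CollectE exE conjE) (blast+)

section \<open>Pairing functionals with representatives of tensors\<close>

locale tensor_pairing =
  fixes A :: "('k::field_char_0, 'a::{ring,monoid_mult}) graded_space"
    and dA :: "'a \<Rightarrow> 'a"
    and \<Omega> :: "('k, 'a, 'w::ab_group_add) graded_mod"
    and E :: "('k, 'a, 'e::ab_group_add) graded_mod"
  assumes cdga: "cdga A dA"
    and mod_\<Omega>: "graded_module A \<Omega>"
    and mod_E: "graded_module A E"
begin

lemma vs_E: "vector_space (scl E)"
  using graded_moduleD(1) [OF mod_E] by (simp add: graded_space_def)

lemma cmp_subgroup:
  "additive_subgroup (cmp A n)" "additive_subgroup (cmp \<Omega> n)" "additive_subgroup (cmp E n)"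
  using graded_space_additive_subgroup cdgaD(1) [OF cdga] graded_moduleD(1) [OF mod_\<Omega>] graded_moduleD(1) [OF mod_E]
  by blast+

definition pairing :: "('w \<Rightarrow> 'a) \<Rightarrow> ('w \<times> 'e \<Rightarrow>\<^sub>0 'k) \<Rightarrow> 'e" where
  "pairing b = lin_ext (scl E) (\<lambda>(w, e). act E (b w) e)"

text \<open>Module laws and linearity of functionals are available on homogeneous elements only, so
  representatives need homogeneous entries. Different terms may have different total
  degrees.\<close>

definition supported :: "('w \<times> 'e \<Rightarrow>\<^sub>0 'k) \<Rightarrow> bool" where
  "supported x \<longleftrightarrow> (\<forall>(w, e)\<in>Poly_Mapping.keys x. \<exists>i j. w \<in> cmp \<Omega> i \<and> e \<in> cmp E j)"

lemma supportedD:
  assumes "supported x" "(w, e) \<in> Poly_Mapping.keys x"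
  obtains i j where "w \<in> cmp \<Omega> i" "e \<in> cmp E j"
  using assms unfolding supported_def by blast

lemma pairing_relator:
  assumes b: "b \<in> cmp (dual A \<Omega>) n" and r: "r \<in> tensor_relators A \<Omega> E"
  shows "pairing b r = 0"
proof -
  note b' = dual_cmpD [OF b]
  note E = graded_moduleD [OF mod_E]
  note simps = lin_ext_diff [OF vs_E] lin_ext_gen [OF vs_E] lin_ext_free_scl [OF vs_E] lin_ext_sg [OF vs_E]
  from r show ?thesis
  proof (cases rule: tensor_relator_cases)
    case (1 w w' e i j)
    then show ?thesis
      using additive_onD(2) [OF b'(2) cmp_subgroup(2) 1(2,3)]
        additive_onD(2) [OF E(3) [OF 1(4)] cmp_subgroup(1) b'(1) [OF 1(2)] b'(1) [OF 1(3)]]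
      by (simp add: pairing_def simps)
  next
    case (2 w e e' i j)
    then show ?thesis
      using additive_onD(2) [OF E(4) [OF b'(1) [OF 2(2)]] cmp_subgroup(3) 2(3,4)] by (simp add: pairing_def simps)
  next
    case (3 c w e i j)
    then show ?thesis
      using b'(3) [OF 3(2)] E(5) [OF b'(1) [OF 3(2)] 3(3)] by (simp add: pairing_def simps)
  next
    case (4 a w e k i j)
    have bw: "b w \<in> cmp A (i + n)"
      by (rule b'(1) [OF 4(3)])
    have in_A: "b w * a \<in> cmp A (i + n + k)"
      by (rule cdgaD(3) [OF cdga bw 4(2)])
    \<comment> \<open>Moving \<open>a\<close> out of \<open>b\<close>, and then to the right of
      \<open>b w\<close>, produces \<open>k * n\<close> twice; what remains, \<open>k * i\<close>,
      is the sign of the right action on \<Omega>.\<close>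
    have "b (act \<Omega> a w) = sg (k * n + k * (i + n)) (b w * a)"
      using b'(4) [OF 4(2,3)] cdgaD(4) [OF cdga 4(2) bw] by simp
    also have "\<dots> = sg (k * i) (b w * a)"
      by (rule sg_cong) (simp add: algebra_simps)
    finally have "act E (b (act \<Omega> a w)) e = sg (k * i) (act E (b w * a) e)"
      using additive_onD(5) [OF E(3) [OF 4(4)] cmp_subgroup(1) in_A] by simp
    then have "act E (b (act \<Omega> a w)) e = sg (k * i) (act E (b w) (act E a e))"
      using E(7) [OF bw 4(2,4)] by simp
    then show ?thesis
      using 4 by (simp add: pairing_def simps) (simp add: sg_def)
  qed
qed

lemma pairing_span:
  assumes b: "b \<in> cmp (dual A \<Omega>) n" and r: "r \<in> module.span free_scl (tensor_relators A \<Omega> E)"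
  shows "pairing b r = 0"
proof -
  interpret F: vector_space "free_scl :: 'k \<Rightarrow> ('w \<times> 'e \<Rightarrow>\<^sub>0 'k) \<Rightarrow> _"
    by (rule vector_space_free_scl)
  interpret E: vector_space "scl E"
    by (rule vs_E)
  from r show ?thesis
  proof (rule F.span_induct)
    show "F.subspace {x. pairing b x = 0}"
      by (rule F.subspaceI)
        (simp_all add: pairing_def lin_ext_0 lin_ext_add [OF vs_E] lin_ext_free_scl [OF vs_E])
    show "pairing b x = 0" if "x \<in> tensor_relators A \<Omega> E" for x
      by (rule pairing_relator [OF b that])
  qed
qed

lemma pairing_coset:
  assumes b: "b \<in> cmp (dual A \<Omega>) n" and y: "y \<in> coset A \<Omega> E x"
  shows "pairing b y = pairing b x"
  using pairing_span [OF b, of "y - x"] y by (simp add: coset_def pairing_def lin_ext_diff [OF vs_E])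

lemma coset_self: "x \<in> coset A \<Omega> E x"
proof -
  interpret F: vector_space "free_scl :: 'k \<Rightarrow> ('w \<times> 'e \<Rightarrow>\<^sub>0 'k) \<Rightarrow> _"
    by (rule vector_space_free_scl)
  show ?thesis by (simp add: coset_def F.span_zero)
qed

lemma supported_iff: "supported x \<longleftrightarrow> (\<forall>p. (\<nexists>i j. fst p \<in> cmp \<Omega> i \<and> snd p \<in> cmp E j) \<longrightarrow> Poly_Mapping.lookup x p = 0)"
  unfolding supported_def by (fastforce simp: in_keys_iff)

lemma supported_gen: "w \<in> cmp \<Omega> i \<Longrightarrow> e \<in> cmp E j \<Longrightarrow> supported (gen w e)"
  by (auto simp: supported_def gen_def)

lemma supported_closed:
  "supported 0"
  "supported x \<Longrightarrow> supported y \<Longrightarrow> supported (x + y)"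
  "supported x \<Longrightarrow> supported y \<Longrightarrow> supported (x - y)"
  "supported x \<Longrightarrow> supported (free_scl c x)"
  "supported x \<Longrightarrow> supported (sg n x)"
  by (auto simp: supported_iff lookup_add lookup_minus sg_def)

text \<open>\<open>tensor_act\<close> ranges over all representatives of a class; this keeps them
  within reach of the module laws.\<close>

lemma supported_span:
  assumes "r \<in> module.span free_scl (tensor_relators A \<Omega> E)"
  shows "supported r"
proof -
  interpret F: vector_space "free_scl :: 'k \<Rightarrow> ('w \<times> 'e \<Rightarrow>\<^sub>0 'k) \<Rightarrow> _"
    by (rule vector_space_free_scl)
  from assms show ?thesis
  proof (rule F.span_induct)
    show "F.subspace {x. supported x}"
      by (rule F.subspaceI) (simp_all add: supported_closed)
    show "supported x" if "x \<in> tensor_relators A \<Omega> E" for x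
      using that
    proof (cases rule: tensor_relator_cases)
      case 1
      then show ?thesis
        using additive_subgroupD(2) [OF cmp_subgroup(2)] by (auto intro!: supported_closed supported_gen)
    next
      case 2
      then show ?thesis
        using additive_subgroupD(2) [OF cmp_subgroup(3)] by (auto intro!: supported_closed supported_gen)
    next
      case 3
      then show ?thesis
        using graded_space_scl_in [OF graded_moduleD(1) [OF mod_\<Omega>]] by (auto intro!: supported_closed supported_gen)
    next
      case 4
      then show ?thesis
        using graded_moduleD(2) [OF mod_\<Omega> 4(2,3)] graded_moduleD(2) [OF mod_E 4(2,4)]
        by (auto intro!: supported_closed supported_gen)
    qed
  qed
qed

lemma supported_coset: "supported x \<Longrightarrow> y \<in> coset A \<Omega> E x \<Longrightarrow> supported y"
  using supported_closed(2) [OF supported_span [of "y - x"], of x] by (simp add: coset_def)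

lemma pairing_add_left:
  assumes b: "b \<in> cmp (dual A \<Omega>) n" and b': "b' \<in> cmp (dual A \<Omega>) n" and x: "supported x"
  shows "pairing (b + b') x = pairing b x + pairing b' x"
proof -
  have "pairing (b + b') x = lin_ext (scl E) (\<lambda>p. (case p of (w, e) \<Rightarrow> act E (b w) e) + (case p of (w, e) \<Rightarrow> act E (b' w) e)) x"
    unfolding pairing_def
  proof (rule lin_ext_cong, clarify)
    fix w e assume "(w, e) \<in> Poly_Mapping.keys x"
    then obtain i j where w: "w \<in> cmp \<Omega> i" and e: "e \<in> cmp E j"
      by (rule supportedD [OF x])
    show "act E ((b + b') w) e = act E (b w) e + act E (b' w) e"
      using additive_onD(2) [OF graded_moduleD(3) [OF mod_E e] cmp_subgroup(1)
          dual_cmpD(1) [OF b w] dual_cmpD(1) [OF b' w]] by simp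
  qed
  then show ?thesis
    by (simp add: lin_ext_pointwise [OF vs_E] pairing_def)
qed

lemma pairing_tensor_act:
  assumes a: "a \<in> cmp A p" and b: "b \<in> cmp (dual A \<Omega>) n" and x: "supported x"
  shows "pairing b (lin_ext free_scl (\<lambda>(w, e). gen (act \<Omega> a w) e) x)
    = sg (p * n) (pairing (act (dual A \<Omega>) a b) x)"
proof -
  have "pairing b (lin_ext free_scl (\<lambda>(w, e). gen (act \<Omega> a w) e) x)
      = lin_ext (scl E) (\<lambda>q. sg (p * n) (case q of (w, e) \<Rightarrow> act E (a * b w) e)) x"
    unfolding pairing_def lin_ext_lin_ext [OF vs_E]
  proof (rule lin_ext_cong, clarify)
    fix w e assume "(w, e) \<in> Poly_Mapping.keys x"
    then obtain i j where w: "w \<in> cmp \<Omega> i" and e: "e \<in> cmp E j"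
      by (rule supportedD [OF x])
    have "act E (b (act \<Omega> a w)) e = sg (p * n) (act E (a * b w) e)"
      using additive_onD(5) [OF graded_moduleD(3) [OF mod_E e] cmp_subgroup(1)
          cdgaD(3) [OF cdga a dual_cmpD(1) [OF b w]]] dual_cmpD(4) [OF b a w] by simp
    then show "lin_ext (scl E) (\<lambda>(w, e). act E (b w) e) (gen (act \<Omega> a w) e) = sg (p * n) (act E (a * b w) e)"
      by (simp add: lin_ext_gen [OF vs_E])
  qed
  then show ?thesis
    by (simp add: lin_ext_pointwise [OF vs_E] pairing_def)
qed

definition tensor_homogeneous :: "int \<Rightarrow> ('w \<times> 'e \<Rightarrow>\<^sub>0 'k) \<Rightarrow> bool" where
  "tensor_homogeneous m x \<longleftrightarrow>
     (\<forall>(w, e)\<in>Poly_Mapping.keys x. \<exists>i j. w \<in> cmp \<Omega> i \<and> e \<in> cmp E j \<and> i + j = m)"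

lemma tensor_homogeneous_supported: "tensor_homogeneous m x \<Longrightarrow> supported x"
  unfolding tensor_homogeneous_def supported_def by blast

lemma pairing_summand_in:
  assumes b: "b \<in> cmp (dual A \<Omega>) n" and x: "tensor_homogeneous m x" and q: "(w, e) \<in> Poly_Mapping.keys x"
  shows "act E (b w) e \<in> cmp E (m + n)"
proof -
  obtain i j where w: "w \<in> cmp \<Omega> i" and e: "e \<in> cmp E j" and ij: "i + j = m"
    using x q unfolding tensor_homogeneous_def by blast
  have "act E (b w) e \<in> cmp E (i + n + j)"
    by (rule graded_moduleD(2) [OF mod_E dual_cmpD(1) [OF b w] e])
  moreover have "i + n + j = m + n"
    using ij by simp
  ultimately show ?thesis
    by simp
qed

lemma sum_in_cmp_E: "(\<And>q. q \<in> K \<Longrightarrow> f q \<in> cmp E m) \<Longrightarrow> (\<Sum>q\<in>K. f q) \<in> cmp E m"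
  by (induction K rule: infinite_finite_induct) (auto intro: additive_subgroupD [OF cmp_subgroup(3)])

lemma pairing_in:
  assumes b: "b \<in> cmp (dual A \<Omega>) n" and x: "tensor_homogeneous m x"
  shows "pairing b x \<in> cmp E (m + n)"
  unfolding pairing_def lin_ext_def
  by (rule sum_in_cmp_E)
    (use pairing_summand_in [OF b x] graded_space_scl_in [OF graded_moduleD(1) [OF mod_E]] in auto)

text \<open>\<open>act E a\<close> is additive only within one component, so all summands must lie
  in degree \<open>m + n\<close>; \<open>supported\<close> alone would not ensure this.\<close>

lemma pairing_act_left:
  assumes a: "a \<in> cmp A p" and b: "b \<in> cmp (dual A \<Omega>) n" and x: "tensor_homogeneous m x"
  shows "pairing (act (dual A \<Omega>) a b) x = act E a (pairing b x)"
proof -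
  note act_a = additive_onD [OF graded_moduleD(4) [OF mod_E a] cmp_subgroup(3) [of "m + n"]]
  note scl_in = graded_space_scl_in [OF graded_moduleD(1) [OF mod_E]]
  have "act E a (\<Sum>q\<in>K. f q) = (\<Sum>q\<in>K. act E a (f q))" if "\<And>q. q \<in> K \<Longrightarrow> f q \<in> cmp E (m + n)"
    for K :: "('w \<times> 'e) set" and f
    using that by (induction K rule: infinite_finite_induct) (auto simp: act_a sum_in_cmp_E)
  then have "act E a (pairing b x)
      = (\<Sum>q\<in>Poly_Mapping.keys x. act E a (scl E (Poly_Mapping.lookup x q) (case q of (w, e) \<Rightarrow> act E (b w) e)))"
    unfolding pairing_def lin_ext_def using pairing_summand_in [OF b x] scl_in by force
  also have "\<dots> = (\<Sum>q\<in>Poly_Mapping.keys x. scl E (Poly_Mapping.lookup x q) (case q of (w, e) \<Rightarrow> act E (a * b w) e))"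
  proof (rule sum.cong [OF refl], clarify)
    fix w e assume q: "(w, e) \<in> Poly_Mapping.keys x"
    then obtain i j where w: "w \<in> cmp \<Omega> i" and e: "e \<in> cmp E j"
      by (rule supportedD [OF tensor_homogeneous_supported [OF x]])
    show "act E a (scl E (Poly_Mapping.lookup x (w, e)) (act E (b w) e))
        = scl E (Poly_Mapping.lookup x (w, e)) (act E (a * b w) e)"
      using graded_moduleD(6) [OF mod_E a pairing_summand_in [OF b x q]]
        graded_moduleD(7) [OF mod_E a dual_cmpD(1) [OF b w] e] by simp
  qed
  finally show ?thesis
    by (simp add: pairing_def lin_ext_def)
qed

end

section \<open>Covariant derivatives along functionals\<close>

locale connection_on = tensor_pairing A dA \<Omega> E
  for A :: "('k::field_char_0, 'a::{ring,monoid_mult}) graded_space"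
    and dA :: "'a \<Rightarrow> 'a"
    and \<Omega> :: "('k, 'a, 'w::ab_group_add) graded_mod"
    and E :: "('k, 'a, 'e::ab_group_add) graded_mod" +
  fixes \<delta> :: "'a \<Rightarrow> 'w" and nabla :: "'e \<Rightarrow> ('w \<times> 'e \<Rightarrow>\<^sub>0 'k) set"
  assumes connection: "connection A \<Omega> \<delta> E nabla"
    and delta_in: "a \<in> cmp A i \<Longrightarrow> \<delta> a \<in> cmp \<Omega> i"
begin

lemma nabla_representative:
  assumes "e \<in> cmp E m"
  obtains x where "nabla e = coset A \<Omega> E x" "tensor_homogeneous m x"
proof -
  have "nabla e \<in> tensor_cmp A \<Omega> E m"
    using connection assms unfolding connection_def by blast
  then show ?thesis
    using that unfolding tensor_cmp_def tensor_homogeneous_def by blast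
qed

lemma cov_eq_pairing:
  assumes b: "b \<in> cmp (dual A \<Omega>) n" and e: "nabla e = coset A \<Omega> E x"
  shows "cov E nabla b e = pairing b x"
  unfolding cov_def e
proof (rule contraction_eqI)
  show "coset A \<Omega> E x \<noteq> {}"
    using coset_self by blast
  show "lin_ext (scl E) (\<lambda>(w, e). act E (b w) e) y = pairing b x" if "y \<in> coset A \<Omega> E x" for y
    using pairing_coset [OF b that] by (simp add: pairing_def)
qed

lemma cov_in:
  assumes "b \<in> cmp (dual A \<Omega>) n" "e \<in> cmp E m"
  shows "cov E nabla b e \<in> cmp E (m + n)"
  by (rule nabla_representative [OF assms(2)]) (simp add: cov_eq_pairing [OF assms(1)] pairing_in [OF assms(1)])

lemma cov_additive_left:
  assumes e: "e \<in> cmp E m" and sub: "additive_subgroup (cmp (dual A \<Omega>) n)"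
  shows "additive_on (cmp (dual A \<Omega>) n) (\<lambda>b. cov E nabla b e)"
  unfolding additive_on_def
proof (intro ballI)
  fix b b' assume b: "b \<in> cmp (dual A \<Omega>) n" and b': "b' \<in> cmp (dual A \<Omega>) n"
  obtain x where x: "nabla e = coset A \<Omega> E x" "tensor_homogeneous m x"
    by (rule nabla_representative [OF e])
  show "cov E nabla (b + b') e = cov E nabla b e + cov E nabla b' e"
    using cov_eq_pairing [OF b x(1)] cov_eq_pairing [OF b' x(1)]
      cov_eq_pairing [OF additive_subgroupD(2) [OF sub b b'] x(1)]
      pairing_add_left [OF b b' tensor_homogeneous_supported [OF x(2)]] by simp
qed

text \<open>Additivity and the Leibniz rule of a connection are both stated with sums of classes;
  this evaluates either.\<close>

lemma contraction_tensor_add: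
  assumes b: "b \<in> cmp (dual A \<Omega>) n" and X: "X \<noteq> {}" "\<And>x. x \<in> X \<Longrightarrow> pairing b x = u"
    and Y: "Y \<noteq> {}" "\<And>y. y \<in> Y \<Longrightarrow> pairing b y = v"
  shows "contraction E b (tensor_add A \<Omega> E X Y) = u + v"
proof (rule contraction_eqI)
  show "tensor_add A \<Omega> E X Y \<noteq> {}"
    using X(1) Y(1) coset_self unfolding tensor_add_def by blast
  fix z assume "z \<in> tensor_add A \<Omega> E X Y"
  then obtain x y where "x \<in> X" "y \<in> Y" "z \<in> coset A \<Omega> E (x + y)"
    unfolding tensor_add_def by blast
  then have "pairing b z = u + v"
    using pairing_coset [OF b, of z "x + y"] X(2) [of x] Y(2) [of y] by (simp add: pairing_def lin_ext_add [OF vs_E])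
  then show "lin_ext (scl E) (\<lambda>(w, e). act E (b w) e) z = u + v"
    by (simp add: pairing_def)
qed

lemma cov_additive_right:
  assumes b: "b \<in> cmp (dual A \<Omega>) n"
  shows "additive_on (cmp E m) (cov E nabla b)"
  unfolding additive_on_def
proof (intro ballI)
  fix e e' assume e: "e \<in> cmp E m" and e': "e' \<in> cmp E m"
  obtain x where x: "nabla e = coset A \<Omega> E x"
    by (rule nabla_representative [OF e])
  obtain x' where x': "nabla e' = coset A \<Omega> E x'"
    by (rule nabla_representative [OF e'])
  have nabla_add: "nabla (e + e') = tensor_add A \<Omega> E (nabla e) (nabla e')"
    using connection e e' unfolding connection_def by blast
  have "cov E nabla b (e + e') = pairing b x + pairing b x'"
    unfolding cov_def nabla_add x x'
    by (rule contraction_tensor_add [OF b _ pairing_coset [OF b] _ pairing_coset [OF b]]) (use coset_self in blast)+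
  then show "cov E nabla b (e + e') = cov E nabla b e + cov E nabla b e'"
    using cov_eq_pairing [OF b x] cov_eq_pairing [OF b x'] by simp
qed

lemma cov_act_left:
  assumes a: "a \<in> cmp A p" and b: "b \<in> cmp (dual A \<Omega>) n" and e: "e \<in> cmp E m"
    and ab: "act (dual A \<Omega>) a b \<in> cmp (dual A \<Omega>) (p + n)"
  shows "cov E nabla (act (dual A \<Omega>) a b) e = act E a (cov E nabla b e)"
proof -
  obtain x where x: "nabla e = coset A \<Omega> E x" "tensor_homogeneous m x"
    by (rule nabla_representative [OF e])
  show ?thesis
    using cov_eq_pairing [OF b x(1)] cov_eq_pairing [OF ab x(1)] pairing_act_left [OF a b x(2)] by simp
qed

lemma cov_act_right:
  assumes a: "a \<in> cmp A p" and b: "b \<in> cmp (dual A \<Omega>) n" and e: "e \<in> cmp E m"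
    and ab: "act (dual A \<Omega>) a b \<in> cmp (dual A \<Omega>) (p + n)"
  shows "cov E nabla b (act E a e) = act E (b (\<delta> a)) e + sg (n * p) (act E a (cov E nabla b e))"
proof -
  obtain x where x: "nabla e = coset A \<Omega> E x" "tensor_homogeneous m x"
    by (rule nabla_representative [OF e])
  have "nabla (act E a e) = tensor_add A \<Omega> E (coset A \<Omega> E (gen (\<delta> a) e)) (tensor_act A \<Omega> E a (nabla e))"
    using connection a e unfolding connection_def by blast
  moreover have "contraction E b (tensor_add A \<Omega> E (coset A \<Omega> E (gen (\<delta> a) e)) (tensor_act A \<Omega> E a (nabla e)))
      = act E (b (\<delta> a)) e + sg (p * n) (pairing (act (dual A \<Omega>) a b) x)"
  proof (rule contraction_tensor_add [OF b])
    show "coset A \<Omega> E (gen (\<delta> a) e) \<noteq> {}"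
      using coset_self by blast
    show "pairing b y = act E (b (\<delta> a)) e" if "y \<in> coset A \<Omega> E (gen (\<delta> a) e)" for y
      using pairing_coset [OF b that] by (simp add: pairing_def lin_ext_gen [OF vs_E])
    show "tensor_act A \<Omega> E a (nabla e) \<noteq> {}"
      unfolding tensor_act_def x(1) using coset_self by blast
    show "pairing b y = sg (p * n) (pairing (act (dual A \<Omega>) a b) x)" if y_in: "y \<in> tensor_act A \<Omega> E a (nabla e)" for y
    proof -
      obtain x' where x': "x' \<in> coset A \<Omega> E x"
        and y: "y \<in> coset A \<Omega> E (lin_ext free_scl (\<lambda>(w, e). gen (act \<Omega> a w) e) x')"
        using y_in unfolding tensor_act_def x(1) by blast
      \<comment> \<open>An arbitrary representative \<open>x'\<close> need not have a single total
        degree, so \<open>a\<close> cannot be pulled out of the pairing there. It is absorbed into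
        the functional, the value is carried over to the homogeneous representative
        \<open>x\<close>, and \<open>a\<close> is pulled out there.\<close>
      have "supported x'"
        by (rule supported_coset [OF tensor_homogeneous_supported [OF x(2)] x'])
      then show ?thesis
        using pairing_coset [OF b y] pairing_tensor_act [OF a b, of x'] pairing_coset [OF ab x'] by simp
    qed
  qed
  ultimately show ?thesis
    using cov_eq_pairing [OF b x(1)] pairing_act_left [OF a b x(2)] by (simp add: cov_def mult.commute)
qed

end

section \<open>The dual module\<close>

lemma scl_sg: "vector_space s \<Longrightarrow> s c (sg n x) = sg n (s c x)"
proof -
  assume "vector_space s"
  then interpret vector_space s .
  show ?thesis by (simp add: sg_def)
qed

lemma mult_sg: "a * sg n x = sg n (a * x)" "sg n x * a = sg n (x * a)" for a x :: "'a::ring"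
  by (simp_all add: sg_def)

locale atiyah_connection =
  fixes A :: "('k::field_char_0, 'a::{ring,monoid_mult}) graded_space"
    and dA :: "'a \<Rightarrow> 'a"
    and \<Omega> :: "('k, 'a, 'w::ab_group_add) graded_mod"
    and d\<Omega> :: "'w \<Rightarrow> 'w"
    and \<delta> :: "'a \<Rightarrow> 'w"
    and nabla :: "('w \<Rightarrow> 'a) \<Rightarrow> ('w \<times> ('w \<Rightarrow> 'a) \<Rightarrow>\<^sub>0 'k) set"
  assumes cdga: "cdga A dA"
    and dg_mod: "dg_module A dA \<Omega> d\<Omega>"
    and dg_der: "dg_derivation A dA \<Omega> d\<Omega> \<delta>"
    and conn: "connection A \<Omega> \<delta> (dual A \<Omega>) nabla"
begin

abbreviation B where "B \<equiv> dual A \<Omega>"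
abbreviation dB where "dB \<equiv> dual_diff A dA \<Omega> d\<Omega>"

lemmas A = cdgaD [OF cdga]
lemmas dA = graded_linearD [OF A(7)]
lemmas \<Omega> = graded_moduleD [OF dg_moduleD(1) [OF dg_mod]]
lemmas d\<Omega> = graded_linearD [OF dg_moduleD(2) [OF dg_mod]]
lemmas A_sub = graded_space_additive_subgroup [OF A(1)]
lemmas A_closed = additive_subgroupD [OF A_sub]
lemmas \<Omega>_sub = graded_space_additive_subgroup [OF \<Omega>(1)]

lemma vs_A: "vector_space (scl A)"
  using A(1) by (simp add: graded_space_def)

lemma homogeneousI: "w \<in> cmp \<Omega> i \<Longrightarrow> w \<in> homogeneous \<Omega>"
  by (auto simp: homogeneous_def)

lemma vs_B: "vector_space (scl B)"
proof -
  interpret vector_space "scl A" by (rule vs_A)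
  show ?thesis
    by unfold_locales (simp_all add: fun_eq_iff scale_right_distrib scale_left_distrib)
qed

lemma dual_add_in:
  assumes f: "f \<in> cmp B n" and g: "g \<in> cmp B n"
  shows "f + g \<in> cmp B n"
proof (rule dual_cmpI)
  show "(f + g) w \<in> cmp A (i + n)" if "w \<in> cmp \<Omega> i" for w i
    using dual_cmpD(1) [OF f that] dual_cmpD(1) [OF g that] A_closed by simp
  show "additive_on (cmp \<Omega> i) (f + g)" for i
    using dual_cmpD(2) [OF f] dual_cmpD(2) [OF g] unfolding additive_on_def by (simp add: add_ac)
  show "(f + g) (scl \<Omega> c w) = scl A c ((f + g) w)" if "w \<in> cmp \<Omega> i" for w i c
    using dual_cmpD(3) [OF f that] dual_cmpD(3) [OF g that] vector_space.vector_space_assms(1) [OF vs_A]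
    by simp
  show "(f + g) (act \<Omega> a w) = sg (p * n) (a * (f + g) w)" if "a \<in> cmp A p" "w \<in> cmp \<Omega> i" for a p w i
    using dual_cmpD(4) [OF f that] dual_cmpD(4) [OF g that] by (simp add: distrib_left sg_add)
  show "(f + g) w = 0" if "w \<notin> homogeneous \<Omega>" for w
    using dual_cmpD(5) [OF f that] dual_cmpD(5) [OF g that] by simp
qed

lemma dual_scl_in:
  assumes f: "f \<in> cmp B n"
  shows "scl B c f \<in> cmp B n"
proof -
  interpret vector_space "scl A" by (rule vs_A)
  show ?thesis
  proof (rule dual_cmpI)
    show "scl B c f w \<in> cmp A (i + n)" if "w \<in> cmp \<Omega> i" for w i
      using dual_cmpD(1) [OF f that] graded_space_scl_in [OF A(1)] by simp
    show "additive_on (cmp \<Omega> i) (scl B c f)" for i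
      using dual_cmpD(2) [OF f] unfolding additive_on_def by (simp add: scale_right_distrib)
    show "scl B c f (scl \<Omega> c' w) = scl A c' (scl B c f w)" if "w \<in> cmp \<Omega> i" for w i c'
      using dual_cmpD(3) [OF f that] by (simp add: mult.commute)
    show "scl B c f (act \<Omega> a w) = sg (p * n) (a * scl B c f w)" if "a \<in> cmp A p" "w \<in> cmp \<Omega> i" for a p w i
      using dual_cmpD(4) [OF f that] A(6) [OF that(1) dual_cmpD(1) [OF f that(2)]]
      by (simp add: scl_sg [OF vs_A])
    show "scl B c f w = 0" if "w \<notin> homogeneous \<Omega>" for w
      using dual_cmpD(5) [OF f that] by simp
  qed
qed

lemma dual_zero_in: "0 \<in> cmp B n"
proof -
  interpret vector_space "scl A" by (rule vs_A)
  show ?thesis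
    by (rule dual_cmpI) (use A_closed(1) in \<open>auto simp: additive_on_def\<close>)
qed

lemma graded_space_dual: "graded_space B"
proof -
  interpret B: vector_space "scl B" by (rule vs_B)
  have "B.subspace (cmp B n)" for n
    by (rule B.subspaceI) (use dual_zero_in dual_add_in dual_scl_in in auto)
  moreover have "x n = 0" if "finite N" and x: "\<forall>n\<in>N. x n \<in> cmp B n" and sum: "(\<Sum>n\<in>N. x n) = 0" and n: "n \<in> N"
    for N and x :: "int \<Rightarrow> 'w \<Rightarrow> 'a" and n
  proof
    fix w
    show "x n w = 0 w"
    proof (cases "w \<in> homogeneous \<Omega>")
      case True
      then obtain i where w: "w \<in> cmp \<Omega> i"
        by (auto simp: homogeneous_def)
      have "(\<Sum>n\<in>N. x n w) = (\<Sum>n\<in>N. x n) w"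
        using \<open>finite N\<close> by (induction N) auto
      \<comment> \<open>Evaluation at \<open>w\<close> of degree \<open>i\<close> shifts degree
        \<open>n\<close> to \<open>i + n\<close>; reindexing turns the relation into one between
        components of the algebra.\<close>
      then have "(\<Sum>m\<in>(+) i ` N. x (m - i) w) = 0"
        using sum by (simp add: sum.reindex)
      moreover have "\<forall>m\<in>(+) i ` N. x (m - i) w \<in> cmp A m"
        using x dual_cmpD(1) [OF _ w] by auto
      ultimately have "\<forall>m\<in>(+) i ` N. x (m - i) w = 0"
        using graded_space_independent [OF A(1), THEN spec, THEN spec, of "(+) i ` N" "\<lambda>m. x (m - i) w"] \<open>finite N\<close>
        by blast
      then show ?thesis
        using n by simp
    next
      case False
      then show ?thesis
        using dual_cmpD(5) [OF bspec [OF x n]] by simp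
    qed
  qed
  ultimately show ?thesis
    unfolding graded_space_def using vs_B by blast
qed

lemmas B_sub = graded_space_additive_subgroup [OF graded_space_dual]

lemma dual_act_in:
  assumes a: "a \<in> cmp A i" and f: "f \<in> cmp B n"
  shows "act B a f \<in> cmp B (i + n)"
proof (rule dual_cmpI)
  show "act B a f w \<in> cmp A (k + (i + n))" if "w \<in> cmp \<Omega> k" for w k
    using A(3) [OF a dual_cmpD(1) [OF f that]] by (simp add: ac_simps)
  show "additive_on (cmp \<Omega> k) (act B a f)" for k
    using dual_cmpD(2) [OF f] unfolding additive_on_def by (simp add: distrib_left)
  show "act B a f (scl \<Omega> c w) = scl A c (act B a f w)" if "w \<in> cmp \<Omega> k" for w k c
    using dual_cmpD(3) [OF f that] A(6) [OF a dual_cmpD(1) [OF f that]] by simp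
  show "act B a f (act \<Omega> b w) = sg (p * (i + n)) (b * act B a f w)" if b: "b \<in> cmp A p" and "w \<in> cmp \<Omega> k" for b p w k
  proof -
    \<comment> \<open>Exchanging the two scalars contributes \<open>i * p\<close>, which together
      with \<open>p * n\<close> gives the sign for a map of degree \<open>i + n\<close>.\<close>
    have "a * (b * f w) = sg (i * p) (b * (a * f w))"
      using A(4) [OF a b] by (metis mult.assoc mult_sg(2))
    then show ?thesis
      using dual_cmpD(4) [OF f that] by (simp add: mult_sg algebra_simps)
  qed
  show "act B a f w = 0" if "w \<notin> homogeneous \<Omega>" for w
    using dual_cmpD(5) [OF f that] by simp
qed

lemma graded_module_dual: "graded_module A B"
proof -
  have scl_act: "act B (scl A c a) f = scl B c (act B a f) \<and> act B a (scl B c f) = scl B c (act B a f)"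
    if a: "a \<in> cmp A i" and f: "f \<in> cmp B n" for a i f n c
  proof -
    interpret vector_space "scl A" by (rule vs_A)
    have "scl A c a * f w = scl A c (a * f w) \<and> a * scl A c (f w) = scl A c (a * f w)" for w
    proof (cases "w \<in> homogeneous \<Omega>")
      case True
      then obtain k where w: "w \<in> cmp \<Omega> k"
        by (auto simp: homogeneous_def)
      show ?thesis
        using A(5,6) [OF a dual_cmpD(1) [OF f w]] by simp
    next
      case False
      then show ?thesis
        using dual_cmpD(5) [OF f] by simp
    qed
    then show ?thesis
      by (simp add: fun_eq_iff)
  qed
  show ?thesis
    unfolding graded_module_def
  proof (intro conjI allI ballI)
    show "graded_space B"
      by (rule graded_space_dual)
    show "act B a f \<in> cmp B (i + j)" if "a \<in> cmp A i" "f \<in> cmp B j" for a f i j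
      by (rule dual_act_in [OF that])
    show "act B (scl A c a) f = scl B c (act B a f)" "act B a (scl B c f) = scl B c (act B a f)"
      if "a \<in> cmp A i" "f \<in> cmp B j" for a f i j c
      using scl_act [OF that] by blast+
  qed (simp_all add: fun_eq_iff distrib_right distrib_left mult.assoc)
qed

section \<open>The dual differential\<close>

lemma dual_diff_eq:
  assumes f: "f \<in> cmp B n"
  shows "dB f = (\<lambda>w. if w \<in> homogeneous \<Omega> then dA (f w) - sg n (f (d\<Omega> w)) else 0)"
\<comment> \<open>\<open>deg\<close> is arbitrary at zero, where both sides vanish whatever the
  sign.\<close>
proof (cases "f = 0")
  case True
  then show ?thesis by (simp add: dual_diff_def fun_eq_iff)
next
  case False
  then show ?thesis
    by (simp only: dual_diff_def deg_eq [OF graded_space_dual f False])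
qed

lemma dual_diff_apply:
  assumes "f \<in> cmp B n" "w \<in> cmp \<Omega> i"
  shows "dB f w = dA (f w) - sg n (f (d\<Omega> w))"
  using dual_diff_eq [OF assms(1)] homogeneousI [OF assms(2)] by simp

lemma dual_diff_nonhomogeneous: "w \<notin> homogeneous \<Omega> \<Longrightarrow> dB f w = 0"
  by (simp add: dual_diff_def)

lemma dA_add: "x \<in> cmp A n \<Longrightarrow> y \<in> cmp A n \<Longrightarrow> dA (x + y) = dA x + dA y"
  using dA(2) unfolding additive_on_def by blast

lemma dA_diff: "x \<in> cmp A n \<Longrightarrow> y \<in> cmp A n \<Longrightarrow> dA (x - y) = dA x - dA y"
  using additive_onD(4) [OF dA(2) A_sub] by blast

lemma dA_sg: "x \<in> cmp A n \<Longrightarrow> dA (sg m x) = sg m (dA x)"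
  using additive_onD(5) [OF dA(2) A_sub] by blast

lemma dual_diff_in:
  assumes f: "f \<in> cmp B n"
  shows "dB f \<in> cmp B (n + 1)"
proof (rule dual_cmpI)
  note f_in = dual_cmpD(1) [OF f]
  note df = dual_diff_apply [OF f]
  have d_in: "dA (f w) \<in> cmp A (i + n + 1)" "f (d\<Omega> w) \<in> cmp A (i + n + 1)" if "w \<in> cmp \<Omega> i" for w i
    using dA(1) [OF f_in [OF that]] f_in [OF d\<Omega>(1) [OF that]] by (simp_all add: ac_simps)
  show "dB f w \<in> cmp A (i + (n + 1))" if "w \<in> cmp \<Omega> i" for w i
    using d_in [OF that] A_closed by (simp add: df [OF that] ac_simps)
  show "additive_on (cmp \<Omega> i) (dB f)" for i
    unfolding additive_on_def
  proof (intro ballI)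
    fix v w assume v: "v \<in> cmp \<Omega> i" and w: "w \<in> cmp \<Omega> i"
    have vw: "v + w \<in> cmp \<Omega> i"
      by (rule additive_subgroupD(2) [OF \<Omega>_sub v w])
    have "f (v + w) = f v + f w"
      by (rule additive_onD(2) [OF dual_cmpD(2) [OF f] \<Omega>_sub v w])
    moreover have "d\<Omega> (v + w) = d\<Omega> v + d\<Omega> w"
      by (rule additive_onD(2) [OF d\<Omega>(2) \<Omega>_sub v w])
    moreover have "f (d\<Omega> v + d\<Omega> w) = f (d\<Omega> v) + f (d\<Omega> w)"
      by (rule additive_onD(2) [OF dual_cmpD(2) [OF f] \<Omega>_sub d\<Omega>(1) [OF v] d\<Omega>(1) [OF w]])
    ultimately show "dB f (v + w) = dB f v + dB f w"
      using dA_add [OF f_in [OF v] f_in [OF w]] by (simp add: df [OF v] df [OF w] df [OF vw] sg_add)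
  qed
  show "dB f (scl \<Omega> c w) = scl A c (dB f w)" if w: "w \<in> cmp \<Omega> i" for w i c
  proof -
    interpret vector_space "scl A" by (rule vs_A)
    have cw: "scl \<Omega> c w \<in> cmp \<Omega> i"
      by (rule graded_space_scl_in [OF \<Omega>(1) w])
    show ?thesis
      using dA(3) [OF f_in [OF w]] d\<Omega>(3) [OF w] dual_cmpD(3) [OF f w] dual_cmpD(3) [OF f d\<Omega>(1) [OF w]]
      by (simp add: df [OF w] df [OF cw] scale_right_diff_distrib scl_sg [OF vs_A])
  qed
  show "dB f (act \<Omega> a w) = sg (p * (n + 1)) (a * dB f w)" if a: "a \<in> cmp A p" and w: "w \<in> cmp \<Omega> i" for a p w i
  proof -
    have aw: "act \<Omega> a w \<in> cmp \<Omega> (p + i)"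
      by (rule \<Omega>(2) [OF a w])
    have "d\<Omega> (act \<Omega> a w) = act \<Omega> (dA a) w + sg p (act \<Omega> a (d\<Omega> w))"
      by (rule dg_moduleD(4) [OF dg_mod a w])
    moreover have in1: "act \<Omega> (dA a) w \<in> cmp \<Omega> (p + i + 1)"
      using \<Omega>(2) [OF dA(1) [OF a] w] by (simp add: ac_simps)
    moreover have in2: "act \<Omega> a (d\<Omega> w) \<in> cmp \<Omega> (p + i + 1)"
      using \<Omega>(2) [OF a d\<Omega>(1) [OF w]] by (simp add: ac_simps)
    ultimately have "f (d\<Omega> (act \<Omega> a w)) = f (act \<Omega> (dA a) w) + sg p (f (act \<Omega> a (d\<Omega> w)))"
      using additive_onD [OF dual_cmpD(2) [OF f] \<Omega>_sub] additive_subgroupD [OF \<Omega>_sub] by simp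
    then have 1: "f (d\<Omega> (act \<Omega> a w)) = sg ((p + 1) * n) (dA a * f w) + sg (p + p * n) (a * f (d\<Omega> w))"
      using dual_cmpD(4) [OF f dA(1) [OF a] w] dual_cmpD(4) [OF f a d\<Omega>(1) [OF w]] by simp
    have "dA (f (act \<Omega> a w)) = sg (p * n) (dA (a * f w))"
      using dual_cmpD(4) [OF f a w] dA_sg [OF A(3) [OF a f_in [OF w]]] by simp
    then have 2: "dA (f (act \<Omega> a w)) = sg (p * n) (dA a * f w + sg p (a * dA (f w)))"
      using A(9) [OF a f_in [OF w]] by simp
    \<comment> \<open>The terms with \<open>dA a * f w\<close> cancel; the rest is
      \<open>a * dB f w\<close> with the sign for degree \<open>n + 1\<close>.\<close>
    show ?thesis
      unfolding df [OF aw] df [OF w] 1 2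
      by (cases "even p"; cases "even n") (simp_all add: sg_def algebra_simps)
  qed
  show "dB f w = 0" if "w \<notin> homogeneous \<Omega>" for w
    by (rule dual_diff_nonhomogeneous [OF that])
qed

lemma dual_eqI: "(\<And>w i. w \<in> cmp \<Omega> i \<Longrightarrow> f w = g w) \<Longrightarrow> (\<And>w. w \<notin> homogeneous \<Omega> \<Longrightarrow> f w = g w) \<Longrightarrow> f = g"
  unfolding homogeneous_def by (rule ext) blast

lemma graded_linear_dual_diff: "graded_linear B B 1 dB"
proof -
  interpret vector_space "scl A" by (rule vs_A)
  have "dB (f + g) = dB f + dB g" if f: "f \<in> cmp B n" and g: "g \<in> cmp B n" for f g n
  proof (rule dual_eqI)
    fix w i assume w: "w \<in> cmp \<Omega> i"
    show "dB (f + g) w = (dB f + dB g) w"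
      using dA_add [OF dual_cmpD(1) [OF f w] dual_cmpD(1) [OF g w]]
      by (simp add: dual_diff_apply [OF dual_add_in [OF f g] w] dual_diff_apply [OF f w] dual_diff_apply [OF g w] sg_add)
  qed (simp add: dual_diff_nonhomogeneous)
  moreover have "dB (scl B c f) = scl B c (dB f)" if f: "f \<in> cmp B n" for f n c
  proof (rule dual_eqI)
    fix w i assume w: "w \<in> cmp \<Omega> i"
    show "dB (scl B c f) w = scl B c (dB f) w"
      using dA(3) [OF dual_cmpD(1) [OF f w]]
      by (simp add: dual_diff_apply [OF dual_scl_in [OF f] w, simplified] dual_diff_apply [OF f w]
          scale_right_diff_distrib scl_sg [OF vs_A])
  qed (simp add: dual_diff_nonhomogeneous)
  ultimately show ?thesis
    using dual_diff_in unfolding graded_linear_def by blast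
qed

lemma dual_diff_dual_diff:
  assumes f: "f \<in> cmp B n"
  shows "dB (dB f) = 0"
proof (rule dual_eqI)
  fix w i assume w: "w \<in> cmp \<Omega> i"
  note f_in = dual_cmpD(1) [OF f]
  have in1: "dA (f w) \<in> cmp A (i + n + 1)" and in2: "f (d\<Omega> w) \<in> cmp A (i + n + 1)"
    using dA(1) [OF f_in [OF w]] f_in [OF d\<Omega>(1) [OF w]] by (simp_all add: ac_simps)
  have "f 0 = 0"
    by (rule additive_onD(1) [OF dual_cmpD(2) [OF f] \<Omega>_sub])
  then have "dB f (d\<Omega> w) = dA (f (d\<Omega> w))"
    using dual_diff_apply [OF f d\<Omega>(1) [OF w]] dg_moduleD(3) [OF dg_mod w] by simp
  moreover have "dA (dB f w) = - sg n (dA (f (d\<Omega> w)))"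
    using dA_diff [OF in1 A_closed(5) [OF in2]] dA_sg [OF in2] A(8) [OF f_in [OF w]]
    by (simp add: dual_diff_apply [OF f w])
  \<comment> \<open>The mixed terms carry the signs of \<open>n\<close> and \<open>n + 1\<close> and
    cancel.\<close>
  ultimately show "dB (dB f) w = 0 w"
    by (simp add: dual_diff_apply [OF dual_diff_in [OF f] w]) (simp add: sg_def)
qed (simp add: dual_diff_nonhomogeneous)

lemma dual_diff_act:
  assumes a: "a \<in> cmp A p" and f: "f \<in> cmp B n"
  shows "dB (act B a f) = act B (dA a) f + sg p (act B a (dB f))"
proof (rule dual_eqI)
  fix w i assume w: "w \<in> cmp \<Omega> i"
  show "dB (act B a f) w = (act B (dA a) f + sg p (act B a (dB f))) w"
    using A(9) [OF a dual_cmpD(1) [OF f w]]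
    by (cases "even p") (simp_all add: dual_diff_apply [OF dual_act_in [OF a f] w, simplified]
        dual_diff_apply [OF f w] sg_def algebra_simps)
next
  fix w assume "w \<notin> homogeneous \<Omega>"
  then show "dB (act B a f) w = (act B (dA a) f + sg p (act B a (dB f))) w"
    using dual_cmpD(5) [OF f] by (simp add: dual_diff_nonhomogeneous sg_def)
qed

lemma dg_module_dual: "dg_module A dA B dB"
  unfolding dg_module_def
  using graded_module_dual graded_linear_dual_diff dual_diff_dual_diff dual_diff_act by blast

section \<open>The dual module as an instance of the abstract setting\<close>

sublocale connection_on A dA \<Omega> B \<delta> nabla
  using cdga dg_moduleD(1) [OF dg_mod] graded_module_dual conn dg_derivationD(1) [OF dg_der]
  by unfold_locales

sublocale dg_module_connection "cmp B" dB "cov B nabla" "cmp A" dA "act B" "\<lambda>b a. b (\<delta> a)"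
proof
  show "additive_subgroup (cmp B n)" for n
    by (rule B_sub)
  show "dB x \<in> cmp B (n + 1)" if "x \<in> cmp B n" for x n
    by (rule dual_diff_in [OF that])
  show "additive_on (cmp B n) dB" for n
    by (rule graded_linearD(2) [OF graded_linear_dual_diff])
  show "dB (dB x) = 0" if "x \<in> cmp B n" for x n
    by (rule dual_diff_dual_diff [OF that])
  show "cov B nabla x y \<in> cmp B (n + m)" if "x \<in> cmp B m" "y \<in> cmp B n" for x y m n
    by (rule cov_in [OF that])
  show "additive_on (cmp B m) (\<lambda>x. cov B nabla x y)" if "y \<in> cmp B n" for y m n
    by (rule cov_additive_left [OF that B_sub])
  show "additive_on (cmp B n) (cov B nabla x)" if "x \<in> cmp B m" for x m n
    by (rule cov_additive_right [OF that])
  show "act B a x \<in> cmp B (p + n)" if "a \<in> cmp A p" "x \<in> cmp B n" for a x p n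
    by (rule dual_act_in [OF that])
  show "additive_on (cmp B n) (act B a)" if "a \<in> cmp A p" for a p n
    by (rule graded_moduleD(4) [OF graded_module_dual that])
  show "dA a \<in> cmp A (p + 1)" if "a \<in> cmp A p" for a p
    by (rule dA(1) [OF that])
  show "b (\<delta> a) \<in> cmp A (p + m)" if "b \<in> cmp B m" "a \<in> cmp A p" for a b p m
    by (rule dual_cmpD(1) [OF that(1) delta_in [OF that(2)]])
  show "dB (act B a x) = act B (dA a) x + sg p (act B a (dB x))" if "a \<in> cmp A p" "x \<in> cmp B n" for a x p n
    by (rule dual_diff_act [OF that])
  show "cov B nabla (act B a b) x = act B a (cov B nabla b x)"
    if "a \<in> cmp A p" "b \<in> cmp B m" "x \<in> cmp B n" for a b x p m n
    by (rule cov_act_left [OF that dual_act_in [OF that(1,2)]])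
  show "cov B nabla b (act B a x) = act B (b (\<delta> a)) x + sg (m * p) (act B a (cov B nabla b x))"
    if "a \<in> cmp A p" "b \<in> cmp B m" "x \<in> cmp B n" for a b x p m n
    by (rule cov_act_right [OF that dual_act_in [OF that(1,2)]])
  \<comment> \<open>The dual differential of \<open>b\<close> evaluated at
    \<open>\<delta> a\<close>, using
    \<open>\<delta> (dA a) = d\<Omega> (\<delta> a)\<close>.\<close>
  show "act B (dB b (\<delta> a)) x = act B (dA (b (\<delta> a))) x - sg m (act B (b (\<delta> (dA a))) x)"
    if "a \<in> cmp A p" "b \<in> cmp B m" "x \<in> cmp B n" for a b x p m n
    by (simp add: dual_diff_apply [OF that(2) delta_in [OF that(1)]] dg_derivationD(2) [OF dg_der that(1)]
        fun_eq_iff sg_def algebra_simps)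
qed


section \<open>Comparison of the structure maps with the recursion on labelled lists\<close>

abbreviation l where "l \<equiv> atiyah_map A dA \<Omega> d\<Omega> nabla"

text \<open>Disposes of the terms in which a degree would be taken of zero.\<close>

lemma R_zero_entry:
  assumes ps: "homog ps" and j: "j < length ps" and zero: "snd (ps ! j) = 0"
  shows "R ps = 0"
proof -
  have *: "ps = take j ps @ (fst (ps ! j), 0) # drop (Suc j) ps"
    using id_take_nth_drop [OF j] zero by (metis prod.collapse)
  have "homog (take j ps)" "homog (drop (Suc j) ps)"
    using ps by (auto simp: homogeneous_list_def dest: in_set_takeD in_set_dropD)
  then show ?thesis
    by (subst *) (rule R_zero)
qed

lemma cov_zero_left: "e \<in> cmp B n \<Longrightarrow> cov B nabla 0 e = 0"
  using additive_onD(1) [OF cov_additive_left [OF _ B_sub] B_sub] by blast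

text \<open>The signs on the left use \<open>deg\<close>, which is uncontrolled at zero. If
  \<open>b\<close> or an entry before position \<open>i\<close> is zero, the term itself vanishes,
  so the degrees agree wherever they count.\<close>

lemma after_derivation_eq_tensor_der:
  assumes b: "b \<in> cmp B m" and es: "homog es"
    and F: "\<And>qs. homog qs \<Longrightarrow> length qs = length es \<Longrightarrow> F (map snd qs) = R qs"
  shows "after_derivation B (deg B b) (cov B nabla b) F (map snd es) = tensor_der m (cov B nabla b) R es"
  unfolding after_derivation_def tensor_der_conv_sum
proof (rule sum.cong)
  fix i assume "i \<in> {..<length es}"
  then have i: "i < length es" by simp
  let ?q = "(fst (es ! i) + m, cov B nabla b (snd (es ! i)))"
  let ?qs = "es[i := ?q]"
  have "snd (es ! i) \<in> cmp B (fst (es ! i))"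
    using es i by (simp add: homogeneous_list_def)
  then have q: "snd ?q \<in> cmp B (fst ?q)" and q0: "b = 0 \<Longrightarrow> snd ?q = 0"
    using cov_in [OF b] cov_zero_left by auto
  have qs: "homog ?qs"
    using es q set_update_subset_insert [of es i ?q] unfolding homogeneous_list_def by blast
  have "(map snd es)[i := cov B nabla b (map snd es ! i)] = map snd ?qs"
    using i by (simp add: map_update)
  then have F_eq: "F ((map snd es)[i := cov B nabla b (map snd es ! i)]) = R ?qs"
    using F [OF qs] by simp
  show "sg (deg B b * (\<Sum>j<i. deg B (map snd es ! j))) (F ((map snd es)[i := cov B nabla b (map snd es ! i)]))
      = sg (m * (\<Sum>j<i. fst (es ! j))) (R ?qs)"
  proof (cases "R ?qs = 0")
    case False
    have "b \<noteq> 0"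
      using R_zero_entry [OF qs, of i] i q0 False by auto
    then have "deg B b = m"
      by (rule deg_eq [OF graded_space_dual b])
    moreover have "deg B (map snd es ! j) = fst (es ! j)" if j: "j < i" for j
    proof -
      have "snd (es ! j) \<noteq> 0"
        using R_zero_entry [OF qs, of j] j i False by auto
      moreover have "snd (es ! j) \<in> cmp B (fst (es ! j))"
        using es i j by (simp add: homogeneous_list_def)
      ultimately show ?thesis
        using deg_eq [OF graded_space_dual] i j by simp
    qed
    ultimately show ?thesis
      by (simp add: F_eq)
  qed (simp add: F_eq)
qed simp

lemma sg_deg_cov:
  assumes b: "b \<in> cmp B m" and e: "e \<in> cmp B n"
  shows "sg (deg B b) (cov B nabla b e) = sg m (cov B nabla b e)"
proof (cases "b = 0")
  case True
  then show ?thesis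
    using cov_zero_left [OF e] by simp
next
  case False
  show ?thesis
    by (simp only: deg_eq [OF graded_space_dual b False])
qed

lemma atiyah_map_eq_R: "homog ps \<Longrightarrow> ps \<noteq> [] \<Longrightarrow> l (length ps) (map snd ps) = R ps"
proof (induction "length ps" arbitrary: ps rule: less_induct)
  case less
  then obtain m b es where ps: "ps = (m, b) # es"
    by (cases ps) auto
  have b: "b \<in> cmp B m" and es: "homog es"
    using less.prems ps by auto
  consider "es = []" | n e where "es = [(n, e)]" | k where "length es = Suc (Suc k)"
    by (metis length_0_conv length_Suc_conv not0_implies_Suc prod.exhaust)
  then show ?case
  proof cases
    case 1
    then show ?thesis by (simp add: ps)
  next
    case (2 n e)
    then have e: "e \<in> cmp B n"
      using es by simp
    show ?thesis
      using sg_deg_cov [OF b dual_diff_in [OF e]] by (simp add: ps 2 Let_def R_Cons)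
  next
    case (3 k)
    have IH: "l (Suc (Suc k)) (map snd qs) = R qs" if "homog qs" "length qs = length es" for qs
      using less.hyps [of qs] that 3 ps by (cases qs) auto
    have es_ne: "es \<noteq> []"
      using 3 by auto
    then have "R es \<in> cmp B (total_deg es + 1)"
      by (rule R_in [OF es])
    moreover have "l (length ps) (map snd ps)
        = sg (deg B b) (cov B nabla b (l (Suc (Suc k)) (map snd es)))
          - after_derivation B (deg B b) (cov B nabla b) (l (Suc (Suc k))) (map snd es)"
      by (simp add: ps 3 Let_def)
    moreover have "R ps = sg m (cov B nabla b (R es)) - tensor_der m (cov B nabla b) R es"
      using R_Cons [OF es_ne, of "(m, b)"] by (simp add: ps 3)
    ultimately show ?thesis
      using after_derivation_eq_tensor_der [OF b es IH] IH [OF es] sg_deg_cov [OF b] by simp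
  qed
qed

section \<open>Multilinearity of the structure maps\<close>

lemma zip_homog:
  assumes "has_degs B ns vs"
  shows "homog (zip ns vs)" "map snd (zip ns vs) = vs" "length (zip ns vs) = length vs"
    "length ns = length vs" "total_deg (zip ns vs) = sum_list ns"
  using assms list_all2_lengthD [of _ ns vs]
  by (auto simp: has_degs_def homogeneous_list_def total_deg_def list_all2_iff)

lemma atiyah_map_update:
  assumes vs: "has_degs B ns vs" and i: "i < length vs" and x: "x \<in> cmp B m"
  shows "l (length vs) (vs[i := x]) = R (take i (zip ns vs) @ (m, x) # drop (Suc i) (zip ns vs))"
proof -
  let ?ps = "take i (zip ns vs) @ (m, x) # drop (Suc i) (zip ns vs)"
  have "homog ?ps"
    using zip_homog(1) [OF vs] x by (auto simp: homogeneous_list_def dest: in_set_takeD in_set_dropD)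
  moreover have "map snd ?ps = vs[i := x]" "length ?ps = length vs"
    using i zip_homog(2,4) [OF vs] by (simp_all add: upd_conv_take_nth_drop flip: take_map drop_map)
  ultimately show ?thesis
    using atiyah_map_eq_R [of ?ps] by auto
qed

lemma has_degs_nth: "has_degs B ns vs \<Longrightarrow> i < length vs \<Longrightarrow> vs ! i \<in> cmp B (ns ! i)"
  by (simp add: has_degs_def list_all2_conv_all_nth)

lemma take_drop_zip_homog:
  assumes "has_degs B ns vs"
  shows "homog (take i (zip ns vs))" "homog (drop i (zip ns vs))"
  using zip_homog(1) [OF assms] by (auto simp: homogeneous_list_def dest: in_set_takeD in_set_dropD)

lemma total_deg_take_zip:
  assumes "has_degs B ns vs" "i < length vs"
  shows "total_deg (take i (zip ns vs)) = (\<Sum>j<i. ns ! j)"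
proof -
  have "total_deg (take i (zip ns vs)) = sum_list (take i ns)"
    using zip_homog(4) [OF assms(1)] by (simp add: total_deg_def flip: take_map)
  then show ?thesis
    using zip_homog(4) [OF assms(1)] assms(2) by (simp add: sum_list_sum_nth atLeast0LessThan)
qed

lemma atiyah_map_act:
  assumes vs: "has_degs B ns vs" and k: "2 \<le> length vs" and i: "i < length vs" and a: "a \<in> cmp A p"
  shows "l (length vs) (vs[i := act B a (vs ! i)])
    = sg (p * (1 + (\<Sum>j<i. ns ! j))) (act B a (l (length vs) vs))"
proof -
  let ?xs = "take i (zip ns vs)" and ?ys = "drop (Suc i) (zip ns vs)"
  have vi: "vs ! i \<in> cmp B (ns ! i)"
    by (rule has_degs_nth [OF vs i])
  have "l (length vs) vs = R (?xs @ (ns ! i, vs ! i) # ?ys)"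
    using atiyah_map_update [OF vs i vi] by simp
  moreover have "l (length vs) (vs[i := act B a (vs ! i)]) = R (?xs @ (p + ns ! i, act B a (vs ! i)) # ?ys)"
    by (rule atiyah_map_update [OF vs i dual_act_in [OF a vi]])
  moreover have "length ?xs + Suc (length ?ys) = length vs"
    using i zip_homog(3) [OF vs] by simp
  then have "slot_linear R (length ?xs + Suc (length ?ys))"
    by (simp only: slot_linear_R [OF k])
  ultimately show ?thesis
    using slot_linearD [of R ?xs ?ys a p "vs ! i" "ns ! i"] take_drop_zip_homog [OF vs] a vi
      total_deg_take_zip [OF vs i] by simp
qed

text \<open>The field acts through \<open>scl A c 1\<close>, which has degree zero, so linearity
  over the field is a sign-free case of linearity over the algebra.\<close>

lemma scl_eq_act:
  assumes f: "f \<in> cmp B n"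
  shows "scl B c f = act B (scl A c 1) f"
  using graded_moduleD(5) [OF graded_module_dual A(2) f] graded_moduleD(8) [OF graded_module_dual f] by simp

lemma multilinear_deg_one_atiyah_map:
  assumes k: "1 \<le> k"
  shows "multilinear_deg_one B k (l k)"
  unfolding multilinear_deg_one_def
proof (intro allI impI conjI ballI; elim conjE)
  fix ns vs assume len: "length vs = k" and vs: "has_degs B ns vs"
  show l_in: "l k vs \<in> cmp B (sum_list ns + 1)"
  proof -
    have "zip ns vs \<noteq> []"
      using k len zip_homog(4) [OF vs] by (cases vs; cases ns) auto
    then show ?thesis
      using atiyah_map_eq_R [of "zip ns vs"] R_in [of "zip ns vs"] zip_homog [OF vs] len by simp
  qed
  fix i assume "i < k"
  then have i: "i < length vs"
    using len by simp
  have vi: "vs ! i \<in> cmp B (ns ! i)"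
    by (rule has_degs_nth [OF vs i])
  have l_vs: "l k vs = R (take i (zip ns vs) @ (ns ! i, vs ! i) # drop (Suc i) (zip ns vs))"
    using atiyah_map_update [OF vs i vi] len by simp
  show "l k (vs[i := vs ! i + u]) = l k vs + l k (vs[i := u])" if u: "u \<in> cmp B (ns ! i)" for u
    using additive_onD(2) [OF R_additive subgroup vi u] take_drop_zip_homog [OF vs] l_vs
      atiyah_map_update [OF vs i u] atiyah_map_update [OF vs i dual_add_in [OF vi u]] len by simp
  show "l k (vs[i := scl B c (vs ! i)]) = scl B c (l k vs)" for c
  proof (cases "2 \<le> k")
    case True
    have "scl A c 1 \<in> cmp A 0"
      by (rule graded_space_scl_in [OF A(1,2)])
    then show ?thesis
      using atiyah_map_act [OF vs _ i, of "scl A c 1" 0] True len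
      by (simp only: scl_eq_act [OF vi] scl_eq_act [OF l_in] mult_zero_left sg_0)
  next
    \<comment> \<open>The first bracket is not linear over the algebra; its linearity over the field
      is that of the differential.\<close>
    case False
    then have "k = 1"
      using k by simp
    with len obtain v where v: "vs = [v]" "k = 1"
      by (auto simp: length_Suc_conv)
    then show ?thesis
      using graded_linearD(3) [OF graded_linear_dual_diff, of v "ns ! 0" c] vi i by simp
  qed
qed

section \<open>The Leibniz identities in indexed form\<close>

lemma leibniz_infinity_atiyah_map: "leibniz_infinity B l"
  unfolding leibniz_infinity_def
proof (intro conjI allI impI)
  show "graded_space B"
    by (rule graded_space_dual)
  show "multilinear_deg_one B k (l k)" if "1 \<le> k" for k
    by (rule multilinear_deg_one_atiyah_map [OF that])
  fix n :: nat and v :: "nat \<Rightarrow> 'w \<Rightarrow> 'a" and g :: "nat \<Rightarrow> int"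
  assume n: "1 \<le> n" and v: "\<forall>r\<in>{1..n}. v r \<in> cmp B (g r)"
  \<comment> \<open>The labels are the prescribed degrees \<open>g r\<close>, not
    \<open>deg\<close>, so the signs agree literally with those of the identity.\<close>
  define f where "f r = (g r, v r)" for r
  have f: "snd (f r) \<in> cmp B (fst (f r))" if "r \<in> {1..n}" for r
    using v that by (simp add: f_def)
  have homog_f: "homog (map f rs)" if "set rs \<subseteq> {1..n}" for rs
    using f that by (auto simp: homogeneous_list_def)
  have l_term: "sg (koszul_exponent g (k - 1) \<sigma> + (\<Sum>r=1..k - j. g (\<sigma> r)))
         (l i (map (\<lambda>r. v (\<sigma> r)) [1..<k - j + 1]
               @ [l j (map (\<lambda>r. v (\<sigma> r)) [k - j + 1..<k] @ [v k])]
               @ map v [k + 1..<n + 1]))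
      = sg (koszul_exponent (\<lambda>r. fst (f r)) (k - 1) \<sigma>)
         (bracket_term (map (\<lambda>r. f (\<sigma> r)) [1..<k - j + 1]) (map (\<lambda>r. f (\<sigma> r)) [k - j + 1..<k]) (f k)
            (map f [k + 1..<n + 1]))"
    if ij: "1 \<le> i" "1 \<le> j" "i + j = n + 1" and k: "k \<in> {j..n}" and \<sigma>: "\<sigma> \<in> shuffle (k - j) (j - 1)"
    for i j k \<sigma>
  proof -
    let ?ts = "map (\<lambda>r. f (\<sigma> r)) [1..<k - j + 1]"
    let ?ss = "map (\<lambda>r. f (\<sigma> r)) [k - j + 1..<k]"
    let ?rs = "map f [k + 1..<n + 1]"
    \<comment> \<open>The blocks have sizes \<open>k - j\<close> and \<open>j - 1\<close>, so the
      shuffle acts on the positions before the root.\<close>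
    have "\<sigma> permutes {1..k - 1}"
      using \<sigma> ij k by (simp add: shuffle_def)
    then have \<sigma>_in: "\<sigma> r \<in> {1..n}" if "r \<in> {1..k - 1}" for r
      using permutes_in_image [of \<sigma> "{1..k - 1}" r] that k by auto
    have ts: "homog ?ts" and ss: "homog ?ss"
      using f \<sigma>_in ij k by (auto simp: homogeneous_list_def simp del: upt_Suc)
    have fk: "snd (f k) \<in> cmp B (fst (f k))"
      using f ij k by simp
    have rs: "homog ?rs"
      by (rule homog_f) auto
    have inner_eq: "l j (map (\<lambda>r. v (\<sigma> r)) [k - j + 1..<k] @ [v k]) = R (?ss @ [f k])"
      using atiyah_map_eq_R [of "?ss @ [f k]"] ss fk ij k by (simp add: f_def comp_def)
    have all_homog: "homog (?ts @ inner (?ss @ [f k]) # ?rs)"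
      using ts rs ss fk inner_in [of "?ss @ [f k]"] by simp
    \<comment> \<open>\<open>k - j\<close> entries, the inner value and \<open>n - k\<close>
      entries: \<open>n + 1 - j = i\<close> in all.\<close>
    have len: "length (?ts @ inner (?ss @ [f k]) # ?rs) = i"
      using ij k by (auto simp del: upt_Suc)
    have vals: "map snd (?ts @ inner (?ss @ [f k]) # ?rs) = map (\<lambda>r. v (\<sigma> r)) [1..<k - j + 1]
               @ [l j (map (\<lambda>r. v (\<sigma> r)) [k - j + 1..<k] @ [v k])]
               @ map v [k + 1..<n + 1]"
      unfolding inner_eq by (simp add: f_def comp_def inner_def del: upt_Suc)
    have "l i (map (\<lambda>r. v (\<sigma> r)) [1..<k - j + 1]
               @ [l j (map (\<lambda>r. v (\<sigma> r)) [k - j + 1..<k] @ [v k])]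
               @ map v [k + 1..<n + 1]) = R (?ts @ inner (?ss @ [f k]) # ?rs)"
      using atiyah_map_eq_R [OF all_homog] unfolding len vals by blast
    moreover have "total_deg ?ts = (\<Sum>r=1..k - j. g (\<sigma> r))"
    proof -
      have "total_deg ?ts = sum_list (map (\<lambda>r. g (\<sigma> r)) [1..<k - j + 1])"
        by (simp add: total_deg_def f_def comp_def del: upt_Suc)
      also have "\<dots> = (\<Sum>r\<in>set [1..<k - j + 1]. g (\<sigma> r))"
        by (rule sum_list_distinct_conv_sum_set) simp
      also have "set [1..<k - j + 1] = {1..k - j}"
        by auto
      finally show ?thesis .
    qed
    ultimately show ?thesis
      by (simp add: bracket_term_def f_def del: upt_Suc)
  qed
  have "homog (map f [1..<n + 1])"
    by (rule homog_f) auto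
  then have "jacobiator (map f [1..<n + 1]) = 0"
    by (rule jacobiator_eq_0) (use n in simp)
  then have "unshuffle_sum bracket_term (map f [1..<n + 1]) = 0"
    by (simp only: jacobiator_def)
  then show "(\<Sum>(i, j)\<in>{(i, j). 1 \<le> i \<and> 1 \<le> j \<and> i + j = n + 1}. \<Sum>k=j..n. \<Sum>\<sigma>\<in>shuffle (k - j) (j - 1).
           sg (koszul_exponent g (k - 1) \<sigma> + (\<Sum>r=1..k - j. g (\<sigma> r)))
             (l i (map (\<lambda>r. v (\<sigma> r)) [1..<k - j + 1]
                   @ [l j (map (\<lambda>r. v (\<sigma> r)) [k - j + 1..<k] @ [v k])]
                   @ map v [k + 1..<n + 1]))) = 0"
    unfolding unshuffle_sum_shuffle
    by (rule trans [rotated]) (intro sum.cong refl; clarify; intro sum.cong refl l_term; simp)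
qed

lemma leibniz_infinity_algebra_atiyah_map: "leibniz_infinity_algebra A dA B l"
  unfolding leibniz_infinity_algebra_def module_multilinear_deg_one_def
proof (intro conjI allI impI ballI; (elim conjE)?)
  show "leibniz_infinity B l"
    by (rule leibniz_infinity_atiyah_map)
  show "dg_module A dA B (\<lambda>v. l 1 [v])"
    using dg_module_dual by simp
  show "multilinear_deg_one B k (l k)" if "2 \<le> k" for k
    using multilinear_deg_one_atiyah_map that by simp
  show "l k (vs[i := act B a (vs ! i)]) = sg (p * (1 + (\<Sum>j<i. ns ! j))) (act B a (l k vs))"
    if "2 \<le> k" "a \<in> cmp A p" "i < k" "length vs = k" "has_degs B ns vs" for k ns vs p a i
    using atiyah_map_act [of ns vs i a p] that by blast
qed

end

theorem theorem1p1:
  fixes A :: "('k::field_char_0, 'a::{ring,monoid_mult}) graded_space"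
    and dA :: "'a \<Rightarrow> 'a"
    and \<Omega> :: "('k, 'a, 'w::ab_group_add) graded_mod"
    and d\<Omega> :: "'w \<Rightarrow> 'w"
    and \<delta> :: "'a \<Rightarrow> 'w"
    and nabla :: "('w \<Rightarrow> 'a) \<Rightarrow> ('w \<times> ('w \<Rightarrow> 'a) \<Rightarrow>\<^sub>0 'k) set"
  assumes "cdga A dA"
    and "dg_module A dA \<Omega> d\<Omega>"
    and "projective_module TYPE('i) A \<Omega>"
    and "projective_module TYPE('j) A (dual A \<Omega>)"
    and "dg_derivation A dA \<Omega> d\<Omega> \<delta>"
    and "connection A \<Omega> \<delta> (dual A \<Omega>) nabla"
  shows "leibniz_infinity_algebra A dA (dual A \<Omega>) (atiyah_map A dA \<Omega> d\<Omega> nabla)"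
proof -
  interpret atiyah_connection A dA \<Omega> d\<Omega> \<delta> nabla
    by unfold_locales (fact assms)+
  show ?thesis
    by (rule leibniz_infinity_algebra_atiyah_map)
qed

end
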